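(* Let $W:=SL(2n,\mathbb{R})/SL(n,\mathbb{C})$ be the Teichmüller space of an $n$-dimensional compact complex torus, $n\geq 2$, equipped with an action of the mapping class group $\Gamma=SL(2n,\mathbb{Z})$. Then the action of $\Gamma$ on $W$ is ergodic. In particular, the set of non-ergodic complex tori has measure $0$ in the corresponding Teichmüller space $W$.
   Context: The Teichmüller space of a compact complex manifold $M$ is the quotient of the space of complex structures on $M$ by the group $\mathrm{Diff}_0(M)$ of isotopies (the connected component of the diffeomorphism group), and the mapping class group is $\mathrm{Diff}(M)/\mathrm{Diff}_0(M)$, where $\mathrm{Diff}(M)$ is the group of oriented diffeomorphisms; it acts naturally on the Teichmüller space. For an $n$-dimensional compact complex torus, the Teichmüller space is the space of complex structure operators on $\mathbb{R}^{2n}$, identified with the quotient $SL(2n,\mathbb{R})/SL(n,\mathbb{C})$, and the mapping class group is $SL(2n,\mathbb{Z})$, acting on this quotient from the left. An action of a group on a space with measure, preserving the sigma-algebra of measurable subsets and mapping measure zero sets to measure zero sets, is called ergodic if every invariant measurable subset either has measure $0$ or has complement of measure $0$. On a manifold, the notion of a measure zero subset does not depend on the choice of a Lebesgue measure, so ergodicity makes sense without fixing a measure. A complex torus, viewed as a point $I\in W$, is called ergodic if its orbit $\Gamma\cdot I$ is dense in $W$, and non-ergodic otherwise. *)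

theory Defs
  imports
    "HOL-Analysis.Analysis"
    "HOL-Algebra.Group_Action"
    "HOL-Algebra.Left_Coset"
begin

definition ergodic_action ::
    "('g, 'r) monoid_scheme \<Rightarrow> 'a measure \<Rightarrow> ('g \<Rightarrow> 'a \<Rightarrow> 'a) \<Rightarrow> bool" where
  "ergodic_action G M \<phi> \<longleftrightarrow>
     group_action G (space M) \<phi> \<and>
     (\<forall>g\<in>carrier G. \<forall>A\<in>sets M. \<phi> g ` A \<in> sets M) \<and>
     (\<forall>g\<in>carrier G. \<forall>N\<in>null_sets M. \<phi> g ` N \<in> null_sets M) \<and>
     (\<forall>A\<in>sets M. (\<forall>g\<in>carrier G. \<phi> g ` A = A) \<longrightarrow>
        A \<in> null_sets M \<or> space M - A \<in> null_sets M)"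

definition SL_real :: "(real^'m^'m) monoid" where
  "SL_real = \<lparr>carrier = {A. det A = 1}, mult = (**), one = mat 1\<rparr>"

definition SL_int :: "(real^'m^'m) monoid" where
  "SL_int = SL_real\<lparr>carrier := {A. det A = 1 \<and> (\<forall>i j. A $ i $ j \<in> \<int>)}\<rparr>"

text \<open>The real space of dimension \<open>2n\<close> is indexed by \<open>'n + 'n\<close> and identified with the
  complex space of dimension \<open>n\<close> by taking \<open>Inl\<close> for real and \<open>Inr\<close> for imaginary parts. A
  complex matrix \<open>P + iQ\<close> then becomes the real block matrix with rows \<open>(P, -Q)\<close> and
  \<open>(Q, P)\<close>.\<close>

definition realify :: "complex^'n::finite^'n \<Rightarrow> real^('n::finite + 'n)^('n + 'n)" where
  "realify A = (\<chi> i j.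
     case i of
       Inl a \<Rightarrow> (case j of Inl b \<Rightarrow> Re (A $ a $ b) | Inr b \<Rightarrow> - Im (A $ a $ b))
     | Inr a \<Rightarrow> (case j of Inl b \<Rightarrow> Im (A $ a $ b) | Inr b \<Rightarrow> Re (A $ a $ b)))"

definition SL_complex :: "(real^('n::finite + 'n)^('n + 'n)) set" where
  "SL_complex = realify ` {A. det A = 1}"

definition teich :: "(real^('n::finite + 'n)^('n + 'n)) set set" where
  "teich = lcosets\<^bsub>SL_real\<^esub> SL_complex"

definition teich_proj :: "real^('n::finite + 'n)^('n + 'n) \<Rightarrow> (real^('n::finite + 'n)^('n + 'n)) set" where
  "teich_proj g = g <#\<^bsub>SL_real\<^esub> SL_complex"

text \<open>The left action on cosets. It is restricted to the Teichmueller space because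
  \<^const>\<open>group_action\<close> works with extensional functions.\<close>

definition teich_act ::
    "real^('n::finite + 'n)^('n + 'n) \<Rightarrow> (real^('n::finite + 'n)^('n + 'n)) set \<Rightarrow> (real^('n::finite + 'n)^('n + 'n)) set"
  where "teich_act g = (\<lambda>I\<in>teich. g <#\<^bsub>SL_real\<^esub> I)"

text \<open>The quotient topology.\<close>

definition teich_top :: "(real^('n::finite + 'n)^('n + 'n)) set topology" where
  "teich_top = topology (\<lambda>U. U \<subseteq> teich \<and>
     openin (top_of_set (carrier SL_real)) {g \<in> carrier SL_real. teich_proj g \<in> U})"

text \<open>A Lebesgue measure on the manifold \<open>teich\<close>. Every matrix with positive determinant is
  uniquely \<open>t *\<^sub>R g\<close> with \<open>t > 0\<close> and \<open>det g = 1\<close>, and sending it to the coset of \<open>g\<close> is a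
  surjective submersion from an open set of matrices onto \<open>teich\<close>; \<open>teich_cone A\<close> is the
  preimage of \<open>A\<close>. As for any surjective submersion, \<open>A\<close> is Lebesgue measurable (respectively
  null) in the manifold iff \<open>teich_cone A\<close> is. The measure \<open>teich_measure\<close> is the image of
  Lebesgue measure on the unit ball. Without the restriction to the ball, the null sets
  would be the same (the sets \<open>teich_cone A\<close> are invariant under scaling), but the measure
  would take only the values zero and infinity. With it, the measure is finite, and its
  density with respect to the invariant measure, which at the coset of \<open>g\<close> is proportional
  to the integral of \<open>norm (g ** h) powr - (2n)\<^sup>2\<close> over \<open>h\<close> in the complex special linear
  group, is smooth and positive.\<close>

definition teich_cone :: "(real^('n::finite + 'n)^('n + 'n)) set set \<Rightarrow> (real^('n::finite + 'n)^('n + 'n)) set"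
  where "teich_cone A = {t *\<^sub>R g | t g. 0 < t \<and> g \<in> carrier SL_real \<and> teich_proj g \<in> A}"

definition teich_measure :: "(real^('n::finite + 'n)^('n + 'n)) set measure" where
  "teich_measure = measure_of teich {A. A \<subseteq> teich \<and> teich_cone A \<in> sets lebesgue}
     (\<lambda>A. emeasure lebesgue (teich_cone A \<inter> ball 0 1))"

definition ergodic_torus :: "(real^('n::finite + 'n)^('n + 'n)) set \<Rightarrow> bool" where
  "ergodic_torus I \<longleftrightarrow>
     teich_top closure_of (orbit SL_int teich_act I) = topspace teich_top"

text \<open>\<open>topology\<close> and \<open>measure_of\<close> are unspecified or degenerate unless their arguments satisfy
  the respective axioms, which the following facts confirm.\<close>

lemma teich_eq: "teich = teich_proj ` carrier SL_real"
  by (auto simp: teich_def LCOSETS_def teich_proj_def)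

lemma openin_teich_top:
  fixes U :: "(real^('n::finite + 'n)^('n + 'n)) set set"
  shows "openin teich_top U \<longleftrightarrow> U \<subseteq> teich \<and>
     openin (top_of_set (carrier SL_real)) {g \<in> carrier SL_real. teich_proj g \<in> U}"
proof -
  let ?P = "\<lambda>U :: (real^('n::finite + 'n)^('n + 'n)) set set. {g \<in> carrier SL_real. teich_proj g \<in> U}"
  have "istopology (\<lambda>U :: (real^('n::finite + 'n)^('n + 'n)) set set. U \<subseteq> teich \<and> openin (top_of_set (carrier SL_real)) (?P U))"
    unfolding istopology_def
  proof (intro conjI allI impI)
    fix S T :: "(real^('n::finite + 'n)^('n + 'n)) set set"
    assume "S \<subseteq> teich \<and> openin (top_of_set (carrier SL_real)) (?P S)"
      and "T \<subseteq> teich \<and> openin (top_of_set (carrier SL_real)) (?P T)"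
    moreover have "?P (S \<inter> T) = ?P S \<inter> ?P T" by auto
    ultimately show "S \<inter> T \<subseteq> teich" "openin (top_of_set (carrier SL_real)) (?P (S \<inter> T))"
      by auto
  next
    fix K :: "(real^('n::finite + 'n)^('n + 'n)) set set set"
    assume K: "\<forall>S\<in>K. S \<subseteq> teich \<and> openin (top_of_set (carrier SL_real)) (?P S)"
    have "?P (\<Union>K) = \<Union> (?P ` K)" by auto
    with K show "\<Union>K \<subseteq> teich" "openin (top_of_set (carrier SL_real)) (?P (\<Union>K))"
      by auto
  qed
  then show ?thesis
    by (simp add: teich_top_def)
qed

lemma topspace_teich_top: "topspace teich_top = (teich :: (real^('n::finite + 'n)^('n + 'n)) set set)"
proof -
  have "{g :: (real^('n::finite + 'n)^('n + 'n)). g \<in> carrier SL_real \<and> teich_proj g \<in> teich} = carrier SL_real"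
    by (auto simp: teich_eq)
  then have "openin teich_top (teich :: (real^('n::finite + 'n)^('n + 'n)) set set)"
    unfolding openin_teich_top by (metis openin_subtopology_self subset_refl)
  then show ?thesis
    by (metis openin_subset openin_teich_top openin_topspace subset_antisym)
qed

lemma det_scaleR: "det (t *\<^sub>R (A :: real^'m^'m)) = t ^ CARD('m) * det A"
  by (simp add: det_def prod.distrib sum_distrib_left ac_simps)

lemma scaleR_SL_real_unique:
  fixes g h :: "real^'m^'m"
  assumes "t *\<^sub>R g = s *\<^sub>R h" "0 < t" "0 < s"
    "g \<in> carrier SL_real" "h \<in> carrier SL_real"
  shows "t = s \<and> g = h"
proof -
  have "t ^ CARD('m) = s ^ CARD('m)"
    using arg_cong[OF assms(1), of det] assms(4,5) by (simp add: det_scaleR SL_real_def)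
  then have "t = s"
    using assms(2,3) by (metis less_imp_le power_eq_imp_eq_base zero_less_card_finite)
  with assms show ?thesis by simp
qed

lemma teich_cone_teich: "teich_cone teich = {A :: (real^('n::finite + 'n)^('n + 'n)). 0 < det A}"
proof (intro equalityI subsetI)
  fix A :: "real^('n::finite + 'n)^('n + 'n)"
  assume "A \<in> teich_cone teich"
  then show "A \<in> {A. 0 < det A}"
    by (auto simp: teich_cone_def det_scaleR SL_real_def)
next
  fix A :: "real^('n::finite + 'n)^('n + 'n)"
  assume "A \<in> {A. 0 < det A}"
  then have A: "0 < det A" by simp
  define t where "t = root CARD('n + 'n) (det A)"
  have t: "0 < t" "t ^ CARD('n + 'n) = det A"
    using A unfolding t_def
    by (auto simp del: card_sum intro!: real_root_gt_zero real_root_pow_pos)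
  have "det (inverse t *\<^sub>R A) = 1"
    using t A by (simp add: det_scaleR power_inverse del: card_sum)
  then have "inverse t *\<^sub>R A \<in> carrier SL_real"
    by (simp add: SL_real_def)
  moreover have "A = t *\<^sub>R (inverse t *\<^sub>R A)"
    using t by simp
  ultimately show "A \<in> teich_cone teich"
    using t(1) unfolding teich_cone_def teich_eq by blast
qed

lemma teich_cone_Diff: "teich_cone (A - B) = teich_cone A - teich_cone B"
  unfolding teich_cone_def by (auto dest: scaleR_SL_real_unique)

lemma teich_cone_Union: "teich_cone (\<Union> (A ` K)) = (\<Union>i\<in>K. teich_cone (A i))"
  unfolding teich_cone_def by blast

lemma teich_cone_empty: "teich_cone {} = {}"
  by (simp add: teich_cone_def)

lemma teich_cone_disjoint: "A \<inter> B = {} \<Longrightarrow> teich_cone A \<inter> teich_cone B = {}"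
  unfolding teich_cone_def by (auto dest!: scaleR_SL_real_unique)

lemma sigma_algebra_teich:
  "sigma_algebra (teich :: (real^('n::finite + 'n)^('n + 'n)) set set) {A. A \<subseteq> teich \<and> teich_cone A \<in> sets lebesgue}"
proof -
  have "open {A :: real^('n::finite + 'n)^('n + 'n). 0 < det A}"
    by (intro open_Collect_less continuous_on_const)
      (simp add: det_def continuous_intros)
  then have "teich_cone (teich :: (real^('n::finite + 'n)^('n + 'n)) set set) \<in> sets lebesgue"
    by (simp add: teich_cone_teich borel_open sets_completionI_sets)
  then show ?thesis
    by (auto simp: sigma_algebra_iff2 teich_cone_empty teich_cone_Diff teich_cone_Union)
qed

lemma space_teich_measure: "space teich_measure = teich"
  unfolding teich_measure_def by (rule space_measure_of) auto

lemma sets_teich_measure: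
  "sets teich_measure = {A. A \<subseteq> teich \<and> teich_cone A \<in> sets lebesgue}"
  unfolding teich_measure_def
  by (rule sigma_algebra.sets_measure_of_eq[OF sigma_algebra_teich])

lemma emeasure_teich_measure:
  assumes "A \<in> sets teich_measure"
  shows "emeasure teich_measure A = emeasure lebesgue (teich_cone A \<inter> ball 0 1)"
proof (rule emeasure_measure_of[OF teich_measure_def])
  show "positive (sets teich_measure) (\<lambda>A. emeasure lebesgue (teich_cone A \<inter> ball 0 1))"
    by (simp add: positive_def teich_cone_empty)
  show "countably_additive (sets teich_measure)
      (\<lambda>A. emeasure lebesgue (teich_cone A \<inter> ball 0 1))"
  proof (rule countably_additiveI)
    fix A :: "nat \<Rightarrow> (real^('n::finite + 'n)^('n + 'n)) set set"
    assume A: "range A \<subseteq> sets teich_measure" "disjoint_family A"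
    have "(\<Sum>i. emeasure lebesgue (teich_cone (A i) \<inter> ball 0 1)) =
        emeasure lebesgue (\<Union>i. teich_cone (A i) \<inter> ball 0 1)"
    proof (rule suminf_emeasure)
      show "range (\<lambda>i. teich_cone (A i) \<inter> ball 0 1) \<subseteq> sets lebesgue"
        using A(1) by (auto simp: sets_teich_measure subset_iff intro!: sets.Int)
      show "disjoint_family (\<lambda>i. teich_cone (A i) \<inter> ball 0 1)"
        using A(2) teich_cone_disjoint unfolding disjoint_family_on_def by blast
    qed
    also have "(\<Union>i. teich_cone (A i) \<inter> ball 0 1) = teich_cone (\<Union> (range A)) \<inter> ball 0 1"
      by (auto simp: teich_cone_Union)
    finally show "(\<Sum>i. emeasure lebesgue (teich_cone (A i) \<inter> ball 0 1)) =
        emeasure lebesgue (teich_cone (\<Union> (range A)) \<inter> ball 0 1)" .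
  qed
qed (use assms in \<open>auto simp: sets_teich_measure\<close>)

end

theory Submission
  imports Defs
begin

text \<open>Let \<open>m = 2n\<close>. A measurable set of tori that is invariant under \<open>\<Gamma> = SL(m,\<int>)\<close> corresponds, through its
cone, to a measurable set \<open>B\<close> of real \<open>m\<times>m\<close> matrices of positive determinant which is invariant
under \<open>\<Gamma>\<close> from the left and under positive scalars and \<open>SL(n,\<complex>)\<close> from the right. The task is to show
that \<open>B\<close> is null or conull for Lebesgue measure, which is invariant under left and right
multiplication by matrices of determinant 1 and so takes the part of Haar measure.

The reason is the Mautner phenomenon. Let \<open>D\<close> be a fundamental domain for the left action of
\<open>\<Gamma>\<close> on the matrices with determinant in \<open>(0,1)\<close>. On left \<open>\<Gamma>\<close>-invariant sets, the volume inside \<open>D\<close> does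
not change under right multiplication by matrices of determinant 1. If \<open>Ba = B\<close>, then the volume of
\<open>B - Bu\<close> inside \<open>D\<close> therefore agrees with that of \<open>B - Bv\<close> for every conjugate
\<open>v = a\<^sup>-\<^sup>k u a\<^sup>k\<close>. If \<open>D\<close> has finite volume, then that volume tends to 0 as \<open>v\<close> tends to 1, so that
\<open>B - Bu\<close> is null as soon as conjugation by \<open>a\<close> contracts \<open>u\<close> to 1 (lemma \<open>mautner\<close>). Since
\<open>n \<ge> 2\<close>, the group \<open>SL(n,\<complex>)\<close> contains real diagonal matrices that contract any transvection mixing
two different complex coordinates. The other transvections are commutators of those, and transvections
generate \<open>SL(m,\<real>)\<close>, so that \<open>B\<close> is invariant up to null sets under all matrices of positive
determinant. By Fubini such a set is null or conull (lemma \<open>null_or_conull\<close>).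

The arithmetic input is that \<open>D\<close> has finite volume (lemma \<open>emeasure_SLZ_disjoint_le\<close>). It is obtained by
counting: if \<open>K\<close> is compact with disjoint \<open>\<Gamma>\<close>-translates and determinants below 1, cut space into
cubes of side \<open>1/T\<close>. The corners of the cubes that meet \<open>K\<close>, multiplied by \<open>T\<close>, are integer matrices in
different \<open>\<Gamma>\<close>-orbits with determinant at most \<open>T\<^sup>m\<close>. Each orbit contains a Hermite normal form, and there
are only \<open>O(T\<^sup>m\<^sup>m)\<close> of these, which is the number of cubes in a unit volume.

Finally, for each member \<open>V\<close> of a countable basis of open sets that contains a matrix of positive
determinant, the matrices whose torus has an orbit that
meets the image of \<open>V\<close> form an open set of the same kind as \<open>B\<close>, hence a conull set. A torus whose
matrices lie in all of them has a dense orbit.\<close>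

section \<open>Lebesgue measure and linear bijections\<close>

lemma emeasure_lborel_translate:
  fixes B :: "'a::euclidean_space set"
  assumes [measurable]: "B \<in> sets borel"
  shows "emeasure lborel {y. y + c \<in> B} = emeasure lborel B"
proof -
  have "emeasure lborel B = emeasure (distr lborel borel ((+) c)) B"
    by (simp add: lborel_distr_plus)
  also have "\<dots> = emeasure lborel {y. y + c \<in> B}"
    by (subst emeasure_distr) (auto simp: vimage_def add.commute)
  finally show ?thesis ..
qed

lemma emeasure_lborel_open_nonzero:
  fixes S :: "'a::euclidean_space set"
  assumes "S \<noteq> {}" "open S"
  shows "emeasure lborel S \<noteq> 0"
proof
  assume "emeasure lborel S = 0"
  then have "S \<in> null_sets lebesgue"
    using assms(2) by (simp add: null_sets_def borel_open)
  then show False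
    using open_not_negligible[OF assms(2,1)] by (simp add: negligible_iff_null_sets)
qed

text \<open>The factor by which a linear bijection changes volume. It plays the part of the absolute value of
the determinant, but makes sense on every Euclidean space, in particular on spaces of matrices, without
a choice of coordinates.\<close>

definition vol_factor :: "('a::euclidean_space \<Rightarrow> 'a) \<Rightarrow> real" where
  "vol_factor f = measure lborel (f ` ball 0 1) / measure lborel (ball (0::'a) 1)"

lemma bij_linear_image_borel:
  fixes f :: "'a::euclidean_space \<Rightarrow> 'a"
  assumes "linear f" "bij f" "B \<in> sets borel"
  shows "f ` B \<in> sets borel"
proof -
  have "linear (inv_into UNIV f)"
    using assms(1,2) by (simp add: bij_betw_def inj_linear_imp_inv_linear)
  then have [measurable]: "inv_into UNIV f \<in> borel_measurable borel"
    by (simp add: borel_measurable_continuous_onI linear_continuous_on linear_linear)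
  have "f ` B = inv_into UNIV f -` B"
    using assms(2) by (simp add: bij_vimage_eq_inv_image bij_imp_bij_inv inv_inv_eq)
  then show ?thesis
    using assms(3) by (metis \<open>inv_into UNIV f \<in> borel_measurable borel\<close> measurable_sets_borel)
qed

text \<open>This is the uniqueness of translation invariant measures: with \<open>A\<close> the unit ball, computing the measure
of the pairs \<open>(x, y)\<close> with \<open>x \<in> A\<close> and \<open>x + f\<^sup>-\<^sup>1 y \<in> B\<close> in both orders shows that
\<open>vol A \<cdot> vol (f B) = vol (f A) \<cdot> vol B\<close>.\<close>

lemma emeasure_lborel_bij_linear_image:
  fixes f :: "'a::euclidean_space \<Rightarrow> 'a"
  assumes f: "linear f" "bij f" and B[measurable]: "B \<in> sets borel"
  shows "emeasure lborel (f ` B) = ennreal (vol_factor f) * emeasure lborel B"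
    and "0 < vol_factor f"
proof -
  define g where "g = inv_into UNIV f"
  have g: "linear g" and fg: "\<And>x. f (g x) = x" "\<And>x. g (f x) = x"
    using f unfolding g_def
    by (auto simp: bij_betw_def inj_linear_imp_inv_linear surj_f_inv_f)
  have im: "f ` S = {y. g y \<in> S}" for S
    using fg by (auto simp: image_iff) metis
  have [measurable]: "g \<in> borel_measurable borel"
    using g by (simp add: borel_measurable_continuous_onI linear_continuous_on linear_linear)
  define A where "A = ball (0::'a) 1"
  have [measurable]: "A \<in> sets borel" by (simp add: A_def)
  have A_sym: "- x \<in> A \<longleftrightarrow> x \<in> A" for x by (simp add: A_def)
  define X1 where "X1 = {z. fst z \<in> A \<and> fst z + g (snd z) \<in> B}"
  define X2 where "X2 = {z. fst z - g (snd z) \<in> A \<and> fst z \<in> B}"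
  have meas: "X1 \<in> sets (lborel \<Otimes>\<^sub>M lborel)" "X2 \<in> sets (lborel \<Otimes>\<^sub>M lborel)"
  proof -
    have "{z\<in>space (lborel \<Otimes>\<^sub>M lborel). fst z \<in> A \<and> fst z + g (snd z) \<in> B} \<in> sets (lborel \<Otimes>\<^sub>M lborel)"
      by measurable
    then show "X1 \<in> sets (lborel \<Otimes>\<^sub>M lborel)"
      by (simp add: X1_def space_pair_measure)
    have "{z\<in>space (lborel \<Otimes>\<^sub>M lborel). fst z - g (snd z) \<in> A \<and> fst z \<in> B} \<in> sets (lborel \<Otimes>\<^sub>M lborel)"
      by measurable
    then show "X2 \<in> sets (lborel \<Otimes>\<^sub>M lborel)"
      by (simp add: X2_def space_pair_measure)
  qed
  have nu: "emeasure lborel (f ` S) = emeasure lborel {y. g (y + c) \<in> S}"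
    if [measurable]: "S \<in> sets borel" for S c
    unfolding im by (subst emeasure_lborel_translate[symmetric, of _ c]) auto
  have "emeasure lborel A * emeasure lborel (f ` B) = emeasure (lborel \<Otimes>\<^sub>M lborel) X1"
  proof -
    have "emeasure lborel (Pair x -` X1) = emeasure lborel (f ` B) * indicator A x" for x
    proof (cases "x \<in> A")
      case True
      then have "Pair x -` X1 = {y. g (y + f x) \<in> B}"
        by (simp add: X1_def vimage_def linear_add[OF g] fg add.commute)
      then show ?thesis using True nu[of B "f x"] by simp
    qed (simp add: X1_def vimage_def)
    then show ?thesis
      by (simp add: lborel.emeasure_pair_measure_alt[OF meas(1)] nn_integral_cmult_indicator mult.commute[of "emeasure lborel A"])
  qed
  also have "\<dots> = (\<integral>\<^sup>+y. emeasure lborel ((\<lambda>x. (x, y)) -` X1) \<partial>lborel)"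
    by (rule lborel_pair.emeasure_pair_measure_alt2[OF meas(1)])
  also have "\<dots> = (\<integral>\<^sup>+y. emeasure lborel ((\<lambda>x. (x, y)) -` X2) \<partial>lborel)"
  proof (intro nn_integral_cong)
    fix y
    have "{x. x - g y \<in> A \<and> x \<in> B} \<in> sets borel" by measurable
    from emeasure_lborel_translate[OF this, of "g y"]
    show "emeasure lborel ((\<lambda>x. (x, y)) -` X1) = emeasure lborel ((\<lambda>x. (x, y)) -` X2)"
      by (simp add: X1_def X2_def vimage_def)
  qed
  also have "\<dots> = emeasure (lborel \<Otimes>\<^sub>M lborel) X2"
    by (rule lborel_pair.emeasure_pair_measure_alt2[OF meas(2), symmetric])
  also have "\<dots> = emeasure lborel (f ` A) * emeasure lborel B"
  proof -
    have "emeasure lborel (Pair x -` X2) = emeasure lborel (f ` A) * indicator B x" for x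
    proof (cases "x \<in> B")
      case True
      have "x - g y \<in> A \<longleftrightarrow> g (y + - f x) \<in> A" for y
        using A_sym[of "x - g y"] by (simp add: linear_diff[OF g] fg)
      then have "Pair x -` X2 = {y. g (y + - f x) \<in> A}"
        using True by (simp add: X2_def vimage_def)
      then show ?thesis using True nu[of A "- f x"] by simp
    qed (simp add: X2_def vimage_def)
    then show ?thesis
      by (simp add: lborel.emeasure_pair_measure_alt[OF meas(2)] nn_integral_cmult_indicator)
  qed
  finally have *: "emeasure lborel A * emeasure lborel (f ` B) = emeasure lborel (f ` A) * emeasure lborel B" .
  have opA: "open (f ` A)"
    using f by (simp add: A_def open_surjective_linear_image bij_is_surj)
  have "bounded (f ` A)"
    by (simp add: A_def f(1) bounded_linear_image linear_linear)
  then have fin: "emeasure lborel (f ` A) < \<infinity>"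
    by (rule emeasure_bounded_finite)
  have "f ` A \<noteq> {}" by (simp add: A_def)
  then have pos: "emeasure lborel (f ` A) \<noteq> 0"
    using opA by (rule emeasure_lborel_open_nonzero)
  have finA: "emeasure lborel A < \<infinity>" and posA: "emeasure lborel A \<noteq> 0"
    unfolding A_def using emeasure_bounded_finite[OF bounded_ball[of "0::'a" 1]]
    by (auto simp: emeasure_lborel_open_nonzero)
  have e: "emeasure lborel (f ` A) = ennreal (measure lborel (f ` A))"
      "emeasure lborel A = ennreal (measure lborel A)"
    using fin finA by (simp_all add: emeasure_eq_ennreal_measure)
  have p: "0 < measure lborel (f ` A)" "0 < measure lborel A"
    using pos posA e by (metis ennreal_eq_0_iff not_le)+
  show "0 < vol_factor f"
    using p by (simp add: vol_factor_def A_def)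
  have "emeasure lborel (f ` A) = ennreal (vol_factor f) * emeasure lborel A"
    unfolding e vol_factor_def using p by (simp add: ennreal_mult[symmetric] A_def)
  with * have "emeasure lborel A * emeasure lborel (f ` B)
      = emeasure lborel A * (ennreal (vol_factor f) * emeasure lborel B)"
    by (simp add: ac_simps)
  then show "emeasure lborel (f ` B) = ennreal (vol_factor f) * emeasure lborel B"
    using finA posA by (auto simp: ennreal_mult_cancel_left)
qed

lemma
  fixes f :: "'a::euclidean_space \<Rightarrow> 'a"
  assumes f: "linear f" "bij f" and S: "S \<in> sets lebesgue"
  shows bij_linear_image_lebesgue: "f ` S \<in> sets lebesgue"
    and emeasure_lebesgue_bij_linear_image:
      "emeasure lebesgue (f ` S) = ennreal (vol_factor f) * emeasure lebesgue S"
proof -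
  obtain B N N' where S_eq: "S = B \<union> N" and N: "N \<subseteq> N'" "N' \<in> null_sets lborel" and B: "B \<in> sets borel"
    using sets_completionE[OF S] by auto
  have N': "f ` N' \<in> null_sets lborel"
    using N(2) bij_linear_image_borel[OF f, of N'] emeasure_lborel_bij_linear_image(1)[OF f, of N']
    by (auto simp: null_sets_def)
  have null: "f ` N \<in> null_sets lebesgue" "N \<in> null_sets lebesgue"
    using N N' by (meson image_mono null_sets_completion_subset null_sets_completionI subset_refl)+
  have fB: "f ` B \<in> sets borel"
    by (rule bij_linear_image_borel[OF f B])
  then show "f ` S \<in> sets lebesgue"
    unfolding S_eq image_Un using null by auto
  show "emeasure lebesgue (f ` S) = ennreal (vol_factor f) * emeasure lebesgue S"
    unfolding S_eq image_Un using null B fB emeasure_lborel_bij_linear_image(1)[OF f B]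
    by (simp add: emeasure_Un_null_set)
qed

lemma null_sets_bij_linear_image:
  fixes f :: "'a::euclidean_space \<Rightarrow> 'a"
  assumes "linear f" "bij f" "S \<in> null_sets lebesgue"
  shows "f ` S \<in> null_sets lebesgue"
  using assms bij_linear_image_lebesgue[OF assms(1,2)]
    emeasure_lebesgue_bij_linear_image[OF assms(1,2)] by (auto simp: null_sets_def)

lemma vol_factor_comp:
  fixes f g :: "'a::euclidean_space \<Rightarrow> 'a"
  assumes f: "linear f" "bij f" and g: "linear g" "bij g"
  shows "vol_factor (f \<circ> g) = vol_factor f * vol_factor g"
proof -
  have [simp]: "measure lborel (ball (0::'a) 1) \<noteq> 0"
    using content_ball_pos[of 1 "0::'a"] by simp
  have "g ` ball 0 1 \<in> sets borel"
    by (simp add: bij_linear_image_borel[OF g])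
  then have "emeasure lborel (f ` g ` ball 0 1) = ennreal (vol_factor f) * emeasure lborel (g ` ball 0 1)"
    by (rule emeasure_lborel_bij_linear_image[OF f])
  then have "measure lborel (f ` g ` ball 0 1) = vol_factor f * measure lborel (g ` ball 0 1)"
    using emeasure_lborel_bij_linear_image(2)[OF f, of "{}"] by (simp add: measure_def enn2real_mult)
  then show ?thesis
    by (simp add: vol_factor_def image_comp)
qed

lemma compact_sets_lebesgue: "compact K \<Longrightarrow> K \<in> sets lebesgue"
  by (intro fmeasurableD lmeasurable_compact)

lemma open_sets_lebesgue: "open S \<Longrightarrow> S \<in> sets lebesgue"
  by (simp add: borel_open sets_completionI_sets)

lemma lebesgue_inner_compact:
  fixes S :: "'a::euclidean_space set"
  assumes S: "S \<in> sets lebesgue" "emeasure lebesgue S < \<infinity>" and e: "0 < e"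
  obtains K where "compact K" "K \<subseteq> S" "emeasure lebesgue (S - K) < e"
proof -
  obtain N C where N: "negligible N" and C: "\<And>n::nat. compact (C n)" "S = (\<Union>n. C n) \<union> N"
    using lebesgue_regular_inner[OF S(1)] by blast
  define R where "R n = S - (\<Union>i\<le>n. C i)" for n
  have comp: "compact (\<Union>i\<le>n. C i)" for n
    using C(1) by (intro compact_UN) auto
  have R: "R n \<in> sets lebesgue" for n
    unfolding R_def by (rule sets.Diff[OF S(1) compact_sets_lebesgue[OF comp]])
  have "(\<lambda>n. emeasure lebesgue (R n)) \<longlonglongrightarrow> emeasure lebesgue (\<Inter>n. R n)"
  proof (rule Lim_emeasure_decseq)
    show "range R \<subseteq> sets lebesgue" using R by auto
    show "decseq R" unfolding decseq_def R_def by (intro allI impI Diff_mono UN_mono) auto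
    have "emeasure lebesgue (R n) \<le> emeasure lebesgue S" for n
      using S(1) by (intro emeasure_mono) (auto simp: R_def)
    then show "emeasure lebesgue (R n) \<noteq> \<infinity>" for n
      using S(2) by (metis leD)
  qed
  moreover have "emeasure lebesgue (\<Inter>n. R n) = 0"
  proof -
    have "(\<Inter>n. R n) \<subseteq> N" using C(2) by (auto simp: R_def)
    then have "negligible (\<Inter>n. R n)" using N negligible_subset by blast
    then show ?thesis by (simp add: negligible_iff_null_sets null_sets_def)
  qed
  ultimately have "\<forall>\<^sub>F n in sequentially. emeasure lebesgue (R n) < e"
    using e by (simp add: order_tendstoD(2))
  then obtain n where "emeasure lebesgue (R n) < e"
    using eventually_happens'[OF sequentially_bot] by blast
  then show thesis
    using that[OF comp[of n]] C(2) by (auto simp: R_def)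
qed

lemma borel_conull_subset:
  fixes S :: "'a::euclidean_space set"
  assumes "S \<in> sets lebesgue"
  obtains T where "T \<in> sets borel" "T \<subseteq> S" "S - T \<in> null_sets lebesgue"
proof -
  obtain T N N' where T: "S = T \<union> N" "N \<subseteq> N'" "N' \<in> null_sets lborel" "T \<in> sets lborel"
    using sets_completionE[OF assms] by blast
  have "S - T \<subseteq> N'" using T by auto
  then have "S - T \<in> null_sets lebesgue"
    using T(3) by (rule null_sets_completion_subset[rotated, OF null_sets_completionI, rotated])
  then show thesis using that[of T] T by auto
qed

lemma bij_scaleR_pos: "0 < c \<Longrightarrow> bij ((*\<^sub>R) c :: 'a::real_vector \<Rightarrow> 'a)"
  by (rule o_bij[of "(*\<^sub>R) (inverse c)"]) (auto simp: fun_eq_iff)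

section \<open>Transvections\<close>

definition transvection :: "'m \<Rightarrow> 'm \<Rightarrow> real \<Rightarrow> real^'m^'m::finite" where
  "transvection i j c = (\<chi> k l. if k = i \<and> l = j then c else of_bool (k = l))"

definition diag_mat :: "('m \<Rightarrow> real) \<Rightarrow> real^'m^'m::finite" where
  "diag_mat d = (\<chi> k l. if k = l then d k else 0)"

lemma transvection_mult_vec:
  assumes "i \<noteq> j"
  shows "transvection i j c *v x = (\<chi> k. if k = i then x $ i + c * x $ j else x $ k)"
proof -
  have "(\<Sum>l\<in>UNIV. (if k = i \<and> l = j then c else of_bool (k = l)) * x $ l)
      = (if k = i then x $ i + c * x $ j else x $ k)" for k
  proof -
    have "(if k = i \<and> l = j then c else of_bool (k = l)) * x $ l
      = (if l = k then x $ k else 0) + (if l = j then (if k = i then c * x $ j else 0) else 0)" for l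
      using assms by auto
    then show ?thesis by (simp add: sum.distrib)
  qed
  then show ?thesis by (simp add: transvection_def matrix_vector_mult_def)
qed

lemma diag_mat_mult_vec: "diag_mat d *v x = (\<chi> k. d k * x $ k)"
proof -
  have "(if k = l then d k else 0) * x $ l = (if l = k then d k * x $ k else 0)" for k l
    by auto
  then show ?thesis by (simp add: diag_mat_def matrix_vector_mult_def)
qed

lemma transvection_add:
  "i \<noteq> j \<Longrightarrow> transvection i j a ** transvection i j b = transvection i j (a + b)"
  by (simp add: matrix_eq transvection_mult_vec vec_eq_iff algebra_simps flip: matrix_vector_mul_assoc)

lemma transvection_0: "i \<noteq> j \<Longrightarrow> transvection i j 0 = mat 1"
  by (simp add: matrix_eq transvection_mult_vec vec_eq_iff)

lemma diag_mat_transvection: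
  assumes "i \<noteq> j" "d j \<noteq> 0"
  shows "diag_mat d ** transvection i j c = transvection i j (d i * c / d j) ** diag_mat d"
  using assms
  by (simp add: matrix_eq transvection_mult_vec diag_mat_mult_vec vec_eq_iff algebra_simps
      flip: matrix_vector_mul_assoc)

lemma diag_mat_mult: "diag_mat d ** diag_mat e = diag_mat (\<lambda>i. d i * e i)"
  by (simp add: matrix_eq diag_mat_mult_vec vec_eq_iff flip: matrix_vector_mul_assoc)

lemma diag_mat_1: "diag_mat (\<lambda>i. 1) = mat 1"
  by (simp add: matrix_eq diag_mat_mult_vec vec_eq_iff)

lemma det_diag_mat: "det (diag_mat d) = (\<Prod>i\<in>UNIV. d i)"
  by (subst det_diagonal) (auto simp: diag_mat_def)

text \<open>Conjugation by a diagonal matrix turns \<open>transvection i j c\<close> into its own square, so its image in the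
commutative multiplicative monoid of the reals is idempotent. This is how the determinant and the volume factor
of a transvection are computed below.\<close>

lemma transvection_hom_trivial:
  fixes h :: "real^'m^'m::finite \<Rightarrow> real"
  assumes mult: "\<And>A B. det A \<noteq> 0 \<Longrightarrow> det B \<noteq> 0 \<Longrightarrow> h (A ** B) = h A * h B"
    and one: "h (mat 1) = 1" and ij: "i \<noteq> j"
    and det: "\<And>c. det (transvection i j c :: real^'m^'m) \<noteq> 0"
  shows "h (transvection i j c) = 1"
proof -
  define d where "d = (\<lambda>k. if k = i then 2 else 1 :: real)"
  have D: "det (diag_mat d :: real^'m^'m) \<noteq> 0"
    by (simp add: det_diag_mat d_def)
  have D': "det (diag_mat (\<lambda>k. inverse (d k)) :: real^'m^'m) \<noteq> 0"
    by (simp add: det_diag_mat d_def)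
  have "h (diag_mat d) * h (diag_mat (\<lambda>k. inverse (d k))) = 1"
    using mult[OF D D'] one by (simp add: diag_mat_mult d_def diag_mat_1 if_distrib cong: if_cong)
  then have nz: "h (diag_mat d) \<noteq> 0" by auto
  have "diag_mat d ** transvection i j c = transvection i j (c + c) ** diag_mat d"
    using diag_mat_transvection[OF ij, of d c] ij by (simp add: d_def)
  from arg_cong[OF this, of h] have "h (transvection i j c) = h (transvection i j (c + c))"
    using nz by (simp add: mult D det)
  also have "\<dots> = h (transvection i j c) * h (transvection i j c)"
    using mult[OF det det, of c c] transvection_add[OF ij, of c c] by simp
  finally have "h (transvection i j c) = 0 \<or> h (transvection i j c) = 1" by simp
  moreover have "h (transvection i j c) * h (transvection i j (- c)) = 1"
    using mult[OF det det, of c "- c"] one by (simp add: transvection_add ij transvection_0)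
  ultimately show ?thesis by auto
qed

lemma det_transvection:
  assumes "i \<noteq> j"
  shows "det (transvection i j c) = 1"
proof (rule transvection_hom_trivial[OF _ _ assms])
  fix c
  have "det (transvection i j c ** transvection i j (- c)) = 1"
    by (simp add: transvection_add[OF assms] transvection_0[OF assms])
  then show "det (transvection i j c) \<noteq> 0"
    by (auto simp: det_mul)
qed (simp_all add: det_mul)

inductive elementary :: "real^'m^'m::finite \<Rightarrow> bool" where
  elementary_1: "elementary (mat 1)"
| elementary_step: "i \<noteq> j \<Longrightarrow> elementary A \<Longrightarrow> elementary (transvection i j c ** A)"

lemma elementary_transvection: "i \<noteq> j \<Longrightarrow> elementary (transvection i j c)"
  using elementary_step[OF _ elementary_1, of i j c] by simp

lemma elementary_mult: "elementary A \<Longrightarrow> elementary B \<Longrightarrow> elementary (A ** B)"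
  by (induction A rule: elementary.induct)
    (simp_all add: elementary_step flip: matrix_mul_assoc)

lemma elementary_diag_comm:
  assumes "elementary A" "\<And>i. d i \<noteq> 0"
  shows "\<exists>B. elementary B \<and> diag_mat d ** A = B ** diag_mat d"
  using assms(1)
proof (induction A rule: elementary.induct)
  case elementary_1
  show ?case using elementary.elementary_1 by force
next
  case (elementary_step i j A c)
  then obtain B where B: "elementary B" "diag_mat d ** A = B ** diag_mat d" by blast
  have "diag_mat d ** (transvection i j c ** A) = transvection i j (d i * c / d j) ** B ** diag_mat d"
    using diag_mat_transvection[OF elementary_step(1), of d c] assms(2)[of j] B(2)
    by (metis matrix_mul_assoc)
  then show ?case
    using elementary.elementary_step[OF elementary_step(1) B(1)] by blast
qed

text \<open>A signed permutation matrix for \<open>t = 1\<close>, and in general the standard product of three transvections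
that exchanges the coordinates \<open>i\<close> and \<open>j\<close> up to the factors \<open>t\<close> and \<open>-1/t\<close>.\<close>

definition weyl :: "'m \<Rightarrow> 'm \<Rightarrow> real \<Rightarrow> real^'m^'m::finite" where
  "weyl i j t = transvection i j t ** (transvection j i (- inverse t) ** transvection i j t)"

lemma elementary_weyl: "i \<noteq> j \<Longrightarrow> elementary (weyl i j t)"
  unfolding weyl_def by (intro elementary_mult elementary_transvection) auto

lemma weyl_mult_vec:
  assumes "i \<noteq> j" "t \<noteq> 0"
  shows "weyl i j t *v x = (\<chi> k. if k = i then t * x $ j else if k = j then - inverse t * x $ i else x $ k)"
  using assms
  by (simp add: weyl_def transvection_mult_vec vec_eq_iff field_simps flip: matrix_vector_mul_assoc)

lemma elementary_diag_pair:
  assumes ij: "i \<noteq> j" and "t \<noteq> 0"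
  shows "elementary (diag_mat (\<lambda>k. if k = i then t else if k = j then inverse t else 1))"
proof -
  have "diag_mat (\<lambda>k. if k = i then t else if k = j then inverse t else 1) = weyl i j t ** weyl i j (-1)"
    using assms
    by (simp add: matrix_eq weyl_mult_vec diag_mat_mult_vec vec_eq_iff flip: matrix_vector_mul_assoc)
  then show ?thesis
    by (simp add: elementary_mult elementary_weyl ij)
qed

text \<open>Collect the diagonal entries one at a time in the position \<open>i0\<close>, using the diagonal matrices with two
mutually inverse entries.\<close>

lemma elementary_diag_mat:
  fixes d :: "'m::finite \<Rightarrow> real"
  assumes "(\<Prod>i\<in>UNIV. d i) = 1"
  shows "elementary (diag_mat d)"
proof -
  obtain i0 :: 'm where True by simp
  have nz: "d i \<noteq> 0" for i
    using assms by (metis finite_class.finite_UNIV UNIV_I prod_zero_iff zero_neq_one)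
  have "elementary (diag_mat (\<lambda>k. if k = i0 then inverse (\<Prod>i\<in>F. d i) else if k \<in> F then d k else 1))"
    if "i0 \<notin> F" for F
    using finite[of F] that
  proof (induction F rule: finite_induct)
    case empty
    then show ?case using elementary_1 by (simp add: diag_mat_1 cong: if_cong)
  next
    case (insert x F)
    then have "x \<noteq> i0" "x \<notin> F" by auto
    have "diag_mat (\<lambda>k. if k = i0 then inverse (\<Prod>i\<in>insert x F. d i) else if k \<in> insert x F then d k else 1)
      = diag_mat (\<lambda>k. if k = x then d x else if k = i0 then inverse (d x) else 1) **
        diag_mat (\<lambda>k. if k = i0 then inverse (\<Prod>i\<in>F. d i) else if k \<in> F then d k else 1)"
      unfolding diag_mat_mult using insert \<open>x \<noteq> i0\<close>
      by (intro arg_cong[where f=diag_mat]) auto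
    then show ?case
      using insert elementary_diag_pair[OF \<open>x \<noteq> i0\<close> nz[of x]] by (auto intro!: elementary_mult)
  qed
  note ex = this[of "UNIV - {i0}"]
  have "(\<lambda>k. if k = i0 then inverse (\<Prod>i\<in>UNIV - {i0}. d i) else if k \<in> UNIV - {i0} then d k else 1)
      = (\<lambda>k. if k = i0 then inverse (\<Prod>i\<in>UNIV - {i0}. d i) else d k)"
    by auto
  with ex have "elementary (diag_mat (\<lambda>k. if k = i0 then inverse (\<Prod>i\<in>UNIV - {i0}. d i) else d k))"
    by simp
  moreover have "inverse (\<Prod>i\<in>UNIV - {i0}. d i) = d i0"
    using assms prod.remove[of UNIV i0 d] by (simp add: inverse_unique mult.commute)
  then have "(\<lambda>k. if k = i0 then inverse (\<Prod>i\<in>UNIV - {i0}. d i) else d k) = d"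
    by auto
  ultimately show ?thesis
    by metis
qed

text \<open>Diagonal matrices normalise the group of elementary matrices, so the matrices of this form are closed under
multiplication; they contain all generators of Gaussian elimination.\<close>

lemma elementary_times_diag:
  fixes A :: "real^'m^'m::finite"
  shows "det A \<noteq> 0 \<Longrightarrow> \<exists>E d. elementary E \<and> A = E ** diag_mat d"
proof (induction A rule: induct_matrix_elementary)
  case (1 A B)
  then obtain E d F e where *: "elementary E" "A = E ** diag_mat d" "elementary F" "B = F ** diag_mat e"
    by (auto simp: det_mul)
  have "d i \<noteq> 0" for i
    using 1 by (auto simp: det_mul * det_diag_mat)
  then obtain F' where F': "elementary F'" "diag_mat d ** F = F' ** diag_mat d"
    using elementary_diag_comm[OF *(3)] by blast
  have "A ** B = E ** (diag_mat d ** F) ** diag_mat e"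
    by (simp add: * matrix_mul_assoc)
  also have "\<dots> = (E ** F') ** diag_mat (\<lambda>i. d i * e i)"
    by (simp add: F' flip: matrix_mul_assoc diag_mat_mult)
  finally show ?case using elementary_mult[OF *(1) F'(1)] by blast
next
  case (2 A i)
  then show ?case by (simp add: det_zero_row)
next
  case (3 A)
  then have "A = mat 1 ** diag_mat (\<lambda>i. A $ i $ i)"
    by (simp add: diag_mat_def vec_eq_iff)
  then show ?case using elementary_1 by blast
next
  case (4 m n)
  have "(\<chi> i j. mat 1 $ i $ Transposition.transpose m n j) = weyl m n 1 ** diag_mat (\<lambda>k. if k = m then -1 else 1)"
  proof (unfold matrix_eq, intro allI)
    fix x :: "real^'m"
    have "(\<Sum>j\<in>UNIV. mat 1 $ i $ Transposition.transpose m n j * x $ j) = x $ Transposition.transpose m n i" for i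
    proof -
      have "mat 1 $ i $ Transposition.transpose m n j * x $ j
          = (if j = Transposition.transpose m n i then x $ Transposition.transpose m n i else 0)" for j
        by (auto simp: mat_def)
      then show ?thesis by simp
    qed
    then have "(\<chi> i j. mat 1 $ i $ Transposition.transpose m n j) *v x = (\<chi> i. x $ Transposition.transpose m n i)"
      by (simp add: matrix_vector_mult_def)
    also have "\<dots> = weyl m n 1 ** diag_mat (\<lambda>k. if k = m then -1 else 1) *v x"
      using 4 by (auto simp: weyl_mult_vec diag_mat_mult_vec vec_eq_iff Transposition.transpose_def
          simp flip: matrix_vector_mul_assoc)
    finally show "(\<chi> i j. mat 1 $ i $ Transposition.transpose m n j) *v x = weyl m n 1 ** diag_mat (\<lambda>k. if k = m then -1 else 1) *v x" .
  qed
  then show ?case using elementary_weyl[OF 4(1)] by blast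
next
  case (5 m n c)
  have "(\<chi> i j. if i = m \<and> j = n then c else of_bool (i = j)) = transvection m n c ** diag_mat (\<lambda>i. 1)"
    by (simp add: transvection_def diag_mat_1)
  then show ?case using elementary_transvection[OF 5(1)] by blast
qed

lemma det_elementary: "elementary A \<Longrightarrow> det A = 1"
  by (induction A rule: elementary.induct) (simp_all add: det_mul det_transvection)

lemma det_1_imp_elementary:
  assumes "det A = 1"
  shows "elementary A"
proof -
  obtain E d where *: "elementary E" "A = E ** diag_mat d"
    using elementary_times_diag[of A] assms by auto
  then have "(\<Prod>i\<in>UNIV. d i) = 1"
    using assms by (simp add: det_mul det_elementary det_diag_mat)
  then show ?thesis
    by (simp add: * elementary_mult elementary_diag_mat)
qed

lemma det_1_induct [consumes 1, case_names one transvection]: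
  assumes "det A = 1" "P (mat 1)"
    and "\<And>i j c A. i \<noteq> j \<Longrightarrow> det A = 1 \<Longrightarrow> P A \<Longrightarrow> P (transvection i j c ** A)"
  shows "P A"
  using det_1_imp_elementary[OF assms(1)]
  by (induction A rule: elementary.induct) (auto intro: assms det_elementary)

lemma SL_hom_trivial:
  fixes h :: "real^'m^'m::finite \<Rightarrow> real"
  assumes mult: "\<And>A B. det A \<noteq> 0 \<Longrightarrow> det B \<noteq> 0 \<Longrightarrow> h (A ** B) = h A * h B"
    and one: "h (mat 1) = 1" and "det A = 1"
  shows "h A = 1"
  using assms(3)
proof (induction A rule: det_1_induct)
  case (transvection i j c A)
  then show ?case
    using transvection_hom_trivial[of h, OF mult one] by (simp add: mult det_transvection)
qed (rule one)

section \<open>Hermite normal forms\<close>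

text \<open>Hermite normal form of a full rank sublattice \<open>L\<close>, with coordinates ordered by \<open>r\<close>. The \<open>i\<close>-th pivot is the least
positive \<open>i\<close>-th coordinate of a vector of \<open>L\<close> whose earlier coordinates vanish. By minimality it divides all
such coordinates, which allows both the reduction of the entries above each pivot and the expansion of every
vector of \<open>L\<close> in the basis.\<close>

lemma hermite_basis:
  fixes L :: "('m::finite \<Rightarrow> int) set" and r :: "'m \<Rightarrow> nat"
  assumes r: "inj r"
    and L: "\<And>v w k. v \<in> L \<Longrightarrow> w \<in> L \<Longrightarrow> (\<lambda>i. v i + k * w i) \<in> L"
    and full: "\<And>i. \<exists>v\<in>L. (\<forall>j. r j < r i \<longrightarrow> v j = 0) \<and> 0 < v i"
  obtains h where "\<And>i. h i \<in> L" "\<And>i j. r j < r i \<Longrightarrow> h i j = 0" "\<And>i. 0 < h i i"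
    "\<And>i j. r i < r j \<Longrightarrow> 0 \<le> h i j \<and> h i j < h j j"
    "\<And>v. v \<in> L \<Longrightarrow> \<exists>c. \<forall>j. v j = (\<Sum>i\<in>UNIV. c i * h i j)"
proof -
  define P where "P i d \<longleftrightarrow> 0 < d \<and> (\<exists>v\<in>L. (\<forall>j. r j < r i \<longrightarrow> v j = 0) \<and> v i = int d)" for i d
  define d where "d i = (LEAST d. P i d)" for i
  have "\<exists>d. P i d" for i
  proof -
    from full[of i] obtain v where v: "v \<in> L" "\<forall>j. r j < r i \<longrightarrow> v j = 0" "0 < v i" by blast
    then have "P i (nat (v i))" unfolding P_def by (intro conjI bexI[of _ v]) auto
    then show ?thesis ..
  qed
  then have Pd: "P i (d i)" for i
    unfolding d_def by (metis LeastI)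
  have d_pos: "0 < d i" for i using Pd by (simp add: P_def)
  have "\<exists>b. \<forall>i. b i \<in> L \<and> (\<forall>j. r j < r i \<longrightarrow> b i j = 0) \<and> b i i = int (d i)"
    using Pd unfolding P_def by (intro choice) blast
  then obtain b where b: "\<And>i. b i \<in> L" "\<And>i j. r j < r i \<Longrightarrow> b i j = 0" "\<And>i. b i i = int (d i)"
    by blast
  have dvd: "int (d i) dvd v i" if v: "v \<in> L" "\<And>j. r j < r i \<Longrightarrow> v j = 0" for v i
  proof (rule ccontr)
    assume "\<not> int (d i) dvd v i"
    then have pos: "0 < v i mod int (d i)"
      using d_pos[of i] by (metis dvd_eq_mod_eq_0 of_nat_0_less_iff order_le_less pos_mod_sign)
    have "v i + - (v i div int (d i)) * b i i = v i mod int (d i)"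
      by (simp add: b minus_div_mult_eq_mod[symmetric])
    moreover have "\<forall>j. r j < r i \<longrightarrow> v j + - (v i div int (d i)) * b i j = 0"
      using v(2) b(2) by simp
    moreover define w where "w = (\<lambda>j. v j + - (v i div int (d i)) * b i j)"
    moreover have "w \<in> L" unfolding w_def by (rule L[OF v(1) b(1)])
    ultimately have "w \<in> L \<and> (\<forall>j. r j < r i \<longrightarrow> w j = 0) \<and> w i = int (nat (v i mod int (d i)))"
      using pos by simp
    then have "P i (nat (v i mod int (d i)))"
      unfolding P_def using pos by (metis zero_less_nat_eq)
    then have "d i \<le> nat (v i mod int (d i))"
      unfolding d_def by (rule Least_le)
    then show False
      using pos_mod_bound[of "int (d i)" "v i"] d_pos[of i] pos by linarith
  qed
  have red: "\<exists>v\<in>L. (\<forall>j. r j < r i \<longrightarrow> v j = 0) \<and> v i = int (d i) \<and>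
      (\<forall>j. r i < r j \<and> r j < k \<longrightarrow> 0 \<le> v j \<and> v j < int (d j))" for i k
  proof (induction k)
    case 0
    show ?case by (intro bexI[of _ "b i"]) (simp_all add: b)
  next
    case (Suc k)
    then obtain v where v: "v \<in> L" "\<forall>j. r j < r i \<longrightarrow> v j = 0" "v i = int (d i)"
      "\<forall>j. r i < r j \<and> r j < k \<longrightarrow> 0 \<le> v j \<and> v j < int (d j)" by blast
    show ?case
    proof (cases "\<exists>j. r j = k \<and> r i < k")
      case False
      then show ?thesis using v by (intro bexI[of _ v]) (auto simp: less_Suc_eq)
    next
      case True
      then obtain j where j: "r j = k" "r i < k" by blast
      define w where "w l = v l + - (v j div int (d j)) * b j l" for l
      have wL: "w \<in> L" unfolding w_def by (rule L[OF v(1) b(1)])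
      have w_eq: "w l = v l" if "r l < k" for l
        using that b(2)[of l j] j by (simp add: w_def)
      have "w j = v j mod int (d j)"
        by (simp add: w_def b minus_div_mult_eq_mod[symmetric])
      then have wj: "0 \<le> w j" "w j < int (d j)" using d_pos[of j] by auto
      have "0 \<le> w l \<and> w l < int (d l)" if "r i < r l" "r l < Suc k" for l
      proof (cases "r l = k")
        case True
        then have "l = j" using j r by (metis injD)
        then show ?thesis using wj by simp
      next
        case False
        then show ?thesis using that v(4) w_eq[of l] by simp
      qed
      then show ?thesis
        using v(2,3) w_eq j by (intro bexI[OF _ wL] conjI allI impI) auto
    qed
  qed
  obtain N where N: "\<And>i. r i < N"
    using finite_nat_set_iff_bounded[of "range r"] by auto
  have "\<exists>h. \<forall>i. h i \<in> L \<and> (\<forall>j. r j < r i \<longrightarrow> h i j = 0) \<and> h i i = int (d i) \<and>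
      (\<forall>j. r i < r j \<and> r j < N \<longrightarrow> 0 \<le> h i j \<and> h i j < int (d j))"
    using red[of _ N] by (intro choice) blast
  then obtain h where h: "\<And>i. h i \<in> L" "\<And>i j. r j < r i \<Longrightarrow> h i j = 0" "\<And>i. h i i = int (d i)"
      "\<And>i j. r i < r j \<Longrightarrow> 0 \<le> h i j \<and> h i j < int (d j)"
    using N by metis
  have span: "\<exists>c. \<forall>j. v j = (\<Sum>i\<in>UNIV. c i * h i j)"
    if "v \<in> L" "\<And>j. r j < N - n \<Longrightarrow> v j = 0" for v n
    using that
  proof (induction n arbitrary: v)
    case 0
    then have "\<forall>j. v j = (\<Sum>i\<in>UNIV. 0 * h i j)" using N by simp
    then show ?case by (intro exI[of _ "\<lambda>_. 0"]) simp
  next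
    case (Suc n)
    show ?case
    proof (cases "\<exists>j. r j = N - Suc n \<and> N - n = Suc (N - Suc n)")
      case False
      have "v j = 0" if "r j < N - n" for j
      proof (rule Suc.prems(2))
        have "r j \<noteq> N - Suc n \<or> N - n \<noteq> Suc (N - Suc n)" using False by blast
        then show "r j < N - Suc n" using that by linarith
      qed
      then show ?thesis using Suc by blast
    next
      case True
      then obtain l where l: "r l = N - Suc n" "N - n = Suc (r l)" by auto
      have "int (d l) dvd v l"
        by (rule dvd) (use Suc.prems l in auto)
      then obtain q where q: "v l = int (d l) * q" by blast
      define w where "w j = v j + - q * h l j" for j
      have "w \<in> L" unfolding w_def by (rule L[OF Suc.prems(1) h(1)])
      moreover have "w j = 0" if "r j < N - n" for j
      proof (cases "j = l")
        case True
        then show ?thesis by (simp add: w_def h q)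
      next
        case False
        then have "r j \<noteq> r l" using r by (auto dest: injD)
        then have "r j < r l" using that l by simp
        then show ?thesis using Suc.prems(2)[of j] h(2)[of j l] l by (simp add: w_def)
      qed
      ultimately obtain c where c: "\<forall>j. w j = (\<Sum>i\<in>UNIV. c i * h i j)"
        using Suc.IH by blast
      have "v j = (\<Sum>i\<in>UNIV. (c i + (if i = l then q else 0)) * h i j)" for j
      proof -
        have "(\<Sum>i\<in>UNIV. (c i + (if i = l then q else 0)) * h i j)
            = (\<Sum>i\<in>UNIV. c i * h i j + (if i = l then q * h l j else 0))"
          by (intro sum.cong) (auto simp: algebra_simps)
        then show ?thesis using c by (simp add: sum.distrib w_def algebra_simps)
      qed
      then show ?thesis by (intro exI[of _ "\<lambda>i. c i + (if i = l then q else 0)"]) blast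
    qed
  qed
  show thesis
  proof (rule that[of h])
    show "\<exists>c. \<forall>j. v j = (\<Sum>i\<in>UNIV. c i * h i j)" if "v \<in> L" for v
      using span[OF that, of N] by simp
  qed (use h d_pos in auto)
qed

lemma permutes_increasing_id:
  fixes r :: "'m::finite \<Rightarrow> nat"
  assumes "inj r" "p permutes UNIV" "\<And>i. r i \<le> r (p i)"
  shows "p = id"
proof -
  have "(\<Sum>i\<in>UNIV. r i) = (\<Sum>i\<in>UNIV. r (p i))"
    using sum.permute[OF assms(2), of r] by (simp add: o_def)
  then have "r i = r (p i)" for i
    by (rule sum_mono_inv) (simp_all add: assms(3))
  then show ?thesis using assms(1) by (simp add: fun_eq_iff inj_eq)
qed

text \<open>The order of the indices is given by a ranking, because the index type need not be ordered.\<close>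

lemma det_triangular:
  fixes A :: "real^'m^'m::finite" and r :: "'m \<Rightarrow> nat"
  assumes r: "inj r" and A: "\<And>i j. r j < r i \<Longrightarrow> A $ i $ j = 0"
  shows "det A = (\<Prod>i\<in>UNIV. A $ i $ i)"
proof -
  have zero: "(\<Prod>i\<in>UNIV. A $ i $ p i) = 0" if p: "p permutes UNIV" "p \<noteq> id" for p
  proof -
    obtain i where "r (p i) < r i"
      using permutes_increasing_id[OF r p(1)] p(2) by (meson not_le)
    then show ?thesis using A by (metis UNIV_I finite prod_zero_iff)
  qed
  have "det A = (\<Sum>p\<in>{p. p permutes (UNIV :: 'm set)}. if p = id then \<Prod>i\<in>UNIV. A $ i $ i else 0)"
    unfolding det_def by (rule sum.cong[OF refl]) (use zero in auto)
  then show ?thesis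
    by (simp add: permutes_id sum.delta' finite_permutations)
qed

lemma det_Ints:
  fixes A :: "real^'m^'m::finite"
  assumes "\<And>i j. A $ i $ j \<in> \<int>"
  shows "det A \<in> \<int>"
  unfolding det_def by (intro Ints_sum Ints_mult Ints_prod assms) (simp add: sign_def)

text \<open>Apply the preceding construction to the row lattice of \<open>M\<close>. It has full rank because, by Cramer's rule, it
contains \<open>det M\<close> times each unit vector. The two bases of the lattice determine each other by integer matrices,
so the transition matrix has determinant 1 or -1, and positivity of both determinants excludes -1.\<close>

lemma integer_matrix_left_orbit_hermite:
  fixes M :: "real^'m^'m::finite" and r :: "'m \<Rightarrow> nat"
  assumes r: "inj r" and M: "\<And>i j. M $ i $ j \<in> \<int>" and detM: "0 < det M"
  obtains W h where "det W = 1" "\<And>i j. W $ i $ j \<in> \<int>" "W ** M = (\<chi> i j. real_of_int (h i j))"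
    "\<And>i j. r j < r i \<Longrightarrow> h i j = 0" "\<And>i. 0 < h i i"
    "\<And>i j. r i < r j \<Longrightarrow> 0 \<le> h i j \<and> h i j < h j j"
    "(\<Prod>i\<in>UNIV. real_of_int (h i i)) = det M"
proof -
  have "\<exists>Mz. \<forall>i j. M $ i $ j = real_of_int (Mz i j)"
    using M by (intro choice allI) (auto elim!: Ints_cases)
  then obtain Mz where Mz: "\<And>i j. M $ i $ j = real_of_int (Mz i j)" by blast
  define L :: "('m \<Rightarrow> int) set" where
    "L = {v. \<exists>w::'m \<Rightarrow> int. \<forall>j. real_of_int (v j) = (\<Sum>i\<in>UNIV. real_of_int (w i) * M $ i $ j)}"
  have L: "(\<lambda>i. v i + k * w i) \<in> L" if "v \<in> L" "w \<in> L" for v w k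
  proof -
    obtain a b where "\<forall>j. real_of_int (v j) = (\<Sum>i\<in>UNIV. real_of_int (a i) * M $ i $ j)"
        "\<forall>j. real_of_int (w j) = (\<Sum>i\<in>UNIV. real_of_int (b i) * M $ i $ j)"
      using \<open>v \<in> L\<close> \<open>w \<in> L\<close> unfolding L_def by blast
    then show ?thesis
      unfolding L_def
      by (intro CollectI exI[of _ "\<lambda>i. a i + k * b i"])
        (simp add: sum.distrib sum_distrib_left algebra_simps)
  qed
  have full: "\<exists>v\<in>L. (\<forall>j. r j < r i \<longrightarrow> v j = 0) \<and> 0 < v i" for i
  proof -
    define x :: "real^'m" where
      "x = (\<chi> k. det (\<chi> l j. if j = k then axis i 1 $ l else transpose M $ l $ j))"
    have "transpose M *v (x /\<^sub>R det M) = axis i 1"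
      using detM by (subst cramer) (auto simp: x_def vec_eq_iff divide_inverse mult.commute)
    then have "(transpose M *v x) /\<^sub>R det M = axis i 1"
      by (simp add: matrix_vector_mult_scaleR)
    then have tx: "transpose M *v x = det M *\<^sub>R axis i 1"
      using detM by (metis divideR_right less_irrefl)
    have "x $ k \<in> \<int>" for k
      unfolding x_def by (simp, intro det_Ints) (auto simp: axis_def transpose_def M)
    then have "\<exists>w. \<forall>k. x $ k = real_of_int (w k)"
      by (intro choice allI) (auto elim!: Ints_cases)
    then obtain w where w: "\<And>k. x $ k = real_of_int (w k)" by blast
    obtain D where D: "det M = real_of_int D"
      using det_Ints[of M] M by (auto elim!: Ints_cases)
    have "real_of_int (if j = i then D else 0) = (\<Sum>k\<in>UNIV. real_of_int (w k) * M $ k $ j)" for j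
    proof -
      have "(transpose M *v x) $ j = (\<Sum>k\<in>UNIV. real_of_int (w k) * M $ k $ j)"
        by (simp add: matrix_vector_mult_def transpose_def w mult.commute)
      then show ?thesis unfolding tx by (auto simp: D axis_def)
    qed
    then have "(\<lambda>j. if j = i then D else 0) \<in> L"
      unfolding L_def by blast
    then show ?thesis
      using detM D by (intro bexI[of _ "\<lambda>j. if j = i then D else 0"]) auto
  qed
  obtain h where h: "\<And>i. h i \<in> L" "\<And>i j. r j < r i \<Longrightarrow> h i j = 0" "\<And>i. 0 < h i i"
    "\<And>i j. r i < r j \<Longrightarrow> 0 \<le> h i j \<and> h i j < h j j"
    "\<And>v. v \<in> L \<Longrightarrow> \<exists>c. \<forall>j. v j = (\<Sum>i\<in>UNIV. c i * h i j)"
    using hermite_basis[of r L, OF r L full] by blast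
  define H :: "real^'m^'m" where "H = (\<chi> i j. real_of_int (h i j))"
  have "\<exists>W. \<forall>i j. real_of_int (h i j) = (\<Sum>k\<in>UNIV. real_of_int (W i k) * M $ k $ j)"
    using h(1) unfolding L_def by (intro choice) blast
  then obtain Wz where Wz: "\<And>i j. real_of_int (h i j) = (\<Sum>k\<in>UNIV. real_of_int (Wz i k) * M $ k $ j)"
    by blast
  define W :: "real^'m^'m" where "W = (\<chi> i j. real_of_int (Wz i j))"
  have WM: "W ** M = H"
    by (simp add: W_def H_def matrix_matrix_mult_def Wz)
  have rowL: "Mz i \<in> L" for i
    unfolding L_def
    by (intro CollectI exI[of _ "\<lambda>k. if k = i then 1 else 0"]) (simp add: Mz if_distrib[of real_of_int] if_distrib[of "\<lambda>x. x * _"] cong: if_cong)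
  have "\<exists>C. \<forall>i j. Mz i j = (\<Sum>k\<in>UNIV. C i k * h k j)"
    using h(5)[OF rowL] by (intro choice) blast
  then obtain Cz where Cz: "\<And>i j. Mz i j = (\<Sum>k\<in>UNIV. Cz i k * h k j)" by blast
  define C :: "real^'m^'m" where "C = (\<chi> i j. real_of_int (Cz i j))"
  have CH: "C ** H = M"
    by (simp add: C_def H_def matrix_matrix_mult_def Mz Cz vec_eq_iff)
  have detH: "det H = (\<Prod>i\<in>UNIV. real_of_int (h i i))"
    using det_triangular[OF r, of H] h(2) by (simp add: H_def)
  have "0 < det H"
    unfolding detH using h(3) by (intro prod_pos) simp
  then have Wpos: "0 < det W"
    using detM WM by (metis det_mul zero_less_mult_pos2)
  have "det C * det W = 1"
  proof -
    have "det C * det W * det M = det M"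
      by (metis CH WM det_mul mult.assoc)
    then show ?thesis using detM by simp
  qed
  moreover obtain c w where "det C = real_of_int c" "det W = real_of_int w"
    using det_Ints[of C] det_Ints[of W] by (auto simp: C_def W_def elim!: Ints_cases)
  ultimately have "real_of_int (c * w) = real_of_int 1" "0 < w" "det W = real_of_int w"
    using Wpos by simp_all
  then have "det W = 1"
    by (metis of_int_1 of_int_eq_iff pos_zmult_eq_1_iff mult.commute)
  moreover have "(\<Prod>i\<in>UNIV. real_of_int (h i i)) = det M"
    using WM \<open>det W = 1\<close> detH by (metis det_mul mult_1)
  ultimately show thesis
    using that[of W h] h WM by (simp add: W_def H_def)
qed

section \<open>Counting orbits of integer matrices\<close>

abbreviation SLZ :: "(real^'m^'m::finite) set" where "SLZ \<equiv> carrier SL_int"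

lemma SLZ_iff: "A \<in> SLZ \<longleftrightarrow> det A = 1 \<and> (\<forall>i j. A $ i $ j \<in> \<int>)"
  by (simp add: SL_int_def)

lemma mat_1_SLZ: "mat 1 \<in> SLZ"
  unfolding SLZ_iff by (simp, simp add: mat_def)

lemma SLZ_mult: "A \<in> SLZ \<Longrightarrow> B \<in> SLZ \<Longrightarrow> A ** B \<in> SLZ"
  unfolding SLZ_iff by (simp add: det_mul, auto simp: matrix_matrix_mult_def)

text \<open>The Hermite normal form of a matrix of determinant 1 has unit pivots, so it is the identity matrix.\<close>

lemma SLZ_inverse:
  fixes A :: "real^'m^'m::finite"
  assumes A: "A \<in> SLZ"
  obtains B where "B \<in> SLZ" "A ** B = mat 1" "B ** A = mat 1"
proof -
  obtain r :: "'m \<Rightarrow> nat" where r: "inj r"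
    using ex_bij_betw_finite_nat[of "UNIV :: 'm set"] by (auto simp: bij_betw_def)
  have int: "A $ i $ j \<in> \<int>" and pos: "0 < det A" for i j
    using A by (simp_all add: SLZ_iff)
  obtain W h where W: "det W = 1" "\<And>i j. W $ i $ j \<in> \<int>" "W ** A = (\<chi> i j. real_of_int (h i j))"
    and h: "\<And>i j. r j < r i \<Longrightarrow> h i j = 0" "\<And>i. 0 < h i i"
      "\<And>i j. r i < r j \<Longrightarrow> 0 \<le> h i j \<and> h i j < h j j"
      "(\<Prod>i\<in>UNIV. real_of_int (h i i)) = det A"
    by (rule integer_matrix_left_orbit_hermite[OF r int pos]) (rule that)
  have "h i i = 1" for i
  proof -
    have "(\<Prod>i\<in>UNIV. h i i) = 1"
      using h(4) A by (simp add: SLZ_iff flip: of_int_prod)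
    then have "h i i dvd 1"
      by (metis UNIV_I dvd_prodI finite)
    then show ?thesis using h(2)[of i] by (simp add: zdvd_not_zless order_less_le)
  qed
  then have "h i j = (if i = j then 1 else 0)" for i j
    using h(1)[of j i] h(3)[of i j] r by (cases "r i" "r j" rule: linorder_cases) (auto dest: injD)
  then have "W ** A = mat 1"
    by (simp add: W(3) mat_def vec_eq_iff)
  then show thesis
    using that[of W] W(1,2) by (simp add: SLZ_iff matrix_left_right_inverse)
qed

lemma sum_inverse_squares_le_2: "(\<Sum>x=1..N. 1 / (real x)\<^sup>2) \<le> 2"
proof -
  have "(\<Sum>x=1..Suc n. 1 / (real x)\<^sup>2) \<le> 2 - 1 / real (Suc n)" for n
  proof (induction n)
    case (Suc n)
    have "1 / (real (Suc (Suc n)))\<^sup>2 \<le> 1 / real (Suc n) - 1 / real (Suc (Suc n))"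
      by (simp add: field_simps power2_eq_square)
        (intro frac_le; auto intro!: add_pos_nonneg)
    then show ?case using Suc by simp
  qed simp
  from this[of "N - 1"] show ?thesis
    by (cases N) (auto intro: order_trans)
qed

lemma finite_prod_le:
  "finite {d :: 'm::finite \<Rightarrow> nat. (\<forall>i. 1 \<le> d i) \<and> (\<Prod>i\<in>UNIV. d i) \<le> N}" (is "finite ?D")
proof (rule finite_subset)
  show "?D \<subseteq> PiE UNIV (\<lambda>_. {1..N})"
  proof
    fix d assume d: "d \<in> ?D"
    have "d i \<le> N" for i
    proof -
      have "d i \<le> (\<Prod>i\<in>UNIV. d i)"
        using d by (intro dvd_imp_le dvd_prodI prod_pos) (auto simp: Suc_le_eq)
      also have "\<dots> \<le> N" using d by blast
      finally show ?thesis .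
    qed
    then show "d \<in> PiE UNIV (\<lambda>_. {1..N})"
      using d by auto
  qed
qed (simp add: finite_PiE)

text \<open>The summand counts the Hermite normal forms with pivots \<open>d\<close>: there are \<open>r j\<close> entries above the pivot in
column \<open>j\<close>, each with \<open>d j\<close> possible values. In the last column, of rank \<open>k = m - 1\<close>, fix the other pivots with
product \<open>P\<close>; the last pivot then takes at most \<open>N/P\<close> values, each contributing at most \<open>(N/P)\<^sup>k\<close>. What remains is
a product of partial sums of series dominated by \<open>\<Sum>1/x\<^sup>2\<close>.\<close>

lemma sum_hermite_count_le:
  fixes r :: "'m::finite \<Rightarrow> nat"
  assumes r: "bij_betw r UNIV {..<CARD('m)}"
  shows "(\<Sum>d\<in>{d :: 'm \<Rightarrow> nat. (\<forall>i. 1 \<le> d i) \<and> (\<Prod>i\<in>UNIV. d i) \<le> N}. \<Prod>j\<in>UNIV. real (d j) ^ r j)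
    \<le> 2 ^ (CARD('m) - 1) * real N ^ CARD('m)" (is "sum ?f ?D \<le> _")
proof -
  define k where "k = CARD('m) - 1"
  have card: "CARD('m) = Suc k" by (simp add: k_def)
  obtain l where l: "r l = k"
    using r unfolding card bij_betw_def by (metis imageE lessThan_iff lessI)
  have rj: "r j + 2 \<le> Suc k" if "j \<noteq> l" for j
  proof -
    have "r j < Suc k" using r unfolding card by (auto simp: bij_betw_def)
    moreover have "r j \<noteq> r l" using r that by (auto simp: bij_betw_def inj_eq)
    ultimately show ?thesis using l by simp
  qed
  define J where "J = UNIV - {l}"
  have cardJ: "card J = k" by (simp add: J_def card)
  define S where "S = PiE J (\<lambda>_. {1..N})"
  define P where "P d = (\<Prod>j\<in>J. d j)" for d :: "'m \<Rightarrow> nat"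
  define X where "X d = {x. 1 \<le> x \<and> x * P d \<le> N}" for d
  define g where "g d = (real N / real (P d)) ^ k * (\<Prod>j\<in>J. real (d j) ^ r j)" for d
  have Ppos: "0 < P d" if "d \<in> S" for d
    using that unfolding P_def S_def by (intro prod_pos) (auto simp: PiE_iff Suc_le_eq)
  have X: "X d \<subseteq> {1..N div P d}" if "d \<in> S" for d
    using Ppos[OF that] by (auto simp: X_def less_eq_div_iff_mult_less_eq)
  have finS: "finite S" by (simp add: S_def finite_PiE)
  have finX: "finite (X d)" if "d \<in> S" for d
    using X[OF that] by (rule finite_subset) simp
  have "sum ?f ?D \<le> (\<Sum>z\<in>Sigma S X. g (fst z))"
  proof (rule sum_le_included[where i="\<lambda>z. (fst z)(l := snd z)"])
    show "finite ?D" by (rule finite_prod_le)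
    show "finite (Sigma S X)" using finS finX by blast
    show "\<forall>z\<in>Sigma S X. 0 \<le> g (fst z)"
      by (auto simp: g_def intro!: mult_nonneg_nonneg prod_nonneg)
    show "\<forall>d\<in>?D. \<exists>z\<in>Sigma S X. (fst z)(l := snd z) = d \<and> ?f d \<le> g (fst z)"
    proof
      fix d assume d: "d \<in> ?D"
      define d' where "d' = restrict d J"
      have d'_eq: "d' j = d j" if "j \<in> J" for j using that by (simp add: d'_def)
      have prod_l: "(\<Prod>i\<in>UNIV. F i) = F l * (\<Prod>i\<in>J. F i)" for F :: "'m \<Rightarrow> 'b::comm_monoid_mult"
        unfolding J_def by (rule prod.remove) auto
      have PP: "P d' = (\<Prod>j\<in>J. d j)"
        unfolding P_def by (rule prod.cong) (auto simp: d'_eq)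
      have le: "d i \<le> N" for i
      proof -
        have "d i \<le> (\<Prod>i\<in>UNIV. d i)"
          using d by (intro dvd_imp_le dvd_prodI prod_pos) (auto simp: Suc_le_eq)
        also have "\<dots> \<le> N" using d by blast
        finally show ?thesis .
      qed
      have d'S: "d' \<in> S"
        using d le by (auto simp: S_def d'_def)
      have dX: "d l * P d' \<le> N" "1 \<le> d l"
        using d by (simp_all add: PP prod_l)
      have "real (d l) * real (P d') \<le> real N"
        using dX(1) by (metis of_nat_le_iff of_nat_mult)
      then have "real (d l) \<le> real N / real (P d')"
        using Ppos[OF d'S] by (simp add: pos_le_divide_eq)
      then have "real (d l) ^ k * (\<Prod>j\<in>J. real (d j) ^ r j) \<le> g d'"
        unfolding g_def by (intro mult_mono power_mono prod_nonneg order.refl)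
          (auto simp: d'_eq intro!: prod_nonneg prod_mono)
      then have "?f d \<le> g d'" by (simp add: prod_l l)
      moreover have "d'(l := d l) = d"
        by (auto simp: d'_def J_def)
      ultimately show "\<exists>z\<in>Sigma S X. (fst z)(l := snd z) = d \<and> ?f d \<le> g (fst z)"
        using d'S dX by (intro bexI[of _ "(d', d l)"]) (auto simp: X_def)
    qed
  qed
  also have "\<dots> = (\<Sum>d\<in>S. real (card (X d)) * g d)"
    using sum.Sigma[of S X "\<lambda>d x. g d"] finS finX by (simp add: case_prod_beta)
  also have "\<dots> \<le> (\<Sum>d\<in>S. real N ^ Suc k * (\<Prod>j\<in>J. 1 / (real (d j))\<^sup>2))"
  proof (rule sum_mono)
    fix d assume d: "d \<in> S"
    have dpos: "1 \<le> real (d j)" if "j \<in> J" for j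
      using d that by (auto simp: S_def)
    have "card (X d) \<le> N div P d"
      using card_mono[OF _ X[OF d]] by simp
    then have "real (card (X d)) \<le> real N / real (P d)"
      by (meson of_nat_le_iff of_nat_div_le_of_nat order_trans)
    then have "real (card (X d)) * g d \<le> real N / real (P d) * g d"
      unfolding g_def by (intro mult_right_mono mult_nonneg_nonneg prod_nonneg) auto
    also have "\<dots> = real N ^ Suc k * (\<Prod>j\<in>J. real (d j) ^ r j / real (d j) ^ Suc k)"
      by (simp add: g_def P_def power_divide prod_dividef prod_power_distrib prod.distrib)
    also have "\<dots> \<le> real N ^ Suc k * (\<Prod>j\<in>J. 1 / (real (d j))\<^sup>2)"
    proof (intro mult_left_mono prod_mono conjI)
      fix j assume j: "j \<in> J"
      have "real (d j) ^ (r j + 2) \<le> real (d j) ^ Suc k"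
        using rj[of j] j dpos[OF j] by (intro power_increasing) (auto simp: J_def)
      then show "real (d j) ^ r j / real (d j) ^ Suc k \<le> 1 / (real (d j))\<^sup>2"
        using dpos[OF j] by (simp add: divide_simps power_add power2_eq_square mult.commute)
    qed auto
    finally show "real (card (X d)) * g d \<le> real N ^ Suc k * (\<Prod>j\<in>J. 1 / (real (d j))\<^sup>2)" .
  qed
  also have "\<dots> = real N ^ Suc k * (\<Prod>j\<in>J. \<Sum>x\<in>{1..N}. 1 / (real x)\<^sup>2)"
  proof -
    have "(\<Prod>j\<in>J. \<Sum>x\<in>{1..N}. 1 / (real x)\<^sup>2) = (\<Sum>d\<in>S. \<Prod>j\<in>J. 1 / (real (d j))\<^sup>2)"
      unfolding S_def by (rule prod_sum_PiE) auto
    then show ?thesis by (simp only: sum_distrib_left)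
  qed
  also have "\<dots> \<le> real N ^ Suc k * 2 ^ k"
    using sum_inverse_squares_le_2[of N]
    by (intro mult_left_mono) (auto simp: cardJ intro!: power_mono sum_nonneg)
  finally show ?thesis by (simp add: card mult.commute)
qed


text \<open>Inequivalent matrices have different Hermite normal forms, so it suffices to count the latter.\<close>

lemma card_inequivalent_integer_matrices_le:
  fixes U :: "(real^'m^'m::finite) set"
  assumes int: "\<And>M i j. M \<in> U \<Longrightarrow> M $ i $ j \<in> \<int>"
    and det: "\<And>M. M \<in> U \<Longrightarrow> 0 < det M \<and> det M \<le> real N"
    and ineq: "\<And>M W. M \<in> U \<Longrightarrow> W \<in> SLZ \<Longrightarrow> W ** M \<in> U \<Longrightarrow> W ** M = M"
  shows "finite U" "real (card U) \<le> 2 ^ (CARD('m) - 1) * real N ^ CARD('m)"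
proof -
  obtain r :: "'m \<Rightarrow> nat" where r: "bij_betw r UNIV {..<CARD('m)}"
    using ex_bij_betw_finite_nat[of "UNIV :: 'm set"] by (auto simp: atLeast0LessThan)
  then have inj: "inj r" by (simp add: bij_betw_def)
  define D where "D = {d :: 'm \<Rightarrow> nat. (\<forall>i. 1 \<le> d i) \<and> (\<Prod>i\<in>UNIV. d i) \<le> N}"
  define B where "B d p = (case p of (i, j) \<Rightarrow> if i = j then {int (d i)} else if r i < r j then {0..<int (d j)} else {})"
    for d :: "'m \<Rightarrow> nat" and p
  define B' where "B' d p = (if r (snd p) < r (fst p) then {0} else B d p)" for d p
  define F where "F = (\<Union>d\<in>D. PiE UNIV (B' d))"
  have finB: "finite (B' d p)" for d p
    by (auto simp: B'_def B_def split: prod.split)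
  have finD: "finite D" unfolding D_def by (rule finite_prod_le)
  have finF: "finite F"
    unfolding F_def using finD finB by (auto intro!: finite_PiE)
  have card_above: "card {i. r i < r j} = r j" for j
  proof -
    have "r ` {i. r i < r j} = {..<r j}"
    proof
      show "{..<r j} \<subseteq> r ` {i. r i < r j}"
      proof
        fix n assume n: "n \<in> {..<r j}"
        have "r j < CARD('m)" using r by (auto simp: bij_betw_def)
        then have "n \<in> range r" using r n by (simp add: bij_betw_def)
        then show "n \<in> r ` {i. r i < r j}" using n by auto
      qed
    qed auto
    then show ?thesis
      by (metis card_image card_lessThan inj inj_on_subset subset_UNIV)
  qed
  have cardB: "real (card (PiE UNIV (B' d))) = (\<Prod>j\<in>UNIV. real (d j) ^ r j)" for d
  proof -
    have "card (B' d (i, j)) = (if r i < r j then d j else 1)" for i j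
      using inj by (auto simp: B'_def B_def inj_eq dest: injD)
    then have "card (PiE UNIV (B' d)) = (\<Prod>i\<in>UNIV. \<Prod>j\<in>UNIV. if r i < r j then d j else 1)"
      by (simp add: card_PiE prod.cartesian_product flip: UNIV_Times_UNIV) (auto intro!: prod.cong)
    also have "\<dots> = (\<Prod>j\<in>UNIV. \<Prod>i\<in>UNIV. if r i < r j then d j else 1)"
      by (rule prod.swap)
    also have "\<dots> = (\<Prod>j\<in>UNIV. d j ^ r j)"
      by (simp add: prod.If_cases card_above)
    finally show ?thesis by simp
  qed
  have "real (card F) \<le> (\<Sum>d\<in>D. real (card (PiE UNIV (B' d))))"
    unfolding F_def using card_UN_le[OF finD, of "\<lambda>d. PiE UNIV (B' d)"] by (metis of_nat_le_iff of_nat_sum)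
  also have "\<dots> \<le> 2 ^ (CARD('m) - 1) * real N ^ CARD('m)"
    unfolding cardB D_def by (rule sum_hermite_count_le[OF r])
  finally have cardF: "real (card F) \<le> 2 ^ (CARD('m) - 1) * real N ^ CARD('m)" .
  have "\<exists>h\<in>F. \<exists>W\<in>SLZ. W ** M = (\<chi> i j. real_of_int (h (i, j)))" if M: "M \<in> U" for M
  proof -
    have M': "M $ i $ j \<in> \<int>" "0 < det M" "det M \<le> real N" for i j using int det M by auto
    obtain W h where W: "det W = 1" "\<And>i j. W $ i $ j \<in> \<int>" "W ** M = (\<chi> i j. real_of_int (h i j))"
    and h: "\<And>i j. r j < r i \<Longrightarrow> h i j = 0" "\<And>i. 0 < h i i"
      "\<And>i j. r i < r j \<Longrightarrow> 0 \<le> h i j \<and> h i j < h j j"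
      "(\<Prod>i\<in>UNIV. real_of_int (h i i)) = det M"
      by (rule integer_matrix_left_orbit_hermite[OF inj M'(1,2)]) (rule that)
    define d where "d i = nat (h i i)" for i
    have d: "int (d i) = h i i" for i using h(2)[of i] by (simp add: d_def)
    have "(\<Prod>i\<in>UNIV. real (d i)) = (\<Prod>i\<in>UNIV. real_of_int (h i i))"
      by (intro prod.cong refl) (metis d of_int_of_nat_eq)
    then have "real (\<Prod>i\<in>UNIV. d i) \<le> real N"
      using h(4) M'(3) by simp
    then have "(\<Prod>i\<in>UNIV. d i) \<le> N"
      by (rule of_nat_le_iff[THEN iffD1])
    moreover have "1 \<le> d i" for i using h(2)[of i] by (simp add: d_def)
    ultimately have "d \<in> D" by (simp add: D_def)
    moreover have "h i j \<in> B' d (i, j)" for i j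
      using h(1,3) d inj by (cases "r i" "r j" rule: linorder_cases) (auto simp: B'_def B_def dest: injD)
    then have "(\<lambda>(i, j). h i j) \<in> PiE UNIV (B' d)"
      by auto
    ultimately have "(\<lambda>(i, j). h i j) \<in> F" unfolding F_def by blast
    moreover have "W \<in> SLZ" using W by (simp add: SLZ_iff)
    ultimately show ?thesis using W(3)
      by (intro bexI[of _ "\<lambda>(i, j). h i j"] bexI[of _ W]) auto
  qed
  then obtain \<phi> W where \<phi>: "\<And>M. M \<in> U \<Longrightarrow> \<phi> M \<in> F" "\<And>M. M \<in> U \<Longrightarrow> W M \<in> SLZ"
    "\<And>M. M \<in> U \<Longrightarrow> W M ** M = (\<chi> i j. real_of_int (\<phi> M (i, j)))"
    by metis
  have inj_\<phi>: "inj_on \<phi> U"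
  proof
    fix M M' assume M: "M \<in> U" "M' \<in> U" "\<phi> M = \<phi> M'"
    then have eq: "W M ** M = W M' ** M'" using \<phi>(3) by metis
    obtain V where V: "V \<in> SLZ" "V ** W M' = mat 1"
      using SLZ_inverse[OF \<phi>(2)[OF M(2)]] by metis
    have "(V ** W M) ** M = M'"
      by (metis V(2) eq matrix_mul_assoc matrix_mul_lid)
    then show "M = M'"
      using ineq[OF M(1), of "V ** W M"] M(2) SLZ_mult[OF V(1) \<phi>(2)[OF M(1)]] by simp
  qed
  have "\<phi> ` U \<subseteq> F" using \<phi>(1) by blast
  then show "finite U" using finF inj_\<phi> by (metis finite_imageD finite_subset)
  have "card U \<le> card F"
    using inj_\<phi> \<open>\<phi> ` U \<subseteq> F\<close> finF by (metis card_inj_on_le)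
  then show "real (card U) \<le> 2 ^ (CARD('m) - 1) * real N ^ CARD('m)"
    using cardF by linarith
qed

section \<open>Translations, and proper discontinuity of the integral action\<close>

lemma linear_matrix_left: "linear ((**) (g :: real^'m^'m::finite) :: real^'m^'m \<Rightarrow> real^'m^'m)"
  by (rule linearI)
    (simp_all add: matrix_matrix_mult_def vec_eq_iff sum_distrib_left sum.distrib algebra_simps)

lemma linear_matrix_right: "linear (\<lambda>x :: real^'m^'m::finite. x ** (g :: real^'m^'m))"
  by (rule linearI)
    (simp_all add: matrix_matrix_mult_def vec_eq_iff sum_distrib_left sum.distrib algebra_simps)

lemma matrix_inverse:
  fixes g :: "real^'m^'m::finite"
  assumes "det g \<noteq> 0"
  obtains g' where "g ** g' = mat 1" "g' ** g = mat 1" "det g' = inverse (det g)"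
proof -
  obtain g' where g': "g ** g' = mat 1" "g' ** g = mat 1"
    using assms unfolding invertible_det_nz[symmetric] invertible_def by blast
  then have "det g * det g' = 1"
    by (metis det_I det_mul)
  then show thesis using that[OF g'] by (simp add: inverse_unique)
qed

lemma bij_matrix_left:
  fixes g :: "real^'m^'m::finite"
  assumes "det g \<noteq> 0"
  shows "bij ((**) g :: real^'m^'m \<Rightarrow> real^'m^'m)"
proof -
  obtain g' where "g ** g' = mat 1" "g' ** g = mat 1"
    using matrix_inverse[OF assms] by blast
  then show ?thesis
    by (intro o_bij[of "(**) g'"]) (auto simp: fun_eq_iff matrix_mul_assoc)
qed

lemma bij_matrix_right:
  fixes g :: "real^'m^'m::finite"
  assumes "det g \<noteq> 0"
  shows "bij (\<lambda>x :: real^'m^'m. x ** g)"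
proof -
  obtain g' where "g ** g' = mat 1" "g' ** g = mat 1"
    using matrix_inverse[OF assms] by blast
  then show ?thesis
    by (intro o_bij[of "\<lambda>x. x ** g'"]) (auto simp: fun_eq_iff simp flip: matrix_mul_assoc)
qed

lemma vol_factor_id: "vol_factor (\<lambda>x :: 'a::euclidean_space. x) = 1"
  using content_ball_pos[of 1 "0::'a"] by (simp add: vol_factor_def)

lemma vol_factor_matrix_left:
  fixes g :: "real^'m^'m::finite"
  assumes "det g = 1"
  shows "vol_factor ((**) g :: real^'m^'m \<Rightarrow> real^'m^'m) = 1"
proof (rule SL_hom_trivial[OF _ _ assms])
  fix A B :: "real^'m^'m" assume "det A \<noteq> 0" "det B \<noteq> 0"
  moreover have "(**) (A ** B) = (**) A \<circ> ((**) B :: real^'m^'m \<Rightarrow> real^'m^'m)"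
    by (simp add: fun_eq_iff matrix_mul_assoc)
  ultimately show "vol_factor ((**) (A ** B) :: real^'m^'m \<Rightarrow> real^'m^'m)
      = vol_factor ((**) A :: real^'m^'m \<Rightarrow> real^'m^'m) * vol_factor ((**) B :: real^'m^'m \<Rightarrow> real^'m^'m)"
    by (simp add: vol_factor_comp linear_matrix_left bij_matrix_left)
qed (simp add: vol_factor_id)

lemma vol_factor_matrix_right:
  fixes g :: "real^'m^'m::finite"
  assumes "det g = 1"
  shows "vol_factor (\<lambda>x :: real^'m^'m. x ** g) = 1"
proof (rule SL_hom_trivial[OF _ _ assms])
  fix A B :: "real^'m^'m" assume "det A \<noteq> 0" "det B \<noteq> 0"
  moreover have "(\<lambda>x. x ** (A ** B)) = (\<lambda>x. x ** B) \<circ> (\<lambda>x :: real^'m^'m. x ** A)"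
    by (simp add: fun_eq_iff matrix_mul_assoc)
  ultimately show "vol_factor (\<lambda>x :: real^'m^'m. x ** (A ** B))
      = vol_factor (\<lambda>x :: real^'m^'m. x ** A) * vol_factor (\<lambda>x :: real^'m^'m. x ** B)"
    by (simp add: vol_factor_comp linear_matrix_right bij_matrix_right)
qed (simp add: vol_factor_id)

lemma
  fixes g :: "real^'m^'m::finite" and S :: "(real^'m^'m) set"
  assumes "det g = 1" "S \<in> sets lebesgue"
  shows left_translate_lebesgue: "(**) g ` S \<in> sets lebesgue"
    and emeasure_left_translate: "emeasure lebesgue ((**) g ` S) = emeasure lebesgue S"
    and right_translate_lebesgue: "(\<lambda>x. x ** g) ` S \<in> sets lebesgue"
    and emeasure_right_translate: "emeasure lebesgue ((\<lambda>x. x ** g) ` S) = emeasure lebesgue S"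
proof -
  have nz: "det g \<noteq> 0" using assms by simp
  show "(**) g ` S \<in> sets lebesgue" "(\<lambda>x. x ** g) ` S \<in> sets lebesgue"
    by (intro bij_linear_image_lebesgue linear_matrix_left bij_matrix_left linear_matrix_right bij_matrix_right nz assms)+
  show "emeasure lebesgue ((**) g ` S) = emeasure lebesgue S"
    by (subst emeasure_lebesgue_bij_linear_image[OF linear_matrix_left bij_matrix_left[OF nz] assms(2)])
      (simp add: vol_factor_matrix_left assms)
  show "emeasure lebesgue ((\<lambda>x. x ** g) ` S) = emeasure lebesgue S"
    by (subst emeasure_lebesgue_bij_linear_image[OF linear_matrix_right bij_matrix_right[OF nz] assms(2)])
      (simp add: vol_factor_matrix_right assms)
qed

lemma bounded_bilinear_matrix_mult:
  "bounded_bilinear ((**) :: real^'m^'m::finite \<Rightarrow> real^'m^'m \<Rightarrow> real^'m^'m)"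
  unfolding bilinear_conv_bounded_bilinear[symmetric] bilinear_def
  using linear_matrix_left linear_matrix_right by blast

lemma continuous_on_det: "continuous_on S (det :: real^'m^'m::finite \<Rightarrow> real)"
  unfolding det_def[abs_def] by (intro continuous_intros)

lemma abs_entry_le_norm: "\<bar>(A :: real^'n::finite^'m::finite) $ i $ j\<bar> \<le> norm A"
  using Finite_Cartesian_Product.norm_nth_le[of "A $ i" j] Finite_Cartesian_Product.norm_nth_le[of A i]
  by simp

text \<open>Integer matrices at distance less than 1 are equal.\<close>

lemma SLZ_sequence_eventually_const:
  fixes W :: "nat \<Rightarrow> real^'m^'m::finite"
  assumes W: "\<And>n. W n \<in> SLZ" and lim: "W \<longlonglongrightarrow> V"
  shows "\<forall>\<^sub>F n in sequentially. W n = V"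
proof -
  obtain N where N: "\<And>n. n \<ge> N \<Longrightarrow> dist (W n) V < 1/2"
    using lim by (meson lim_sequentially half_gt_zero zero_less_one)
  have "W n = W N" if "n \<ge> N" for n
  proof -
    have "dist (W n) (W N) < 1"
      using N[OF that] N[of N] dist_triangle_half_l by (metis dist_commute order.refl)
    moreover have "\<bar>W n $ i $ j - W N $ i $ j\<bar> \<le> dist (W n) (W N)" for i j
      using abs_entry_le_norm[of "W n - W N" i j] by (simp add: dist_norm)
    ultimately have "\<bar>W n $ i $ j - W N $ i $ j\<bar> < 1" for i j
      by (meson le_less_trans)
    then show ?thesis
      using W by (simp add: vec_eq_iff SLZ_iff) (meson Ints_eq_abs_less1)
  qed
  then have ev: "\<forall>\<^sub>F n in sequentially. W n = W N"
    by (rule eventually_sequentiallyI)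
  then have "W \<longlonglongrightarrow> W N" by (rule tendsto_eventually)
  then have "V = W N" using lim LIMSEQ_unique by blast
  with ev show ?thesis by simp
qed

text \<open>The action is properly discontinuous on invertible matrices. If \<open>x\<^sub>n\<close> and \<open>W\<^sub>n x\<^sub>n\<close> both approach \<open>K\<close>, pass to
subsequences with limits \<open>p\<close> and \<open>q\<close>. Then \<open>W\<^sub>n\<close> is bounded, because \<open>p\<close> is invertible, so that a further
subsequence is eventually constant, with a value that maps \<open>p\<close> to \<open>q\<close>.\<close>

lemma SLZ_separation:
  fixes K :: "(real^'m^'m::finite) set"
  assumes K: "compact K" and det: "\<And>x. x \<in> K \<Longrightarrow> det x \<noteq> 0"
    and disj: "\<And>W. W \<in> SLZ \<Longrightarrow> W \<noteq> mat 1 \<Longrightarrow> (**) W ` K \<inter> K = {}"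
  obtains e where "0 < e"
    "\<And>x k k' W. W \<in> SLZ \<Longrightarrow> k \<in> K \<Longrightarrow> k' \<in> K \<Longrightarrow> dist x k < e \<Longrightarrow> dist (W ** x) k' < e \<Longrightarrow> W = mat 1"
proof (rule ccontr)
  interpret mm: bounded_bilinear "(**) :: real^'m^'m \<Rightarrow> real^'m^'m \<Rightarrow> real^'m^'m"
    by (rule bounded_bilinear_matrix_mult)
  assume "\<not> thesis"
  then have "\<exists>W k k' x. W \<in> SLZ \<and> k \<in> K \<and> k' \<in> K \<and> dist x k < inverse (real (Suc n)) \<and>
      dist (W ** x) k' < inverse (real (Suc n)) \<and> W \<noteq> mat 1" for n
    using that[of "inverse (real (Suc n))"] by (metis inverse_positive_iff_positive of_nat_0_less_iff zero_less_Suc)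
  then obtain W k k' x where *: "\<And>n. W n \<in> SLZ" "\<And>n. k n \<in> K" "\<And>n. k' n \<in> K"
    "\<And>n. dist (x n) (k n) < inverse (real (Suc n))"
    "\<And>n. dist (W n ** x n) (k' n) < inverse (real (Suc n))" "\<And>n. W n \<noteq> mat 1"
    by metis
  have "compact (K \<times> K)" using K by (simp add: compact_Times)
  then have sc: "seq_compact (K \<times> K)" by (simp add: compact_eq_seq_compact_metric)
  have "\<forall>n. (k n, k' n) \<in> K \<times> K" using * by simp
  then obtain l s where s: "l \<in> K \<times> K" "strict_mono (s :: nat \<Rightarrow> nat)" "((\<lambda>n. (k n, k' n)) \<circ> s) \<longlonglongrightarrow> l"
    by (rule seq_compactE[OF sc])
  obtain p q where l: "l = (p, q)" "p \<in> K" "q \<in> K" using s(1) by auto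
  have lim: "(\<lambda>n. k (s n)) \<longlonglongrightarrow> p" "(\<lambda>n. k' (s n)) \<longlonglongrightarrow> q"
    using tendsto_fst[OF s(3)] tendsto_snd[OF s(3)] by (simp_all add: l o_def)
  have inv0: "(\<lambda>n. inverse (real (Suc (s n)))) \<longlonglongrightarrow> 0"
    using LIMSEQ_subseq_LIMSEQ[OF LIMSEQ_inverse_real_of_nat s(2)] by (simp add: o_def)
  have limx: "(\<lambda>n. x (s n)) \<longlonglongrightarrow> p"
  proof (rule Lim_transform[OF lim(1)])
    show "(\<lambda>n. x (s n) - k (s n)) \<longlonglongrightarrow> 0"
      by (rule Lim_null_comparison[OF _ inv0])
        (intro always_eventually allI less_imp_le *(4)[unfolded dist_norm])
  qed
  have limy: "(\<lambda>n. W (s n) ** x (s n)) \<longlonglongrightarrow> q"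
  proof (rule Lim_transform[OF lim(2)])
    show "(\<lambda>n. W (s n) ** x (s n) - k' (s n)) \<longlonglongrightarrow> 0"
      by (rule Lim_null_comparison[OF _ inv0])
        (intro always_eventually allI less_imp_le *(5)[unfolded dist_norm])
  qed
  obtain p' where p': "p ** p' = mat 1" "p' ** p = mat 1"
    using matrix_inverse[OF det[OF l(2)]] by blast
  obtain C where C: "C > 0" "\<And>(a :: real^'m^'m) (b :: real^'m^'m). norm (a ** b) \<le> norm a * norm b * C"
    using mm.pos_bounded by blast
  have "(\<lambda>n. norm (x (s n) - p) * (norm p' * C * C)) \<longlonglongrightarrow> norm (p - p) * (norm p' * C * C)"
    by (intro tendsto_intros limx)
  then have ev1: "\<forall>\<^sub>F n in sequentially. norm (x (s n) - p) * (norm p' * C * C) < 1 / 2"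
    by (intro order_tendstoD(2)) auto
  have "(\<lambda>n. norm (W (s n) ** x (s n))) \<longlonglongrightarrow> norm q"
    by (intro tendsto_intros limy)
  then have ev2: "\<forall>\<^sub>F n in sequentially. norm (W (s n) ** x (s n)) < norm q + 1"
    by (intro order_tendstoD(2)) auto
  have ev: "\<forall>\<^sub>F n in sequentially. norm (W (s n)) \<le> 2 * ((norm q + 1) * norm p' * C)"
    using ev1 ev2
  proof eventually_elim
    case (elim n)
    let ?W = "W (s n)" and ?x = "x (s n)"
    \<comment> \<open>Bound \<open>W\<close> by \<open>W p p\<^sup>-\<^sup>1\<close> and absorb the error term, which is at most half the norm of \<open>W\<close>.\<close>
    have "?W = (?W ** ?x - ?W ** (?x - p)) ** p'"
      by (simp add: mm.diff_right flip: matrix_mul_assoc) (simp add: p')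
    then have "norm ?W \<le> norm (?W ** ?x - ?W ** (?x - p)) * norm p' * C"
      using C(2) by metis
    also have "\<dots> \<le> (norm (?W ** ?x) + norm (?W ** (?x - p))) * norm p' * C"
      using C(1) by (intro mult_right_mono norm_triangle_ineq4) auto
    also have "\<dots> \<le> ((norm q + 1) + norm ?W * norm (?x - p) * C) * norm p' * C"
      using C(1) elim(2) by (intro mult_right_mono add_mono C(2)) auto
    also have "\<dots> = (norm q + 1) * norm p' * C + norm ?W * (norm (?x - p) * (norm p' * C * C))"
      by (simp add: algebra_simps)
    also have "\<dots> \<le> (norm q + 1) * norm p' * C + norm ?W * (1 / 2)"
      using elim(1) by (intro add_left_mono mult_left_mono) auto
    finally show ?case by simp
  qed
  define R where "R = 2 * ((norm q + 1) * norm p' * C)"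
  obtain N where N: "\<And>n. n \<ge> N \<Longrightarrow> norm (W (s n)) \<le> R"
    using ev unfolding R_def eventually_sequentially by blast
  have "\<forall>n. W (s (n + N)) \<in> cball 0 R" using N by simp
  moreover have "seq_compact (cball (0::real^'m^'m) R)"
    by (simp add: compact_cball flip: compact_eq_seq_compact_metric)
  ultimately obtain V t where t: "strict_mono (t :: nat \<Rightarrow> nat)" "((\<lambda>n. W (s (n + N))) \<circ> t) \<longlonglongrightarrow> V"
    by (metis seq_compactE)
  have limW: "(\<lambda>n. W (s (t n + N))) \<longlonglongrightarrow> V" using t(2) by (simp add: o_def)
  from SLZ_sequence_eventually_const[OF _ this] *(1)
  obtain n where n: "W (s (t n + N)) = V"
    by (metis (mono_tags, lifting) eventually_sequentially order.refl)
  have sub: "strict_mono (\<lambda>n. t n + N)" using t(1) by (simp add: strict_mono_def)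
  have "(\<lambda>n. W (s (t n + N)) ** x (s (t n + N))) \<longlonglongrightarrow> V ** p"
    using LIMSEQ_subseq_LIMSEQ[OF limx sub] by (intro mm.tendsto limW) (simp add: o_def)
  moreover have "(\<lambda>n. W (s (t n + N)) ** x (s (t n + N))) \<longlonglongrightarrow> q"
    using LIMSEQ_subseq_LIMSEQ[OF limy sub] by (simp add: o_def)
  ultimately have "V ** p = q" using LIMSEQ_unique by blast
  moreover have "V \<in> SLZ" "V \<noteq> mat 1" using n * by metis+
  ultimately show False using disj[of V] l by blast
qed

section \<open>Finite covolume and fundamental domains\<close>

text \<open>Determinants are bounded so that the quotient by \<open>SL(m,\<int>)\<close> has finite Lebesgue volume, and bounded by an
open condition so that small neighbourhoods stay inside.\<close>

definition slab :: "(real^'m^'m::finite) set" where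
  "slab = {x. 0 < det x \<and> det x < 1}"

definition SLZ_disjoint :: "(real^'m^'m::finite) set \<Rightarrow> bool" where
  "SLZ_disjoint E \<longleftrightarrow> (\<forall>W\<in>SLZ. W \<noteq> mat 1 \<longrightarrow> (**) W ` E \<inter> E = {})"

lemma open_slab: "open (slab :: (real^'m^'m::finite) set)"
proof -
  have "slab = det -` {0<..<1::real}" by (auto simp: slab_def)
  then show ?thesis
    using open_vimage[OF _ continuous_on_det] by (metis open_greaterThanLessThan)
qed

lemma SLZ_slab: "W \<in> SLZ \<Longrightarrow> W ** x \<in> slab \<longleftrightarrow> x \<in> slab"
  by (simp add: slab_def SLZ_iff det_mul)

lemma inner_matrix_Basis:
  fixes x :: "real^'n::finite^'m::finite"
  assumes "b \<in> Basis"
  obtains i j where "\<And>x :: real^'n^'m. x \<bullet> b = x $ i $ j"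
proof -
  from assms obtain i j where "b = axis i (axis j 1)"
    by (auto simp: Basis_vec_def)
  then show thesis using that[of i j] by (simp add: inner_axis)
qed

lemma norm_matrix_le_entries:
  fixes A :: "real^'n::finite^'m::finite"
  assumes "\<And>i j. \<bar>A $ i $ j\<bar> \<le> e"
  shows "norm A \<le> real (CARD('m) * CARD('n)) * e"
proof -
  have "norm A \<le> (\<Sum>i\<in>UNIV. norm (A $ i))"
    unfolding norm_vec_def by (rule L2_set_le_sum) simp
  also have "\<dots> \<le> (\<Sum>i\<in>(UNIV::'m set). \<Sum>j\<in>(UNIV::'n set). e)"
    by (intro sum_mono order.trans[OF norm_le_l1_cart] assms)
  finally show ?thesis by (simp add: mult.assoc)
qed

text \<open>Cover \<open>K\<close> by cubes of side \<open>1/T\<close>, where \<open>T\<close> is so large that the lower corners are close enough to \<open>K\<close> to be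
inequivalent under \<open>SL(m,\<int>)\<close> and to have determinant in \<open>(0,1)\<close>. Scaled by \<open>T\<close>, the corners are inequivalent integer
matrices of determinant at most \<open>T\<^sup>m\<close>, so there are at most \<open>2\<^sup>m\<^sup>-\<^sup>1 T\<^sup>m\<^sup>m\<close> cubes, each of volume \<open>T\<^sup>-\<^sup>m\<^sup>m\<close>.\<close>

lemma emeasure_compact_SLZ_disjoint_le:
  fixes K :: "(real^'m^'m::finite) set"
  assumes K: "compact K" "K \<subseteq> slab" "SLZ_disjoint K"
  shows "emeasure lebesgue K \<le> ennreal (2 ^ (CARD('m) - 1))"
proof (cases "K = {}")
  case False
  have nz: "det x \<noteq> 0" if "x \<in> K" for x
    using that K(2) by (auto simp: slab_def)
  obtain e1 where e1: "0 < e1" "\<And>x k k' W. W \<in> SLZ \<Longrightarrow> k \<in> K \<Longrightarrow> k' \<in> K \<Longrightarrow>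
      dist x k < e1 \<Longrightarrow> dist (W ** x) k' < e1 \<Longrightarrow> W = mat 1"
    using SLZ_separation[OF K(1) nz] K(3) unfolding SLZ_disjoint_def by blast
  obtain e2 where e2: "0 < e2" "{x. infdist x K \<le> e2} \<subseteq> slab"
    using compact_in_open_separated[OF False K(1) open_slab K(2)] by blast
  define e where "e = min e1 e2"
  have "0 < e" using e1(1) e2(1) by (simp add: e_def)
  define n where "n = CARD('m) * CARD('m)"
  obtain T0 :: nat where T0: "real n / e < real T0" using reals_Archimedean2 by blast
  define T where "T = Suc T0"
  have T: "0 < T" "real n * (1 / real T) < e"
  proof -
    have "real n / e < real T" using T0 by (simp add: T_def)
    then show "real n * (1 / real T) < e"
      using \<open>0 < e\<close> by (simp add: field_simps T_def)
  qed (simp add: T_def)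
  define M :: "real^'m^'m \<Rightarrow> real^'m^'m" where "M x = (\<chi> i j. of_int \<lfloor>real T * x $ i $ j\<rfloor>)" for x
  define p where "p A = (1 / real T) *\<^sub>R A" for A :: "real^'m^'m"
  define cube where "cube A = cbox (p A) (p A + (1 / real T) *\<^sub>R One)" for A :: "real^'m^'m"
  have close: "0 \<le> x $ i $ j - p (M x) $ i $ j \<and> x $ i $ j - p (M x) $ i $ j \<le> 1 / real T" for x i j
  proof -
    define a where "a = real T * x $ i $ j"
    have "0 \<le> a - of_int \<lfloor>a\<rfloor>" "a - of_int \<lfloor>a\<rfloor> \<le> 1" by linarith+
    then have "0 \<le> (a - of_int \<lfloor>a\<rfloor>) / real T \<and> (a - of_int \<lfloor>a\<rfloor>) / real T \<le> 1 / real T"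
      by (simp add: divide_right_mono)
    moreover have "x $ i $ j - p (M x) $ i $ j = (a - of_int \<lfloor>a\<rfloor>) / real T"
      using T(1) by (simp add: p_def M_def a_def diff_divide_distrib)
    ultimately show ?thesis by simp
  qed
  have dist_p: "dist (p (M x)) x < e" for x
  proof -
    have "\<bar>(x - p (M x)) $ i $ j\<bar> \<le> 1 / real T" for i j
      using close[of x i j] by simp
    then have "norm (x - p (M x)) \<le> real n * (1 / real T)"
      unfolding n_def by (rule norm_matrix_le_entries)
    then show ?thesis using T(2) by (simp add: dist_norm norm_minus_commute)
  qed
  have in_cube: "x \<in> cube (M x)" for x
    unfolding cube_def mem_box
  proof (intro ballI conjI)
    fix b :: "real^'m^'m" assume b: "b \<in> Basis"
    obtain i j where ij: "\<And>x :: real^'m^'m. x \<bullet> b = x $ i $ j" using inner_matrix_Basis[OF b] by blast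
    show "p (M x) \<bullet> b \<le> x \<bullet> b" using close[of x i j] by (simp add: ij)
    have "One \<bullet> b = 1" using b by simp
    then show "x \<bullet> b \<le> (p (M x) + (1 / real T) *\<^sub>R One) \<bullet> b"
      using close[of x i j] by (simp add: inner_add_left) (simp add: ij)
  qed
  have dim: "DIM(real^'m^'m) = n" by (simp add: n_def)
  have cube_vol: "emeasure lebesgue (cube A) = ennreal ((1 / real T) ^ n)" for A
  proof -
    have "emeasure lborel (cube A) = ennreal (\<Prod>b\<in>(Basis :: (real^'m^'m) set). 1 / real T)"
      unfolding cube_def by (subst emeasure_lborel_cbox_eq) (auto simp: inner_add_left intro!: prod.cong)
    also have "(\<Prod>b\<in>(Basis :: (real^'m^'m) set). 1 / real T) = (1 / real T) ^ n"
      by (simp add: dim del: DIM_cart)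
    finally show ?thesis by (simp add: cube_def)
  qed
  define U where "U = M ` K"
  have pU: "p A \<in> slab \<and> (\<exists>k\<in>K. dist (p A) k < e1)" if A: "A \<in> U" for A
  proof -
    obtain x where x: "x \<in> K" "A = M x" using A by (auto simp: U_def)
    have d: "dist (p A) x < e" using dist_p x by simp
    then have "infdist (p A) K \<le> e2"
      using infdist_le[OF x(1), of "p A"] by (simp add: e_def)
    then show ?thesis using e2(2) x(1) d by (auto simp: e_def)
  qed
  have Tp: "A = real T *\<^sub>R p A" for A using T(1) by (simp add: p_def)
  have U_int: "A $ i $ j \<in> \<int>" if "A \<in> U" for A i j
    using that by (auto simp: U_def M_def)
  have U_det: "0 < det A \<and> det A \<le> real (T ^ CARD('m))" if A: "A \<in> U" for A
  proof -
    have "det A = real T ^ CARD('m) * det (p A)"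
      by (subst Tp) (rule det_scaleR)
    then show ?thesis
      using pU[OF A] T(1) by (auto simp: slab_def mult_le_cancel_left1)
  qed
  have U_ineq: "W ** A = A" if A: "A \<in> U" and W: "W \<in> SLZ" "W ** A \<in> U" for A W
  proof -
    have "p (W ** A) = W ** p A"
      by (simp add: p_def linear_scale[OF linear_matrix_left])
    then have "W = mat 1"
      using pU[OF A] pU[OF W(2)] e1(2)[OF W(1)] by auto
    then show ?thesis by simp
  qed
  note cardU = card_inequivalent_integer_matrices_le[OF U_int U_det U_ineq]
  have "emeasure lebesgue K \<le> emeasure lebesgue (\<Union>A\<in>U. cube A)"
  proof (rule emeasure_mono)
    show "K \<subseteq> (\<Union>A\<in>U. cube A)" using in_cube by (auto simp: U_def)
    show "(\<Union>A\<in>U. cube A) \<in> sets lebesgue"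
      using cardU by (intro sets.finite_UN) (auto simp: cube_def)
  qed
  also have "\<dots> \<le> (\<Sum>A\<in>U. emeasure lebesgue (cube A))"
    using cardU by (intro emeasure_subadditive_finite) (auto simp: cube_def)
  also have "\<dots> = ennreal (real (card U) * (1 / real T) ^ n)"
    by (simp add: cube_vol ennreal_mult' ennreal_of_nat_eq_real_of_nat)
  also have "\<dots> \<le> ennreal (2 ^ (CARD('m) - 1) * real (T ^ CARD('m)) ^ CARD('m) * (1 / real T) ^ n)"
    using cardU by (intro ennreal_leI mult_right_mono) auto
  also have "2 ^ (CARD('m) - 1) * real (T ^ CARD('m)) ^ CARD('m) * (1 / real T) ^ n = 2 ^ (CARD('m) - 1)"
    using T(1) by (simp add: n_def power_mult[symmetric] power_divide)
  finally show ?thesis .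
qed simp

lemma SLZ_disjoint_mono: "SLZ_disjoint E \<Longrightarrow> F \<subseteq> E \<Longrightarrow> SLZ_disjoint F"
  unfolding SLZ_disjoint_def by blast

text \<open>This bounds the covolume of \<open>SL(m,\<int>)\<close>; it follows from the compact case by inner regularity.\<close>

lemma emeasure_SLZ_disjoint_le:
  fixes E :: "(real^'m^'m::finite) set"
  assumes E: "E \<in> sets lebesgue" "E \<subseteq> slab" "SLZ_disjoint E"
  shows "emeasure lebesgue E \<le> ennreal (2 ^ (CARD('m) - 1))"
proof -
  obtain N C where N: "negligible N" and C: "\<And>n::nat. compact (C n)" "E = (\<Union>n. C n) \<union> N"
    using lebesgue_regular_inner[OF E(1)] by blast
  define C' where "C' n = (\<Union>i\<le>n. C i)" for n
  have comp: "compact (C' n)" for n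
    unfolding C'_def using C(1) by (intro compact_UN) auto
  have sub: "C' n \<subseteq> E" for n by (auto simp: C'_def C(2))
  have "emeasure lebesgue (C' n) \<le> ennreal (2 ^ (CARD('m) - 1))" for n
    by (intro emeasure_compact_SLZ_disjoint_le comp order.trans[OF sub E(2)] SLZ_disjoint_mono[OF E(3) sub])
  then have "(SUP n. emeasure lebesgue (C' n)) \<le> ennreal (2 ^ (CARD('m) - 1))"
    by (rule SUP_least)
  also have "(SUP n. emeasure lebesgue (C' n)) = emeasure lebesgue (\<Union>n. C' n)"
  proof (rule SUP_emeasure_incseq)
    show "range C' \<subseteq> sets lebesgue"
      using comp by (auto intro: fmeasurableD lmeasurable_compact)
    show "incseq C'" unfolding incseq_def C'_def by (intro allI impI UN_mono) auto
  qed
  also have "(\<Union>n. C' n) = (\<Union>n. C n)" by (auto simp: C'_def)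
  also have "emeasure lebesgue (\<Union>n. C n) = emeasure lebesgue E"
    unfolding C(2) using N C(1)
    by (intro emeasure_Un_null_set[symmetric])
      (auto simp: negligible_iff_null_sets intro!: fmeasurableD[OF lmeasurable_compact] sets.countable_UN)
  finally show ?thesis .
qed

definition SLZ_domain :: "(real^'m^'m::finite) set \<Rightarrow> bool" where
  "SLZ_domain D \<longleftrightarrow> D \<in> sets lebesgue \<and> D \<subseteq> slab \<and> SLZ_disjoint D \<and> slab \<subseteq> (\<Union>W\<in>SLZ. (**) W ` D)"

text \<open>Cover the slab by countably many open sets \<open>V n\<close> with disjoint translates, and take from each \<open>V n\<close> what
is not equivalent to a point of an earlier one.\<close>

lemma SLZ_domain_exists: "\<exists>D :: (real^'m^'m::finite) set. SLZ_domain D"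
proof -
  define \<F> where "\<F> = {V :: (real^'m^'m) set. open V \<and> V \<subseteq> slab \<and> SLZ_disjoint V}"
  have cover: "\<exists>V\<in>\<F>. x \<in> V" if x: "x \<in> slab" for x
  proof -
    have nz: "det x \<noteq> 0" using x by (simp add: slab_def)
    obtain x' where x': "x ** x' = mat 1" using matrix_inverse[OF nz] by blast
    have "W = mat 1" if "W ** x = x" for W
      using that x' by (metis matrix_mul_assoc matrix_mul_rid)
    then have disj: "(**) W ` {x} \<inter> {x} = {}" if "W \<in> SLZ" "W \<noteq> mat 1" for W
      using that by auto
    have "det y \<noteq> 0" if "y \<in> {x}" for y using that nz by simp
    then obtain e where e: "0 < e" "\<And>y k k' W. W \<in> SLZ \<Longrightarrow> k \<in> {x} \<Longrightarrow> k' \<in> {x} \<Longrightarrow>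
        dist y k < e \<Longrightarrow> dist (W ** y) k' < e \<Longrightarrow> W = mat 1"
      using SLZ_separation[of "{x}", OF compact_sing _ disj] by (metis (no_types))
    have "SLZ_disjoint (ball x e \<inter> slab)"
      unfolding SLZ_disjoint_def
    proof (intro ballI impI)
      fix W :: "real^'m^'m" assume W: "W \<in> SLZ" "W \<noteq> mat 1"
      show "(**) W ` (ball x e \<inter> slab) \<inter> (ball x e \<inter> slab) = {}"
        using e(2)[OF W(1) singletonI singletonI] W(2) by (auto simp: dist_commute)
    qed
    then show ?thesis
      using x e(1) open_slab by (intro bexI[of _ "ball x e \<inter> slab"]) (auto simp: \<F>_def)
  qed
  obtain \<F>' where \<F>': "\<F>' \<subseteq> \<F>" "countable \<F>'" "\<Union>\<F>' = \<Union>\<F>"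
    using Lindelof[of \<F>] by (auto simp: \<F>_def)
  have empty: "{} \<in> \<F>" by (simp add: \<F>_def SLZ_disjoint_def)
  define V where "V = from_nat_into (insert {} \<F>')"
  have rangeV: "range V = insert {} \<F>'"
    unfolding V_def using \<F>'(2) by (intro range_from_nat_into) auto
  have "V n \<in> \<F>" for n
    using rangeV \<F>'(1) empty by (metis insert_subset rangeI subsetD)
  then have V: "open (V n)" "V n \<subseteq> slab" "SLZ_disjoint (V n)" for n
    by (auto simp: \<F>_def)
  have V_cover: "\<exists>n. x \<in> V n" if "x \<in> slab" for x
    using cover[OF that] \<F>'(3) rangeV by (metis UnionE UnionI insertCI rangeE)
  have open_img: "open ((**) W ` S)" if "W \<in> SLZ" "open S" for W and S :: "(real^'m^'m) set"
    using that by (intro open_surjective_linear_image linear_matrix_left bij_is_surj bij_matrix_left)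
      (auto simp: SLZ_iff)
  \<comment> \<open>The points equivalent to a point of an earlier set.\<close>
  define Q where "Q n = (\<Union>j<n. \<Union>W\<in>SLZ. (**) W ` V j)" for n
  have Q_inv: "W ** x \<in> Q n" if "x \<in> Q n" "W \<in> SLZ" for W x n
    using that unfolding Q_def by (force simp: matrix_mul_assoc intro: SLZ_mult)
  define D where "D = (\<Union>n. V n - Q n)"
  have "open (Q n)" for n
    unfolding Q_def using open_img V(1) by (intro open_UN ballI) auto
  then have "D \<in> sets borel"
    unfolding D_def using V(1) by (intro sets.countable_UN image_subsetI sets.Diff borel_open) auto
  then have "D \<in> sets lebesgue" by simp
  moreover have "D \<subseteq> slab" using V(2) by (auto simp: D_def)
  moreover have "SLZ_disjoint D"
    unfolding SLZ_disjoint_def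
  proof (intro ballI impI equals0I)
    fix W y :: "real^'m^'m" assume W: "W \<in> SLZ" "W \<noteq> mat 1" and "y \<in> (**) W ` D \<inter> D"
    then obtain x i j where x: "x \<in> V i" "x \<notin> Q i" "W ** x \<in> V j" "W ** x \<notin> Q j"
      by (auto simp: D_def)
    obtain W' where W': "W' \<in> SLZ" "W' ** W = mat 1" using SLZ_inverse[OF W(1)] by blast
    have x_eq: "x = W' ** (W ** x)" using W'(2) by (simp add: matrix_mul_assoc)
    consider "i < j" | "j < i" | "i = j" by linarith
    then show False
    proof cases
      case 1
      then have "W ** x \<in> Q j" using x(1) W(1) by (auto simp: Q_def)
      then show False using x by simp
    next
      case 2
      then have "W' ** (W ** x) \<in> Q i" using x(3) W'(1) by (auto simp: Q_def)
      then show False using x x_eq by simp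
    next
      case 3
      then show False using V(3)[of i] W x by (auto simp: SLZ_disjoint_def)
    qed
  qed
  moreover have "slab \<subseteq> (\<Union>W\<in>SLZ. (**) W ` D)"
  proof
    fix x :: "real^'m^'m" assume x: "x \<in> slab"
    define n where "n = (LEAST n. \<exists>W\<in>SLZ. W ** x \<in> V n)"
    have "\<exists>n. \<exists>W\<in>SLZ. W ** x \<in> V n"
      using V_cover[OF x] mat_1_SLZ by (metis matrix_mul_lid)
    then have "\<exists>W\<in>SLZ. W ** x \<in> V n" unfolding n_def by (rule LeastI_ex)
    then obtain W where W: "W \<in> SLZ" "W ** x \<in> V n" by blast
    have least: "W' ** x \<notin> V j" if "j < n" "W' \<in> SLZ" for j W'
      using that not_less_Least unfolding n_def by blast
    obtain W' where W': "W' \<in> SLZ" "W' ** W = mat 1" using SLZ_inverse[OF W(1)] by blast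
    have "W ** x \<notin> Q n"
    proof
      assume "W ** x \<in> Q n"
      then obtain j V' v where j: "j < n" "V' \<in> SLZ" "v \<in> V j" "W ** x = V' ** v"
        by (auto simp: Q_def)
      obtain V'' where "V'' \<in> SLZ" "V'' ** V' = mat 1" using SLZ_inverse[OF j(2)] by blast
      then have "(V'' ** W) ** x = v"
        by (metis j(4) matrix_mul_assoc matrix_mul_lid)
      then show False using least[OF j(1) SLZ_mult[OF \<open>V'' \<in> SLZ\<close> W(1)]] j(3) by simp
    qed
    then have "W ** x \<in> D" using W(2) by (auto simp: D_def)
    moreover have "x = W' ** (W ** x)" using W'(2) by (simp add: matrix_mul_assoc)
    ultimately show "x \<in> (\<Union>W\<in>SLZ. (**) W ` D)" using W'(1) by blast
  qed
  ultimately show ?thesis unfolding SLZ_domain_def by blast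
qed

section \<open>Volume modulo the integral group\<close>

lemma countable_SLZ: "countable (SLZ :: (real^'m^'m::finite) set)"
proof -
  have "(SLZ :: (real^'m^'m) set) \<subseteq> range (\<lambda>f :: 'm \<Rightarrow> 'm \<Rightarrow> int. \<chi> i j. of_int (f i j))"
  proof
    fix W :: "real^'m^'m" assume "W \<in> SLZ"
    then have "W = (\<chi> i j. of_int (\<lfloor>W $ i $ j\<rfloor>))"
      by (auto simp: SLZ_iff vec_eq_iff elim!: allE elim: Ints_cases)
    then show "W \<in> range (\<lambda>f :: 'm \<Rightarrow> 'm \<Rightarrow> int. \<chi> i j. of_int (f i j))"
      by (intro image_eqI[of _ _ "\<lambda>i j. \<lfloor>W $ i $ j\<rfloor>"]) auto
  qed
  then show ?thesis by (rule countable_subset) simp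
qed

definition SLZ_invariant :: "(real^'m^'m::finite) set \<Rightarrow> bool" where
  "SLZ_invariant E \<longleftrightarrow> (\<forall>W\<in>SLZ. \<forall>x\<in>E. W ** x \<in> E)"

lemma SLZ_invariant_iff:
  assumes "SLZ_invariant E" "W \<in> SLZ"
  shows "W ** x \<in> E \<longleftrightarrow> x \<in> E"
proof
  obtain W' where W': "W' \<in> SLZ" "W' ** W = mat 1" using SLZ_inverse[OF assms(2)] by blast
  assume "W ** x \<in> E"
  then have "W' ** (W ** x) \<in> E" using assms(1) W'(1) by (simp add: SLZ_invariant_def)
  then show "x \<in> E" using W'(2) by (simp add: matrix_mul_assoc)
qed (use assms in \<open>simp add: SLZ_invariant_def\<close>)

lemma SLZ_disjoint_unique:
  assumes D: "SLZ_disjoint D" and W: "W1 \<in> SLZ" "W2 \<in> SLZ" and x: "x \<in> D" "y \<in> D" "W1 ** x = W2 ** y"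
  shows "W1 = W2"
proof -
  obtain V where V: "V \<in> SLZ" "V ** W2 = mat 1" "W2 ** V = mat 1" using SLZ_inverse[OF W(2)] by metis
  have "(V ** W1) ** x = y"
    using x(3) V(2) by (metis matrix_mul_assoc matrix_mul_lid)
  then have "V ** W1 = mat 1"
    using D x SLZ_mult[OF V(1) W(1)] unfolding SLZ_disjoint_def by blast
  then have "W2 ** (V ** W1) = W2" by simp
  then show ?thesis using V(3) by (simp add: matrix_mul_assoc)
qed

text \<open>Cut \<open>E \<inter> D\<close> into the countably many pieces that lie in the translates of \<open>D'\<close> and move each piece back into \<open>D'\<close>.
The pieces remain disjoint because \<open>D\<close> has disjoint translates.\<close>

lemma emeasure_domain_le:
  fixes E D D' :: "(real^'m^'m::finite) set"
  assumes E: "E \<in> sets lebesgue" "SLZ_invariant E" "E \<subseteq> slab"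
    and D: "SLZ_domain D" and D': "SLZ_domain D'"
  shows "emeasure lebesgue (E \<inter> D) \<le> emeasure lebesgue (E \<inter> D')"
proof -
  note d = D[unfolded SLZ_domain_def] and d' = D'[unfolded SLZ_domain_def]
  \<comment> \<open>The part of \<open>D'\<close> that \<open>W\<close> moves into \<open>D\<close>.\<close>
  define B where "B W = {x \<in> D' \<inter> E. W ** x \<in> D}" for W
  have B: "B W \<in> sets lebesgue" and WB: "(**) W ` B W \<in> sets lebesgue"
    "emeasure lebesgue ((**) W ` B W) = emeasure lebesgue (B W)" if W: "W \<in> SLZ" for W
  proof -
    obtain V where V: "V \<in> SLZ" "V ** W = mat 1" "W ** V = mat 1" using SLZ_inverse[OF W] by metis
    have "B W = D' \<inter> E \<inter> (**) V ` D"
    proof (intro equalityI subsetI)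
      fix x assume "x \<in> B W"
      moreover have "x = V ** (W ** x)" using V(2) by (simp add: matrix_mul_assoc)
      ultimately show "x \<in> D' \<inter> E \<inter> (**) V ` D" unfolding B_def by blast
    next
      fix x assume "x \<in> D' \<inter> E \<inter> (**) V ` D"
      then show "x \<in> B W" using V(3) by (auto simp: B_def matrix_mul_assoc)
    qed
    then show B: "B W \<in> sets lebesgue"
      using d d' E(1) V(1) by (auto simp: SLZ_iff intro!: sets.Int left_translate_lebesgue(1))
    show "(**) W ` B W \<in> sets lebesgue"
      "emeasure lebesgue ((**) W ` B W) = emeasure lebesgue (B W)"
      using left_translate_lebesgue[OF _ B, of W] emeasure_left_translate[OF _ B, of W] W by (simp_all add: SLZ_iff)
  qed
  have disj: "disjoint_family_on (\<lambda>W. (**) W ` B W) SLZ"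
    unfolding disjoint_family_on_def using SLZ_disjoint_unique[of D'] d' by (auto simp: B_def)
  have disj': "disjoint_family_on B SLZ"
    unfolding disjoint_family_on_def
  proof (intro ballI impI equals0I)
    fix W V x assume W: "W \<in> SLZ" "V \<in> SLZ" "W \<noteq> V" "x \<in> B W \<inter> B V"
    obtain W' where W': "W' \<in> SLZ" "W' ** W = mat 1" using SLZ_inverse[OF W(1)] by blast
    obtain V' where V': "V' \<in> SLZ" "V' ** V = mat 1" "V ** V' = mat 1" using SLZ_inverse[OF W(2)] by metis
    have "W' ** (W ** x) = V' ** (V ** x)" using W'(2) V'(2) by (simp add: matrix_mul_assoc)
    moreover have "W ** x \<in> D" "V ** x \<in> D" using W(4) by (auto simp: B_def)
    ultimately have "W' = V'"
      using SLZ_disjoint_unique[of D W' V' "W ** x" "V ** x"] d W'(1) V'(1) by blast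
    then have "V ** (W' ** W) = W" using V'(3) by (simp add: matrix_mul_assoc)
    then show False using W'(2) W(3) by simp
  qed
  have "E \<inter> D = (\<Union>W\<in>SLZ. (**) W ` B W)"
  proof (intro equalityI subsetI)
    fix y assume y: "y \<in> E \<inter> D"
    then have "y \<in> slab" using E(3) by blast
    then obtain W x where "W \<in> SLZ" "x \<in> D'" "y = W ** x" using d' by blast
    then show "y \<in> (\<Union>W\<in>SLZ. (**) W ` B W)"
      using y SLZ_invariant_iff[OF E(2)] by (auto simp: B_def)
  qed (use SLZ_invariant_iff[OF E(2)] in \<open>auto simp: B_def\<close>)
  then have "emeasure lebesgue (E \<inter> D) = (\<integral>\<^sup>+W. emeasure lebesgue ((**) W ` B W) \<partial>count_space SLZ)"
    using emeasure_UN_countable[OF WB(1) countable_SLZ disj] by simp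
  also have "\<dots> = (\<integral>\<^sup>+W. emeasure lebesgue (B W) \<partial>count_space SLZ)"
    by (rule nn_integral_cong) (simp add: WB(2))
  also have "\<dots> = emeasure lebesgue (\<Union>W\<in>SLZ. B W)"
    by (rule emeasure_UN_countable[OF B countable_SLZ disj', symmetric])
  also have "\<dots> \<le> emeasure lebesgue (E \<inter> D')"
    using E(1) d' by (intro emeasure_mono) (auto simp: B_def)
  finally show ?thesis .
qed

abbreviation rtrans :: "(real^'m^'m::finite) set \<Rightarrow> real^'m^'m \<Rightarrow> (real^'m^'m) set" where
  "rtrans S g \<equiv> (\<lambda>x. x ** g) ` S"

lemma rtrans_rtrans: "rtrans (rtrans S g) h = rtrans S (g ** h)"
  by (simp add: image_image matrix_mul_assoc)

lemma rtrans_iff: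
  assumes "g ** g' = mat 1"
  shows "x \<in> rtrans S g' \<longleftrightarrow> x ** g \<in> S"
proof
  assume "x ** g \<in> S"
  moreover have "x = (x ** g) ** g'" using assms by (simp flip: matrix_mul_assoc)
  ultimately show "x \<in> rtrans S g'" by blast
next
  have *: "g' ** g = mat 1" using assms by (simp add: matrix_left_right_inverse)
  assume "x \<in> rtrans S g'"
  then show "x ** g \<in> S" using * by (auto simp flip: matrix_mul_assoc)
qed

lemma rtrans_Diff:
  assumes "det g \<noteq> 0"
  shows "rtrans (S - T) g = rtrans S g - rtrans T g"
  using bij_matrix_right[OF assms] by (simp add: image_set_diff bij_is_inj)

lemma SLZ_invariant_rtrans: "SLZ_invariant E \<Longrightarrow> SLZ_invariant (rtrans E g)"
  by (auto simp: SLZ_invariant_def matrix_mul_assoc)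

lemma SLZ_domain_rtrans:
  fixes D :: "(real^'m^'m::finite) set"
  assumes D: "SLZ_domain D" and g: "det g = 1"
  shows "SLZ_domain (rtrans D g)"
proof -
  obtain g' where g': "g ** g' = mat 1" "g' ** g = mat 1" "det g' = inverse (det g)"
    using matrix_inverse[of g] g by auto
  have 1: "rtrans D g \<in> sets lebesgue"
    using D g by (simp add: SLZ_domain_def right_translate_lebesgue)
  have 2: "rtrans D g \<subseteq> slab"
    using D g by (auto simp: SLZ_domain_def slab_def det_mul)
  have 3: "SLZ_disjoint (rtrans D g)"
    unfolding SLZ_disjoint_def
  proof (intro ballI impI equals0I)
    fix W y :: "real^'m^'m" assume W: "W \<in> SLZ" "W \<noteq> mat 1" "y \<in> (**) W ` rtrans D g \<inter> rtrans D g"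
    then obtain x x' where x: "x \<in> D" "x' \<in> D" "W ** (x ** g) = x' ** g" by auto
    then have "(W ** (x ** g)) ** g' = (x' ** g) ** g'" by simp
    then have "W ** x = x'" using g'(1) by (simp flip: matrix_mul_assoc)
    then show False using D x W unfolding SLZ_domain_def SLZ_disjoint_def by blast
  qed
  have 4: "slab \<subseteq> (\<Union>W\<in>SLZ. (**) W ` rtrans D g)"
  proof
    fix y :: "real^'m^'m" assume "y \<in> slab"
    then have "y ** g' \<in> slab" using g g'(3) by (simp add: slab_def det_mul)
    then obtain W x where W: "W \<in> SLZ" "x \<in> D" "y ** g' = W ** x"
      using D by (auto simp: SLZ_domain_def)
    have "y = (y ** g') ** g" using g'(2) by (simp flip: matrix_mul_assoc)
    then have "y = W ** (x ** g)" using W(3) by (simp flip: matrix_mul_assoc)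
    then show "y \<in> (\<Union>W\<in>SLZ. (**) W ` rtrans D g)" using W by blast
  qed
  show ?thesis using 1 2 3 4 by (simp add: SLZ_domain_def)
qed

text \<open>The volume of an invariant set inside a fundamental domain does not depend on the domain, and right
translates of fundamental domains are again fundamental domains.\<close>

lemma emeasure_domain_rtrans:
  fixes E D :: "(real^'m^'m::finite) set"
  assumes E: "E \<in> sets lebesgue" "SLZ_invariant E" "E \<subseteq> slab"
    and D: "SLZ_domain D" and g: "det g = 1"
  shows "emeasure lebesgue (rtrans E g \<inter> D) = emeasure lebesgue (E \<inter> D)"
proof -
  obtain g' where g': "g ** g' = mat 1" "g' ** g = mat 1" "det g' = inverse (det g)"
    using matrix_inverse[of g] g by auto
  have det': "det g' = 1" using g g'(3) by simp
  have Dl: "D \<in> sets lebesgue" using D by (simp add: SLZ_domain_def)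
  have "rtrans E g \<inter> D = rtrans (E \<inter> rtrans D g') g"
    using bij_matrix_right[of g] g by (simp add: image_Int bij_is_inj rtrans_rtrans g')
  then have "emeasure lebesgue (rtrans E g \<inter> D) = emeasure lebesgue (E \<inter> rtrans D g')"
    using emeasure_right_translate[OF g, of "E \<inter> rtrans D g'"] E(1) right_translate_lebesgue[OF det' Dl]
    by simp
  also have "\<dots> = emeasure lebesgue (E \<inter> D)"
    using emeasure_domain_le[OF E D SLZ_domain_rtrans[OF D det']]
      emeasure_domain_le[OF E SLZ_domain_rtrans[OF D det'] D] by (rule antisym[rotated])
  finally show ?thesis .
qed

lemma null_of_domain_null:
  fixes E D :: "(real^'m^'m::finite) set"
  assumes E: "E \<in> sets lebesgue" "SLZ_invariant E" "E \<subseteq> slab"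
    and D: "SLZ_domain D" and null: "emeasure lebesgue (E \<inter> D) = 0"
  shows "E \<in> null_sets lebesgue"
proof -
  have "E \<inter> D \<in> null_sets lebesgue"
    using null E(1) D by (auto simp: null_sets_def SLZ_domain_def)
  then have "(\<Union>W\<in>SLZ. (**) W ` (E \<inter> D)) \<in> null_sets lebesgue"
    by (intro null_sets_UN' countable_SLZ null_sets_bij_linear_image linear_matrix_left bij_matrix_left)
      (auto simp: SLZ_iff)
  moreover have "E \<subseteq> (\<Union>W\<in>SLZ. (**) W ` (E \<inter> D))"
  proof
    fix y assume y: "y \<in> E"
    then have "y \<in> slab" using E(3) by blast
    then obtain W x where "W \<in> SLZ" "x \<in> D" "y = W ** x" using D by (auto simp: SLZ_domain_def)
    then show "y \<in> (\<Union>W\<in>SLZ. (**) W ` (E \<inter> D))"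
      using y SLZ_invariant_iff[OF E(2)] by blast
  qed
  ultimately show ?thesis using E(1) by (metis null_sets_subset)
qed

section \<open>The Mautner phenomenon\<close>

text \<open>Replace \<open>B \<inter> D\<close> by a compact subset \<open>K\<close> and choose an open \<open>U \<supseteq> K\<close> of almost the same measure. If \<open>u\<close> is near 1,
then \<open>Ku \<subseteq> U\<close>, and as \<open>K\<close> and \<open>Ku\<close> have equal measure, little of \<open>K\<close> lies outside \<open>Ku\<close>.\<close>

lemma right_translation_continuous:
  fixes B D :: "(real^'m^'m::finite) set"
  assumes B: "B \<in> sets lebesgue" and D: "D \<in> sets lebesgue" "emeasure lebesgue (B \<inter> D) < \<infinity>" and e: "0 < (e::real)"
  obtains d where "0 < d" "\<And>u. det u = 1 \<Longrightarrow> norm (u - mat 1) < d \<Longrightarrow>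
    emeasure lebesgue ((B - rtrans B u) \<inter> D) \<le> ennreal e"
proof -
  have BD: "B \<inter> D \<in> sets lebesgue" using B D by blast
  have e2: "0 < ennreal (e / 2)" using e by simp
  obtain K where K: "compact K" "K \<subseteq> B \<inter> D" "emeasure lebesgue (B \<inter> D - K) < ennreal (e / 2)"
    using lebesgue_inner_compact[OF BD D(2) e2] by blast
  have Kl: "K \<in> sets lebesgue" using K(1) by (rule compact_sets_lebesgue)
  obtain U where U: "open U" "K \<subseteq> U" "emeasure lebesgue (U - K) < ennreal (e / 2)"
    by (rule sets_lebesgue_outer_open[OF Kl half_gt_zero[OF e]]) (rule that)
  have Ul: "U \<in> sets lebesgue" using U(1) by (simp add: borel_open)
  obtain d where d: "0 < d" "\<And>u. norm (u - mat 1) < d \<Longrightarrow> rtrans K u \<subseteq> U"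
  proof (cases "K = {}")
    case False
    obtain r where r: "0 < r" "{x. infdist x K \<le> r} \<subseteq> U"
      using compact_in_open_separated[OF False K(1) U(1,2)] by blast
    obtain R where R: "0 < R" "\<And>x. x \<in> K \<Longrightarrow> norm x \<le> R"
      using compact_imp_bounded[OF K(1)] unfolding bounded_pos by blast
    obtain C where C: "C > 0" "\<And>(a :: real^'m^'m) (b :: real^'m^'m). norm (a ** b) \<le> norm a * norm b * C"
      using bounded_bilinear.pos_bounded[OF bounded_bilinear_matrix_mult[where 'm='m]] by blast
    show thesis
    proof (rule that[of "r / (R * C)"])
      show "0 < r / (R * C)" using r R C by simp
      fix u :: "real^'m^'m" assume u: "norm (u - mat 1) < r / (R * C)"
      show "rtrans K u \<subseteq> U"
      proof
        fix y assume "y \<in> rtrans K u"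
        then obtain x where x: "x \<in> K" "y = x ** u" by blast
        have "y - x = x ** (u - mat 1)"
          using linear_diff[OF linear_matrix_left, of x u "mat 1"] by (simp add: x)
        then have "norm (y - x) \<le> norm x * norm (u - mat 1) * C"
          using C(2) by simp
        also have "\<dots> \<le> R * (r / (R * C)) * C"
          using u R C(1) x by (intro mult_right_mono mult_mono) auto
        also have "\<dots> = r" using R C by simp
        finally have "infdist y K \<le> r"
          using infdist_le[OF x(1), of y] by (simp add: dist_norm)
        then show "y \<in> U" using r(2) by blast
      qed
    qed
  qed (use that[of 1] in auto)
  show thesis
  proof (rule that[OF d(1)])
    fix u :: "real^'m^'m" assume u: "det u = 1" "norm (u - mat 1) < d"
    have Ku: "rtrans K u \<in> sets lebesgue" "emeasure lebesgue (rtrans K u) = emeasure lebesgue K"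
      using right_translate_lebesgue[OF u(1) Kl] emeasure_right_translate[OF u(1) Kl] by auto
    have fin: "emeasure lebesgue K \<noteq> \<infinity>"
      using lmeasurable_compact[OF K(1)] by (metis fmeasurableD2 infinity_ennreal_def)
    have "emeasure lebesgue (K - rtrans K u) \<le> emeasure lebesgue (U - rtrans K u)"
      using Ul Ku U(2) by (intro emeasure_mono) auto
    also have "\<dots> = emeasure lebesgue U - emeasure lebesgue K"
      using d(2)[OF u(2)] Ul Ku fin by (subst emeasure_Diff) auto
    also have "\<dots> = emeasure lebesgue (U - K)"
      using U(2) Ul Kl fin by (subst emeasure_Diff) auto
    finally have 1: "emeasure lebesgue (K - rtrans K u) \<le> ennreal (e / 2)"
      using U(3) by simp
    have "emeasure lebesgue ((B - rtrans B u) \<inter> D) \<le> emeasure lebesgue ((B \<inter> D - K) \<union> (K - rtrans K u))"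
      using K(2) BD Kl Ku(1) by (intro emeasure_mono) auto
    also have "\<dots> \<le> emeasure lebesgue (B \<inter> D - K) + emeasure lebesgue (K - rtrans K u)"
      using BD Kl Ku(1) by (intro emeasure_subadditive) auto
    also have "\<dots> \<le> ennreal (e / 2) + ennreal (e / 2)"
      using 1 K(3) by (intro add_mono) auto
    also have "\<dots> = ennreal e"
      using e by (simp flip: ennreal_plus)
    finally show "emeasure lebesgue ((B - rtrans B u) \<inter> D) \<le> ennreal e" .
  qed
qed

lemma norm_transvection_diff_le:
  assumes "i \<noteq> j"
  shows "norm (transvection i j c - mat 1 :: real^'m^'m::finite) \<le> real (CARD('m) * CARD('m)) * \<bar>c\<bar>"
  using assms by (intro norm_matrix_le_entries) (auto simp: transvection_def mat_def)

text \<open>Conjugation by \<open>diag_mat d\<close> multiplies the entry \<open>c\<close> of the transvection by \<open>q = d j / d i < 1\<close>. The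
volume \<open>f c\<close> of \<open>B - B u\<close> in a fundamental domain does not change under this conjugation, since \<open>B\<close> is fixed by
\<open>diag_mat d\<close>. Hence \<open>f c = f (q\<^sup>n c)\<close>, and the right-hand side tends to 0.\<close>

lemma mautner:
  fixes B :: "(real^'m^'m::finite) set"
  assumes B: "B \<in> sets lebesgue" "SLZ_invariant B" "B \<subseteq> slab"
    and d: "rtrans B (diag_mat d) = B" "(\<Prod>i\<in>UNIV. d i) = 1"
    and ij: "i \<noteq> j" "0 < d j" "d j < d i"
  shows "B - rtrans B (transvection i j c) \<in> null_sets lebesgue"
proof -
  obtain D :: "(real^'m^'m) set" where D: "SLZ_domain D" using SLZ_domain_exists by blast
  have Dl: "D \<in> sets lebesgue" using D by (simp add: SLZ_domain_def)
  define E where "E c = B - rtrans B (transvection i j c)" for c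
  define f where "f c = emeasure lebesgue (E c \<inter> D)" for c
  have detT: "det (transvection i j c :: real^'m^'m) = 1" for c by (rule det_transvection[OF ij(1)])
  have detd: "det (diag_mat d) = 1" using d(2) by (simp add: det_diag_mat)
  have El: "E c \<in> sets lebesgue" for c
    unfolding E_def using B(1) by (intro sets.Diff right_translate_lebesgue detT)
  have Einv: "SLZ_invariant (E c)" for c
    unfolding SLZ_invariant_def E_def
    using SLZ_invariant_iff[OF B(2)] SLZ_invariant_iff[OF SLZ_invariant_rtrans[OF B(2)]] by blast
  have Esub: "E c \<subseteq> slab" for c using B(3) by (auto simp: E_def)
  define q where "q = d j / d i"
  have q: "0 < q" "q < 1" using ij by (auto simp: q_def)
  have step: "f c = f (q * c)" for c
  proof -
    have di: "d i \<noteq> 0" using ij by auto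
    have "transvection i j c ** diag_mat d = diag_mat d ** transvection i j (q * c)"
      using diag_mat_transvection[OF ij(1), of d "q * c"] ij di by (simp add: q_def)
    then have "rtrans (E c) (diag_mat d) = E (q * c)"
      unfolding E_def using detd
      by (simp add: rtrans_Diff rtrans_rtrans d(1)) (metis d(1) rtrans_rtrans)
    then show ?thesis
      using emeasure_domain_rtrans[OF El Einv Esub D detd, of c] by (simp add: f_def)
  qed
  have pow: "f c = f (q ^ n * c)" for n
    by (induction n) (use step in \<open>auto simp: mult.assoc\<close>)
  have BD: "emeasure lebesgue (B \<inter> D) < \<infinity>"
  proof -
    have "emeasure lebesgue (B \<inter> D) \<le> ennreal (2 ^ (CARD('m) - 1))"
      using D B(1) by (intro emeasure_SLZ_disjoint_le)
        (auto simp: SLZ_domain_def intro: SLZ_disjoint_mono[of D])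
    then show ?thesis by (simp add: le_less_trans)
  qed
  have small: "f c \<le> ennreal e" if e: "0 < e" for e
  proof -
    obtain \<delta> where \<delta>: "0 < \<delta>" "\<And>u. det u = 1 \<Longrightarrow> norm (u - mat 1) < \<delta> \<Longrightarrow>
        emeasure lebesgue ((B - rtrans B u) \<inter> D) \<le> ennreal e"
      using right_translation_continuous[OF B(1) Dl BD e] by blast
    have "(\<lambda>n. real (CARD('m) * CARD('m)) * \<bar>q ^ n * c\<bar>) \<longlonglongrightarrow> real (CARD('m) * CARD('m)) * \<bar>0 * c\<bar>"
      using q by (intro tendsto_intros LIMSEQ_power_zero) auto
    then have "\<forall>\<^sub>F n in sequentially. real (CARD('m) * CARD('m)) * \<bar>q ^ n * c\<bar> < \<delta>"
      using \<delta>(1) by (intro order_tendstoD(2)) auto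
    then obtain n where "real (CARD('m) * CARD('m)) * \<bar>q ^ n * c\<bar> < \<delta>"
      using eventually_happens'[OF sequentially_bot] by blast
    then have "norm (transvection i j (q ^ n * c) - mat 1 :: real^'m^'m) < \<delta>"
      using norm_transvection_diff_le[OF ij(1), of "q ^ n * c"] by linarith
    then show ?thesis
      using \<delta>(2)[OF detT] pow[of n] by (simp add: f_def E_def)
  qed
  have "f c \<le> 0"
    by (rule ennreal_le_epsilon) (simp add: small)
  then have "f c = 0" by simp
  then show ?thesis
    using null_of_domain_null[OF El Einv Esub D, of c] by (simp add: f_def E_def)
qed

section \<open>Almost invariant sets are null or conull\<close>

abbreviation GLpos :: "(real^'m^'m::finite) set" where "GLpos \<equiv> {x. 0 < det x}"

lemma open_GLpos: "open (GLpos :: (real^'m^'m::finite) set)"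
  by (intro open_Collect_less continuous_on_const continuous_on_det)

lemma GLpos_scaled_SL:
  fixes g :: "real^'m^'m::finite"
  assumes "0 < det g"
  obtains t h where "0 < t" "det h = 1" "g = t *\<^sub>R h"
proof -
  define t where "t = root CARD('m) (det g)"
  have t: "0 < t" "t ^ CARD('m) = det g"
    using assms unfolding t_def by (auto intro!: real_root_gt_zero real_root_pow_pos)
  have "det (inverse t *\<^sub>R g) = 1"
    using t assms by (simp add: det_scaleR power_inverse)
  then show thesis using that[of t "inverse t *\<^sub>R g"] t(1) by simp
qed

lemma matrix_mult_scaleR:
  fixes A B :: "real^'m^'m::finite"
  shows "(t *\<^sub>R A) ** B = t *\<^sub>R (A ** B)" "A ** (t *\<^sub>R B) = t *\<^sub>R (A ** B)"
  by (simp_all add: linear_scale[OF linear_matrix_left] linear_scale[OF linear_matrix_right])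

lemma almost_invariant_mult:
  fixes B :: "(real^'m^'m::finite) set"
  assumes g: "B - rtrans B g \<in> null_sets lebesgue" and h: "B - rtrans B h \<in> null_sets lebesgue"
    and B: "B \<in> sets lebesgue" and det: "det g = 1" "det h = 1"
  shows "B - rtrans B (g ** h) \<in> null_sets lebesgue"
proof -
  have nz: "det h \<noteq> 0" using det by simp
  have "rtrans (B - rtrans B g) h \<in> null_sets lebesgue"
    by (intro null_sets_bij_linear_image linear_matrix_right bij_matrix_right nz g)
  then have 1: "(B - rtrans B h) \<union> rtrans (B - rtrans B g) h \<in> null_sets lebesgue"
    using h by blast
  have "B - rtrans B (g ** h) \<subseteq> (B - rtrans B h) \<union> rtrans (B - rtrans B g) h"
    unfolding rtrans_Diff[OF nz] rtrans_rtrans by blast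
  moreover have "B - rtrans B (g ** h) \<in> sets lebesgue"
    using B det by (intro sets.Diff right_translate_lebesgue) (simp_all add: det_mul)
  ultimately show ?thesis using 1 null_sets_subset by blast
qed

lemma transvection_commutator:
  assumes "i \<noteq> j" "i \<noteq> k" "k \<noteq> j"
  shows "transvection i j c = (transvection i k c ** transvection k j 1) ** (transvection i k (- c) ** transvection k j (- 1))"
  using assms
  by (simp add: matrix_eq transvection_mult_vec vec_eq_iff algebra_simps flip: matrix_vector_mul_assoc)

text \<open>The relation \<open>P\<close> collects the pairs \<open>(i, j)\<close> whose transvections are contracted by a diagonal matrix that fixes \<open>B\<close>.
The remaining transvections are commutators of such ones.\<close>

lemma SL_almost_invariant:
  fixes B :: "(real^'m^'m::finite) set"
  assumes B: "B \<in> sets lebesgue" "SLZ_invariant B" "B \<subseteq> slab"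
    and P: "\<And>i j. P i j \<Longrightarrow> i \<noteq> j \<and> (\<exists>d. rtrans B (diag_mat d) = B \<and> (\<Prod>i\<in>UNIV. d i) = 1 \<and> 0 < d j \<and> d j < d i)"
    and gen: "\<And>i j. i \<noteq> j \<Longrightarrow> P i j \<or> (\<exists>k. P i k \<and> P k j)"
    and g: "det g = 1"
  shows "B - rtrans B g \<in> null_sets lebesgue"
  using g
proof (induction g rule: det_1_induct)
  case one
  then show ?case by simp
next
  case (transvection i j c A)
  have P_inv: "B - rtrans B (transvection i j c) \<in> null_sets lebesgue" if ij: "P i j" for i j c
  proof -
    obtain d where "rtrans B (diag_mat d) = B" "(\<Prod>i\<in>UNIV. d i) = 1" "0 < d j" "d j < d i"
      using P[OF ij] by blast
    then show ?thesis using mautner[OF B] P[OF ij] by blast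
  qed
  have "B - rtrans B (transvection i j c) \<in> null_sets lebesgue"
  proof (cases "P i j")
    case False
    then obtain k where k: "P i k" "P k j" using gen[OF transvection(1)] by blast
    then have ne: "i \<noteq> k" "k \<noteq> j" using P by blast+
    show ?thesis
      unfolding transvection_commutator[OF transvection(1) ne]
      by (intro almost_invariant_mult P_inv k B(1)) (simp_all add: det_mul det_transvection ne)
  qed (rule P_inv)
  then show ?case
    using transvection by (intro almost_invariant_mult B(1)) (simp_all add: det_transvection)
qed

text \<open>Every matrix of positive determinant can be scaled down into the slab by an integer, and \<open>B\<close> is a cone, so
the part of \<open>B\<close> to be removed is a countable union of multiples of a null set.\<close>

lemma GLpos_almost_invariant:
  fixes B :: "(real^'m^'m::finite) set"
  assumes B: "B \<in> sets lebesgue" "B \<subseteq> GLpos" and cone: "\<And>t x. 0 < t \<Longrightarrow> x \<in> B \<Longrightarrow> t *\<^sub>R x \<in> B"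
    and SL: "\<And>g. det g = 1 \<Longrightarrow> B \<inter> slab - rtrans (B \<inter> slab) g \<in> null_sets lebesgue"
    and g: "0 < det g"
  shows "B - rtrans B g \<in> null_sets lebesgue"
proof -
  obtain t h where th: "0 < t" "det h = 1" "g = t *\<^sub>R h" using GLpos_scaled_SL[OF g] by blast
  define N where "N = B \<inter> slab - rtrans (B \<inter> slab) h"
  have "(\<Union>n. (*\<^sub>R) (real (Suc n)) ` N) \<in> null_sets lebesgue"
  proof (intro null_sets_UN null_sets_bij_linear_image)
    fix n
    show "linear ((*\<^sub>R) (real (Suc n)) :: real^'m^'m \<Rightarrow> _)" by (rule linear_scaleR)
    show "bij ((*\<^sub>R) (real (Suc n)) :: real^'m^'m \<Rightarrow> _)"
      by (rule bij_scaleR_pos) simp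
    show "N \<in> null_sets lebesgue" unfolding N_def by (rule SL[OF th(2)])
  qed
  moreover have "B - rtrans B g \<subseteq> (\<Union>n. (*\<^sub>R) (real (Suc n)) ` N)"
  proof
    fix x assume x: "x \<in> B - rtrans B g"
    then have dx: "0 < det x" using B(2) by blast
    obtain n0 where "det x < real n0" using reals_Archimedean2 by blast
    define s where "s = real (Suc n0)"
    have s: "0 < s" "1 \<le> s" "det x < s" using \<open>det x < real n0\<close> by (auto simp: s_def)
    define y where "y = inverse s *\<^sub>R x"
    have xy: "x = s *\<^sub>R y" using s by (simp add: y_def)
    have "s \<le> s ^ CARD('m)" using s(2) by (simp add: self_le_power)
    then have "det x < s ^ CARD('m)" using s(3) by linarith
    then have "y \<in> slab" using dx s(1) by (simp add: y_def slab_def det_scaleR power_inverse field_simps)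
    moreover have "y \<in> B" unfolding y_def using x s by (intro cone) auto
    moreover have "y \<notin> rtrans (B \<inter> slab) h"
    proof
      assume "y \<in> rtrans (B \<inter> slab) h"
      then obtain z where z: "z \<in> B" "y = z ** h" by blast
      have "x = ((s / t) *\<^sub>R z) ** g"
        using th(1) by (simp add: xy z th(3) matrix_mult_scaleR)
      moreover have "(s / t) *\<^sub>R z \<in> B" using z s th by (intro cone) auto
      ultimately show False using x by blast
    qed
    ultimately have "y \<in> N" by (simp add: N_def)
    then show "x \<in> (\<Union>n. (*\<^sub>R) (real (Suc n)) ` N)" unfolding xy s_def by blast
  qed
  moreover have "B - rtrans B g \<in> sets lebesgue"
    using B(1) g by (intro sets.Diff bij_linear_image_lebesgue linear_matrix_right bij_matrix_right) auto
  ultimately show ?thesis using null_sets_subset by blast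
qed

text \<open>Consider the pairs \<open>(x, g)\<close> with \<open>x \<in> B\<close> and \<open>x g \<notin> B\<close>. For fixed \<open>g\<close> the set of these \<open>x\<close> is null, so by Fubini
almost every \<open>x \<in> B\<close> has \<open>x g \<in> B\<close> for almost all \<open>g\<close>. If \<open>B\<close> is not null, then one such \<open>x\<close> exists, and \<open>x g\<close> ranges over
all matrices of positive determinant. Borel sets \<open>B1\<close> and \<open>C1\<close> stand in for \<open>B\<close> and its complement to
make the set of pairs measurable.\<close>

lemma null_or_conull_of_almost_invariant:
  fixes B :: "(real^'m^'m::finite) set"
  assumes B: "B \<in> sets lebesgue" "B \<subseteq> GLpos"
    and inv: "\<And>g. 0 < det g \<Longrightarrow> B - rtrans B g \<in> null_sets lebesgue"
  shows "B \<in> null_sets lebesgue \<or> GLpos - B \<in> null_sets lebesgue"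
proof -
  obtain B1 where B1: "B1 \<in> sets borel" "B1 \<subseteq> B" "B - B1 \<in> null_sets lebesgue"
    using borel_conull_subset[OF B(1)] by blast
  have "GLpos - B \<in> sets lebesgue"
    by (rule sets.Diff[OF open_sets_lebesgue[OF open_GLpos] B(1)])
  then obtain C1 where C1: "C1 \<in> sets borel" "C1 \<subseteq> GLpos - B" "GLpos - B - C1 \<in> null_sets lebesgue"
    using borel_conull_subset by blast
  define S where "S = {z :: (real^'m^'m) \<times> (real^'m^'m). fst z \<in> B1 \<and> fst z ** snd z \<in> C1}"
  have "(\<lambda>z :: (real^'m^'m) \<times> (real^'m^'m). fst z ** snd z) \<in> borel_measurable borel"
    by (intro borel_measurable_continuous_onI bounded_bilinear.continuous_on[OF bounded_bilinear_matrix_mult]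
        continuous_intros)
  moreover have "fst \<in> borel_measurable (borel :: ((real^'m^'m) \<times> (real^'m^'m)) measure)"
    by (intro borel_measurable_continuous_onI continuous_intros)
  ultimately have "S \<in> sets borel"
    unfolding S_def using B1(1) C1(1) by measurable
  then have S: "S \<in> sets (lborel \<Otimes>\<^sub>M lborel)"
    by (metis lborel_prod sets_lborel)
  have "emeasure lborel ((\<lambda>x. (x, g)) -` S) = 0" for g
  proof (cases "0 < det g")
    case True
    obtain g' where g': "g ** g' = mat 1" "g' ** g = mat 1" "det g' = inverse (det g)"
      using matrix_inverse[of g] True by auto
    have "(\<lambda>x. (x, g)) -` S \<subseteq> B - rtrans B g'"
    proof
      fix x assume "x \<in> (\<lambda>x. (x, g)) -` S"
      then have "x \<in> B" "x ** g \<notin> B" using B1(2) C1(2) by (auto simp: S_def)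
      then show "x \<in> B - rtrans B g'" unfolding Diff_iff rtrans_iff[OF g'(1)] by blast
    qed
    moreover have "B - rtrans B g' \<in> null_sets lebesgue"
      using inv[of g'] g'(3) True by simp
    moreover have "(\<lambda>x. (x, g)) -` S \<in> sets lborel"
      using sets_Pair2[OF S] by simp
    ultimately have "(\<lambda>x. (x, g)) -` S \<in> null_sets lebesgue"
      by (metis null_sets_subset sets_completionI_sets)
    then show ?thesis
      using \<open>(\<lambda>x. (x, g)) -` S \<in> sets lborel\<close> by (simp add: null_sets_def)
  next
    case False
    \<comment> \<open>Both \<open>x\<close> and \<open>x g\<close> would have positive determinant.\<close>
    have "x ** g \<notin> C1" if "x \<in> B1" for x
      using that B1(2) B(2) C1(2) False by (fastforce simp: det_mul zero_less_mult_iff)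
    then have "(\<lambda>x. (x, g)) -` S = {}" by (auto simp: S_def)
    then show ?thesis by simp
  qed
  then have "emeasure (lborel \<Otimes>\<^sub>M lborel) S = 0"
    by (simp add: lborel_pair.emeasure_pair_measure_alt2[OF S])
  then have "AE x in lborel. emeasure lborel (Pair x -` S) = 0"
    using nn_integral_0_iff_AE[OF lborel.measurable_emeasure_Pair[OF S]]
    by (simp add: lborel.emeasure_pair_measure_alt[OF S])
  then have AE: "AE x in lebesgue. emeasure lborel (Pair x -` S) = 0"
    by (rule AE_completion)
  show ?thesis
  proof (cases "B1 \<in> null_sets lebesgue")
    case True
    then have "B1 \<union> (B - B1) \<in> null_sets lebesgue" using B1(3) by blast
    moreover have "B1 \<union> (B - B1) = B" using B1(2) by blast
    ultimately show ?thesis by simp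
  next
    case False
    obtain N where N: "{x. emeasure lborel (Pair x -` S) \<noteq> 0} \<subseteq> N" "N \<in> null_sets lebesgue"
      using AE unfolding eventually_ae_filter by auto
    have "\<not> B1 \<subseteq> N"
      using False N(2) B1(1) null_sets_subset[of N lebesgue B1] by auto
    then obtain x where x: "x \<in> B1" "emeasure lborel (Pair x -` S) = 0" using N(1) by blast
    have nz: "det x \<noteq> 0" using x(1) B1(2) B(2) by force
    have "Pair x -` S \<in> sets lborel" using sets_Pair1[OF S] by simp
    then have "Pair x -` S \<in> null_sets lebesgue"
      using x(2) by (simp add: null_sets_def)
    then have "(**) x ` (Pair x -` S) \<in> null_sets lebesgue"
      by (intro null_sets_bij_linear_image linear_matrix_left bij_matrix_left nz)
    moreover have "C1 \<subseteq> (**) x ` (Pair x -` S)"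
    proof
      fix y assume y: "y \<in> C1"
      obtain x' where "x ** x' = mat 1" using matrix_inverse[OF nz] by blast
      then have "y = x ** (x' ** y)" by (simp add: matrix_mul_assoc)
      then show "y \<in> (**) x ` (Pair x -` S)" using x(1) y by (auto simp: S_def)
    qed
    ultimately have "C1 \<in> null_sets lebesgue"
      using C1(1) null_sets_subset by (metis sets_completionI_sets sets_lborel)
    then have "C1 \<union> (GLpos - B - C1) \<in> null_sets lebesgue" using C1(3) by blast
    moreover have "C1 \<union> (GLpos - B - C1) = GLpos - B" using C1(2) by blast
    ultimately show ?thesis by simp
  qed
qed

lemma null_or_conull:
  fixes B :: "(real^'m^'m::finite) set"
  assumes B: "B \<in> sets lebesgue" "B \<subseteq> GLpos" "SLZ_invariant B" and cone: "\<And>t x. 0 < t \<Longrightarrow> x \<in> B \<Longrightarrow> t *\<^sub>R x \<in> B"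
    and P: "\<And>i j. P i j \<Longrightarrow> i \<noteq> j \<and> (\<exists>d. rtrans B (diag_mat d) = B \<and> (\<Prod>i\<in>UNIV. d i) = 1 \<and> 0 < d j \<and> d j < d i)"
    and gen: "\<And>i j. i \<noteq> j \<Longrightarrow> P i j \<or> (\<exists>k. P i k \<and> P k j)"
  shows "B \<in> null_sets lebesgue \<or> GLpos - B \<in> null_sets lebesgue"
proof (rule null_or_conull_of_almost_invariant[OF B(1,2)])
  have slab: "rtrans (B \<inter> slab) (diag_mat d) = B \<inter> slab"
    if d: "rtrans B (diag_mat d) = B" "(\<Prod>i\<in>UNIV. d i) = 1" for d
  proof -
    have det: "det (diag_mat d :: real^'m^'m) = 1" using d(2) by (simp add: det_diag_mat)
    have "rtrans (B \<inter> slab) (diag_mat d) = rtrans B (diag_mat d) \<inter> slab"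
      using det by (auto simp: slab_def det_mul)
    then show ?thesis using d(1) by simp
  qed
  have B': "B \<inter> slab \<in> sets lebesgue" "SLZ_invariant (B \<inter> slab)" "B \<inter> slab \<subseteq> slab"
    using B by (auto simp: SLZ_invariant_def SLZ_slab open_sets_lebesgue[OF open_slab])
  have P': "i \<noteq> j \<and> (\<exists>d. rtrans (B \<inter> slab) (diag_mat d) = B \<inter> slab \<and> (\<Prod>i\<in>UNIV. d i) = 1 \<and> 0 < d j \<and> d j < d i)"
    if ij: "P i j" for i j
  proof -
    obtain d where "rtrans B (diag_mat d) = B" "(\<Prod>i\<in>UNIV. d i) = 1" "0 < d j" "d j < d i" "i \<noteq> j"
      using P[OF ij] by blast
    then show ?thesis using slab[of d] by blast
  qed
  have SL: "B \<inter> slab - rtrans (B \<inter> slab) h \<in> null_sets lebesgue" if "det h = 1" for h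
    using B' P' gen that by (rule SL_almost_invariant)
  show "B - rtrans B g \<in> null_sets lebesgue" if "0 < det g" for g
    using B(1,2) cone SL that by (rule GLpos_almost_invariant)
qed

section \<open>The Teichmueller space of tori\<close>

type_synonym 'n realmat = "real^('n + 'n)^('n + 'n)"

lemma realify_mult: "realify (A ** B) = realify A ** realify (B :: complex^'n::finite^'n)"
proof -
  have sum: "(\<Sum>k\<in>(UNIV :: ('n + 'n) set). f k) = (\<Sum>a\<in>UNIV. f (Inl a)) + (\<Sum>a\<in>UNIV. f (Inr a))"
    for f :: "'n + 'n \<Rightarrow> real"
    using sum.Plus[of "UNIV :: 'n set" "UNIV :: 'n set" f] by simp
  have "realify (A ** B) $ i $ j = (realify A ** realify B) $ i $ j" for i j
    by (cases i; cases j)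
      (simp_all add: realify_def matrix_matrix_mult_def sum sum.distrib sum_subtractf sum_negf add.commute)
  then show ?thesis by (simp add: vec_eq_iff)
qed

lemma realify_1: "realify (mat 1) = mat 1"
  by (auto simp: vec_eq_iff realify_def mat_def split: sum.split)

lemma SL_complex_1: "mat 1 \<in> SL_complex"
  unfolding SL_complex_def by (rule image_eqI[of _ _ "mat 1"]) (simp_all add: realify_1)

lemma SL_complex_mult: "g \<in> SL_complex \<Longrightarrow> h \<in> SL_complex \<Longrightarrow> g ** h \<in> SL_complex"
  unfolding SL_complex_def by (auto simp: realify_mult[symmetric] det_mul)

lemma SL_complex_inverse:
  assumes "h \<in> SL_complex"
  obtains h' where "h' \<in> SL_complex" "h ** h' = mat 1" "h' ** h = mat 1"
proof -
  obtain A where A: "h = realify A" "det A = 1" using assms by (auto simp: SL_complex_def)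
  then have "invertible A" by (simp add: invertible_det_nz)
  then obtain A' where A': "A ** A' = mat 1" "A' ** A = mat 1" unfolding invertible_def by blast
  have "det A * det A' = 1" using A'(1) by (metis det_I det_mul)
  then have "realify A' \<in> SL_complex" using A by (simp add: SL_complex_def)
  then show thesis
    using that[of "realify A'"] A(1) A' by (metis realify_1 realify_mult)
qed

lemma SL_real_iff: "g \<in> carrier SL_real \<longleftrightarrow> det g = 1"
  by (simp add: SL_real_def)

lemma teich_proj_eq: "teich_proj g = (**) g ` SL_complex"
  by (auto simp: teich_proj_def l_coset_def SL_real_def)

lemma teich_proj_mult_SL_complex:
  assumes "h \<in> SL_complex"
  shows "teich_proj (g ** h) = teich_proj g"
proof -
  obtain h' where h': "h' \<in> SL_complex" "h ** h' = mat 1" using SL_complex_inverse[OF assms] by blast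
  show ?thesis
  proof (intro equalityI subsetI)
    fix x assume "x \<in> teich_proj (g ** h)"
    then show "x \<in> teich_proj g"
      using assms by (auto simp: teich_proj_eq intro!: image_eqI SL_complex_mult simp flip: matrix_mul_assoc)
  next
    fix x assume "x \<in> teich_proj g"
    then obtain k where k: "k \<in> SL_complex" "x = g ** k" by (auto simp: teich_proj_eq)
    have "x = (g ** h) ** (h' ** k)"
      using k(2) h'(2) by (metis matrix_mul_assoc matrix_mul_lid)
    then show "x \<in> teich_proj (g ** h)"
      using k h' by (auto simp: teich_proj_eq intro: SL_complex_mult)
  qed
qed

lemma l_coset_teich_proj: "W <#\<^bsub>SL_real\<^esub> teich_proj g = teich_proj (W ** g)"
  by (auto simp: teich_proj_eq l_coset_def SL_real_def matrix_mul_assoc image_iff)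

lemma teich_act_proj:
  assumes "det g = 1"
  shows "teich_act W (teich_proj g) = teich_proj (W ** g)"
  using assms by (auto simp: teich_act_def l_coset_teich_proj teich_eq SL_real_iff)

lemma SLZ_SL_real: "W \<in> SLZ \<Longrightarrow> det W = 1"
  by (simp add: SLZ_iff)

lemma teich_cases:
  assumes "I \<in> teich"
  obtains g where "det g = 1" "I = teich_proj g"
  using assms by (auto simp: teich_eq SL_real_iff)

lemma teich_proj_in_teich: "det g = 1 \<Longrightarrow> teich_proj g \<in> teich"
  by (auto simp: teich_eq SL_real_iff)

lemma SL_int_mult: "x \<otimes>\<^bsub>SL_int\<^esub> y = x ** y" and SL_int_one: "\<one>\<^bsub>SL_int\<^esub> = mat 1"
  by (simp_all add: SL_int_def SL_real_def)

lemma group_SL_int: "group (SL_int :: (real^'m^'m::finite) monoid)"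
proof (rule groupI)
  fix x :: "real^'m^'m" assume "x \<in> SLZ"
  then show "\<exists>y\<in>SLZ. y \<otimes>\<^bsub>SL_int\<^esub> x = \<one>\<^bsub>SL_int\<^esub>"
    by (metis SLZ_inverse SL_int_mult SL_int_one)
qed (auto simp: SL_int_mult SL_int_one SLZ_mult mat_1_SLZ matrix_mul_assoc)

lemma teich_act_mult:
  assumes "W \<in> SLZ" "V \<in> SLZ" "I \<in> teich"
  shows "teich_act W (teich_act V I) = teich_act (W ** V) I"
proof -
  obtain g where g: "det g = 1" "I = teich_proj g" using teich_cases[OF assms(3)] by blast
  have "det (V ** g) = 1" using g assms(2) by (simp add: det_mul SLZ_iff)
  then show ?thesis by (simp add: g teich_act_proj matrix_mul_assoc)
qed

lemma teich_act_1: "I \<in> teich \<Longrightarrow> teich_act (mat 1) I = I"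
  by (erule teich_cases) (simp add: teich_act_proj)

lemma teich_act_in_teich:
  assumes "W \<in> SLZ" "I \<in> teich"
  shows "teich_act W I \<in> teich"
proof -
  obtain g where g: "det g = 1" "I = teich_proj g" using teich_cases[OF assms(2)] by blast
  then show ?thesis using assms(1) by (simp add: teich_act_proj teich_proj_in_teich det_mul SLZ_iff)
qed

lemma teich_act_Bij:
  assumes "W \<in> SLZ"
  shows "teich_act W \<in> Bij teich"
proof -
  obtain V where V: "V \<in> SLZ" "W ** V = mat 1" "V ** W = mat 1" using SLZ_inverse[OF assms] by metis
  have "bij_betw (teich_act W) teich teich"
    by (rule bij_betw_byWitness[of _ "teich_act V"])
      (auto simp: teich_act_mult assms V teich_act_1 teich_act_in_teich)
  then show ?thesis
    by (auto simp: Bij_def teich_act_def)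
qed

lemma group_action_teich: "group_action SL_int (teich :: ('n::finite realmat) set set) teich_act"
proof -
  have "teich_act \<in> hom SL_int (BijGroup (teich :: ('n realmat) set set))"
  proof (rule homI)
    fix W :: "'n realmat" assume W: "W \<in> SLZ"
    then show "teich_act W \<in> carrier (BijGroup teich)"
      by (simp add: BijGroup_def teich_act_Bij)
    fix V :: "'n realmat" assume V: "V \<in> SLZ"
    have "teich_act (W ** V) = compose teich (teich_act W) (teich_act V)"
    proof (rule extensionalityI[of _ teich])
      show "teich_act (W ** V) \<in> extensional teich" by (simp add: teich_act_def)
    qed (auto simp: compose_def teich_act_mult W V)
    then show "teich_act (W \<otimes>\<^bsub>SL_int\<^esub> V) = teich_act W \<otimes>\<^bsub>BijGroup teich\<^esub> teich_act V"
      by (simp add: BijGroup_def SL_int_mult teich_act_Bij W V)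
  qed
  then show ?thesis
    by (simp add: group_action_def group_hom_def group_hom_axioms_def group_SL_int group_BijGroup)
qed

lemma scaleR_in_teich_cone_iff:
  assumes "0 < t" "det g = 1"
  shows "t *\<^sub>R g \<in> teich_cone A \<longleftrightarrow> teich_proj g \<in> A"
  using assms unfolding teich_cone_def
  by (auto simp flip: SL_real_iff dest: scaleR_SL_real_unique)

lemma teich_cone_cases:
  assumes "x \<in> teich_cone A"
  obtains t g where "0 < t" "det g = 1" "x = t *\<^sub>R g" "teich_proj g \<in> A"
  using assms by (auto simp: teich_cone_def SL_real_iff)

lemma teich_cone_GLpos: "teich_cone A \<subseteq> GLpos"
  by (auto elim!: teich_cone_cases simp: det_scaleR)

lemma teich_cone_act:
  assumes W: "W \<in> SLZ" and A: "A \<subseteq> teich"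
  shows "teich_cone (teich_act W ` A) = (**) W ` teich_cone A"
proof (intro equalityI subsetI)
  fix x assume "x \<in> (**) W ` teich_cone A"
  then obtain t g where x: "0 < t" "det g = 1" "x = W ** (t *\<^sub>R g)" "teich_proj g \<in> A"
    by (auto elim: teich_cone_cases)
  then have "x = t *\<^sub>R (W ** g)" "det (W ** g) = 1" using W by (simp_all add: matrix_mult_scaleR det_mul SLZ_iff)
  moreover have "teich_proj (W ** g) \<in> teich_act W ` A"
    using x by (intro image_eqI[of _ _ "teich_proj g"]) (simp_all add: teich_act_proj)
  ultimately show "x \<in> teich_cone (teich_act W ` A)"
    using x(1) by (simp add: scaleR_in_teich_cone_iff)
next
  fix x assume "x \<in> teich_cone (teich_act W ` A)"
  then obtain t g where x: "0 < t" "det g = 1" "x = t *\<^sub>R g" "teich_proj g \<in> teich_act W ` A"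
    by (rule teich_cone_cases)
  then obtain I where I: "I \<in> A" "teich_proj g = teich_act W I" by blast
  obtain V where V: "V \<in> SLZ" "W ** V = mat 1" "V ** W = mat 1" using SLZ_inverse[OF W] by metis
  have IA: "I \<in> teich" using I A by blast
  have "teich_proj (V ** g) = teich_act V (teich_act W I)"
    using x(2) I(2) by (simp flip: teich_act_proj)
  also have "\<dots> = I" using V IA W by (simp add: teich_act_mult teich_act_1)
  finally have "t *\<^sub>R (V ** g) \<in> teich_cone A"
    using x V I(1) by (simp add: scaleR_in_teich_cone_iff det_mul SLZ_iff)
  moreover have "x = W ** (t *\<^sub>R (V ** g))"
    using V(2) by (simp add: x matrix_mult_scaleR matrix_mul_assoc)
  ultimately show "x \<in> (**) W ` teich_cone A" by blast
qed

lemma teich_cone_scaleR: "x \<in> teich_cone A \<Longrightarrow> 0 < t \<Longrightarrow> t *\<^sub>R x \<in> teich_cone A"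
  by (erule teich_cone_cases) (simp add: scaleR_in_teich_cone_iff)

text \<open>The unit ball in the definition of the measure does not affect null sets, since a cone is the union of the
integer multiples of its intersection with the ball.\<close>

lemma null_sets_teich_measure_iff:
  "A \<in> null_sets (teich_measure :: ('n::finite realmat) set measure) \<longleftrightarrow> A \<subseteq> teich \<and> teich_cone A \<in> null_sets lebesgue"
proof
  assume A: "A \<subseteq> teich \<and> teich_cone A \<in> null_sets lebesgue"
  then have sets: "A \<in> sets teich_measure" by (auto simp: sets_teich_measure)
  have "teich_cone A \<inter> ball 0 1 \<in> null_sets lebesgue"
    using A by (intro null_set_Int2 open_sets_lebesgue) auto
  then show "A \<in> null_sets teich_measure"
    using sets by (simp add: null_sets_def emeasure_teich_measure)
next
  assume A: "A \<in> null_sets (teich_measure :: ('n realmat) set measure)"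
  then have sets: "A \<in> sets teich_measure" by blast
  then have A': "A \<subseteq> teich" "teich_cone A \<in> sets lebesgue" by (auto simp: sets_teich_measure)
  have "teich_cone A \<inter> ball 0 1 \<in> null_sets lebesgue"
    using A A' emeasure_teich_measure[OF sets] open_sets_lebesgue[OF open_ball]
    by (auto simp: null_sets_def intro!: sets.Int)
  then have "(\<Union>n. (*\<^sub>R) (real (Suc n)) ` (teich_cone A \<inter> ball 0 1)) \<in> null_sets lebesgue"
    by (intro null_sets_UN null_sets_bij_linear_image linear_scaleR bij_scaleR_pos) simp_all
  moreover have "teich_cone A \<subseteq> (\<Union>n. (*\<^sub>R) (real (Suc n)) ` (teich_cone A \<inter> ball 0 1))"
  proof
    fix x assume x: "x \<in> teich_cone A"
    obtain n where n: "norm x < real n" using reals_Archimedean2 by blast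
    define y where "y = inverse (real (Suc n)) *\<^sub>R x"
    have "y \<in> teich_cone A" unfolding y_def by (rule teich_cone_scaleR[OF x]) simp
    moreover have "norm y < 1" using n by (simp add: y_def divide_simps)
    ultimately have "y \<in> teich_cone A \<inter> ball 0 1" by simp
    moreover have "x = real (Suc n) *\<^sub>R y" by (simp add: y_def del: of_nat_Suc)
    ultimately show "x \<in> (\<Union>n. (*\<^sub>R) (real (Suc n)) ` (teich_cone A \<inter> ball 0 1))" by blast
  qed
  ultimately show "A \<subseteq> teich \<and> teich_cone A \<in> null_sets lebesgue"
    using A' null_sets_subset by blast
qed

text \<open>The complex coordinate to which a real one belongs.\<close>

definition base :: "'n + 'n \<Rightarrow> 'n" where
  "base = case_sum id id"

lemma diag_mat_base_SL_complex:
  fixes e :: "'n::finite \<Rightarrow> real"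
  assumes "(\<Prod>p\<in>UNIV. e p) = 1"
  shows "diag_mat (e \<circ> base) \<in> SL_complex"
proof -
  define A :: "complex^'n^'n" where "A = (\<chi> a b. if a = b then of_real (e a) else 0)"
  have "det A = (\<Prod>p\<in>UNIV. of_real (e p))"
    unfolding A_def by (subst det_diagonal) auto
  also have "\<dots> = of_real (\<Prod>p\<in>UNIV. e p)" by simp
  finally have "det A = 1" using assms by simp
  moreover have "diag_mat (e \<circ> base) = realify A"
    by (auto simp: vec_eq_iff diag_mat_def realify_def A_def base_def split: sum.split)
  ultimately show ?thesis by (auto simp: SL_complex_def)
qed

lemma prod_base: "(\<Prod>i\<in>(UNIV :: ('n::finite + 'n) set). (e \<circ> base) i) = (\<Prod>p\<in>UNIV. e p :: real)\<^sup>2"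
  using prod.Plus[of "UNIV :: 'n set" "UNIV :: 'n set" "e \<circ> base"] by (simp add: base_def power2_eq_square)

text \<open>For real coordinates \<open>i\<close> and \<open>j\<close> that belong to different complex coordinates, the complex diagonal matrix with
entries 2 and 1/2 at these and 1 elsewhere has determinant 1 and contracts the transvection at \<open>(i, j)\<close>. If
\<open>i\<close> and \<open>j\<close> belong to the same complex coordinate, a second one provides the intermediate index.\<close>

lemma cone_null_or_conull:
  fixes B :: "('n::finite realmat) set"
  assumes n: "CARD('n) \<ge> 2"
    and B: "B \<in> sets lebesgue" "B \<subseteq> GLpos" "SLZ_invariant B" "\<And>t x. 0 < t \<Longrightarrow> x \<in> B \<Longrightarrow> t *\<^sub>R x \<in> B"
    and H: "\<And>x h. x \<in> B \<Longrightarrow> h \<in> SL_complex \<Longrightarrow> det h = 1 \<Longrightarrow> x ** h \<in> B"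
  shows "B \<in> null_sets lebesgue \<or> GLpos - B \<in> null_sets lebesgue"
proof (rule null_or_conull[OF B, where P="\<lambda>i j. base i \<noteq> base j"])
  fix i j :: "'n + 'n" assume ij: "base i \<noteq> base j"
  have *: "diag_mat (e \<circ> base) \<in> SL_complex \<and> det (diag_mat (e \<circ> base)) = 1"
    if "(\<Prod>p\<in>UNIV. e p) = 1" for e :: "'n \<Rightarrow> real"
    using that diag_mat_base_SL_complex[OF that] prod_base[of e] by (simp add: det_diag_mat)
  define e :: "'n \<Rightarrow> real" where "e p = (if p = base i then 2 else if p = base j then 1 / 2 else 1)" for p
  have e1: "(\<Prod>p\<in>UNIV. e p) = 1"
  proof -
    have "(\<Prod>p\<in>UNIV. e p) = e (base i) * (e (base j) * (\<Prod>p\<in>UNIV - {base i} - {base j}. e p))"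
      using ij by (simp add: prod.remove[of UNIV "base i"] prod.remove[of "UNIV - {base i}" "base j"])
    also have "(\<Prod>p\<in>UNIV - {base i} - {base j}. e p) = 1"
      by (rule prod.neutral) (auto simp: e_def)
    finally show ?thesis using ij by (simp add: e_def)
  qed
  have e2: "(\<Prod>p\<in>UNIV. inverse (e p)) = 1" using prod_inversef[of e UNIV] e1 by (simp add: o_def)
  have ne: "e p \<noteq> 0" for p by (simp add: e_def)
  have mult: "diag_mat ((\<lambda>p. inverse (e p)) \<circ> base) ** diag_mat (e \<circ> base) = (mat 1 :: 'n realmat)"
    by (simp add: diag_mat_mult ne diag_mat_1)
  have "rtrans B (diag_mat (e \<circ> base)) = B"
  proof (intro equalityI subsetI)
    fix x assume x: "x \<in> B"
    have "x = (x ** diag_mat ((\<lambda>p. inverse (e p)) \<circ> base)) ** diag_mat (e \<circ> base)"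
      using mult by (simp flip: matrix_mul_assoc)
    then show "x \<in> rtrans B (diag_mat (e \<circ> base))"
      using H[OF x] *[OF e2] by blast
  qed (use H *[OF e1] in blast)
  moreover have "(\<Prod>i\<in>UNIV. (e \<circ> base) i) = 1" by (simp only: prod_base e1) simp
  moreover have "0 < (e \<circ> base) j" "(e \<circ> base) j < (e \<circ> base) i" using ij by (auto simp: e_def)
  moreover have "i \<noteq> j" using ij by blast
  ultimately show "i \<noteq> j \<and> (\<exists>d. rtrans B (diag_mat d) = B \<and> (\<Prod>i\<in>UNIV. d i) = 1 \<and> 0 < d j \<and> d j < d i)"
    by blast
next
  fix i j :: "'n + 'n"
  have "\<exists>q. q \<noteq> base i"
    using n card_le_Suc0_iff_eq[of "UNIV :: 'n set"] by (metis UNIV_I finite not_less_eq_eq numeral_2_eq_2)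
  then obtain q where "q \<noteq> base i" by blast
  then show "base i \<noteq> base j \<or> (\<exists>k. base i \<noteq> base k \<and> base k \<noteq> base j)"
    by (metis base_def old.sum.simps(5) id_apply)
qed


lemma teich_cone_null_or_conull:
  fixes A :: "('n::finite realmat) set set"
  assumes n: "CARD('n) \<ge> 2" and A: "A \<in> sets teich_measure" "\<And>W. W \<in> SLZ \<Longrightarrow> teich_act W ` A = A"
  shows "teich_cone A \<in> null_sets lebesgue \<or> GLpos - teich_cone A \<in> null_sets lebesgue"
proof (rule cone_null_or_conull[OF n])
  have A': "A \<subseteq> teich" "teich_cone A \<in> sets lebesgue" using A(1) by (auto simp: sets_teich_measure)
  show "teich_cone A \<in> sets lebesgue" by (rule A')
  show "teich_cone A \<subseteq> GLpos" by (rule teich_cone_GLpos)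
  show "SLZ_invariant (teich_cone A)"
    unfolding SLZ_invariant_def
  proof (intro ballI)
    fix W x :: "'n realmat" assume "W \<in> SLZ" "x \<in> teich_cone A"
    then show "W ** x \<in> teich_cone A"
      using teich_cone_act[OF _ A'(1), of W] A(2)[of W] by auto
  qed
  show "t *\<^sub>R x \<in> teich_cone A" if "0 < t" "x \<in> teich_cone A" for t x
    using that by (rule teich_cone_scaleR[rotated])
  fix x h :: "'n realmat" assume x: "x \<in> teich_cone A" and h: "h \<in> SL_complex" "det h = 1"
  obtain t g where g: "0 < t" "det g = 1" "x = t *\<^sub>R g" "teich_proj g \<in> A"
    using teich_cone_cases[OF x] by blast
  have "x ** h = t *\<^sub>R (g ** h)" by (simp add: g(3) matrix_mult_scaleR)
  then show "x ** h \<in> teich_cone A"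
    using g h by (simp add: scaleR_in_teich_cone_iff det_mul teich_proj_mult_SL_complex)
qed

lemma ergodic_action_teich:
  assumes n: "CARD('n::finite) \<ge> 2"
  shows "ergodic_action SL_int (teich_measure :: ('n realmat) set measure) teich_act"
  unfolding ergodic_action_def space_teich_measure
proof (intro conjI ballI impI)
  show "group_action SL_int (teich :: ('n realmat) set set) teich_act" by (rule group_action_teich)
next
  fix W :: "'n realmat" and A assume W: "W \<in> SLZ" and A: "A \<in> sets (teich_measure :: ('n realmat) set measure)"
  have A': "A \<subseteq> teich" "teich_cone A \<in> sets lebesgue" using A by (auto simp: sets_teich_measure)
  show "teich_act W ` A \<in> sets teich_measure"
    using A' W teich_act_in_teich[OF W] left_translate_lebesgue[OF SLZ_SL_real[OF W] A'(2)]
    by (auto simp: sets_teich_measure teich_cone_act)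
next
  fix W :: "'n realmat" and A assume W: "W \<in> SLZ" and A: "A \<in> null_sets (teich_measure :: ('n realmat) set measure)"
  have A': "A \<subseteq> teich" "teich_cone A \<in> null_sets lebesgue" using A by (auto simp: null_sets_teich_measure_iff)
  have "(**) W ` teich_cone A \<in> null_sets lebesgue"
    using W A' by (intro null_sets_bij_linear_image linear_matrix_left bij_matrix_left) (simp add: SLZ_iff)
  then show "teich_act W ` A \<in> null_sets teich_measure"
    using A' W teich_act_in_teich[OF W] by (auto simp: null_sets_teich_measure_iff teich_cone_act)
next
  fix A :: "('n realmat) set set"
  assume A: "A \<in> sets teich_measure" and inv: "\<forall>W\<in>SLZ. teich_act W ` A = A"
  have "A \<subseteq> teich" using A by (auto simp: sets_teich_measure)
  moreover have "teich_cone A \<in> null_sets lebesgue \<or> GLpos - teich_cone A \<in> null_sets lebesgue"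
    using teich_cone_null_or_conull[OF n A] inv by blast
  ultimately show "A \<in> null_sets teich_measure \<or> teich - A \<in> null_sets teich_measure"
    by (auto simp: null_sets_teich_measure_iff teich_cone_Diff teich_cone_teich)
qed

text \<open>The matrices whose torus has an orbit that meets the image of \<open>V\<close>. The condition \<open>det h = 1\<close> is on the real
determinant; with it \<open>h\<close> acts on matrices of determinant 1, which keeps the scalar \<open>t\<close> under control.\<close>

definition teich_saturation :: "('n::finite realmat) set \<Rightarrow> ('n realmat) set" where
  "teich_saturation V = {x \<in> GLpos. \<exists>W\<in>SLZ. \<exists>t>0. \<exists>h\<in>SL_complex. det h = 1 \<and> t *\<^sub>R ((W ** x) ** h) \<in> V}"

lemma open_teich_saturation:
  fixes V :: "('n::finite realmat) set"
  assumes "open V"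
  shows "open (teich_saturation V)"
proof -
  have "open {x :: 'n realmat. t *\<^sub>R ((W ** x) ** h) \<in> V}" for t W h
  proof -
    have "linear (\<lambda>x :: 'n realmat. t *\<^sub>R ((W ** x) ** h))"
      using linear_compose[OF linear_compose[OF linear_matrix_left[of W] linear_matrix_right[of h]] linear_scaleR[of t]]
      by (simp add: o_def)
    then have "continuous_on UNIV (\<lambda>x :: 'n realmat. t *\<^sub>R ((W ** x) ** h))"
      by (simp add: linear_continuous_on linear_linear)
    then show ?thesis
      using open_vimage[OF assms] by (simp add: vimage_def)
  qed
  moreover have "teich_saturation V = GLpos \<inter> (\<Union>W\<in>SLZ. \<Union>t\<in>{0<..}. \<Union>h\<in>{h\<in>SL_complex. det h = 1}.
      {x. t *\<^sub>R ((W ** x) ** h) \<in> V})"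
    by (auto simp: teich_saturation_def)
  ultimately show ?thesis
    by (simp only:) (intro open_Int open_GLpos open_UN ballI)
qed

lemma teich_saturation_conull:
  fixes V :: "('n::finite realmat) set"
  assumes n: "CARD('n) \<ge> 2" and V: "open V" "V \<inter> GLpos \<noteq> {}"
  shows "GLpos - teich_saturation V \<in> null_sets lebesgue"
proof -
  let ?C = "teich_saturation V"
  have sub: "V \<inter> GLpos \<subseteq> ?C"
  proof
    fix x assume "x \<in> V \<inter> GLpos"
    then show "x \<in> ?C"
      unfolding teich_saturation_def
      by (intro CollectI conjI bexI[OF _ mat_1_SLZ] exI[of _ 1] bexI[OF _ SL_complex_1]) auto
  qed
  have "?C \<in> null_sets lebesgue \<or> GLpos - ?C \<in> null_sets lebesgue"
  proof (rule cone_null_or_conull[OF n])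
    show "?C \<in> sets lebesgue" by (rule open_sets_lebesgue[OF open_teich_saturation[OF V(1)]])
    show "?C \<subseteq> GLpos" by (auto simp: teich_saturation_def)
    show "SLZ_invariant ?C"
      unfolding SLZ_invariant_def
    proof (intro ballI)
      fix U x :: "'n realmat" assume U: "U \<in> SLZ" and "x \<in> ?C"
      then obtain W t h where x: "0 < det x" "W \<in> SLZ" "0 < t" "h \<in> SL_complex" "det h = 1" "t *\<^sub>R ((W ** x) ** h) \<in> V"
        by (auto simp: teich_saturation_def)
      obtain U' where U': "U' \<in> SLZ" "U' ** U = mat 1" using SLZ_inverse[OF U] by blast
      have "(W ** U') ** (U ** x) = W ** x"
        using U'(2) by (metis matrix_mul_assoc matrix_mul_lid)
      moreover have "0 < det (U ** x)" using U x(1) by (simp add: det_mul SLZ_iff)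
      ultimately show "U ** x \<in> ?C"
        unfolding teich_saturation_def using x SLZ_mult[OF x(2) U'(1)]
        by (intro CollectI conjI bexI[of _ "W ** U'"] exI[of _ t] bexI[of _ h]) simp_all
    qed
    show "s *\<^sub>R x \<in> ?C" if s: "0 < s" and "x \<in> ?C" for s x
    proof -
      obtain W t h where x: "0 < det x" "W \<in> SLZ" "0 < t" "h \<in> SL_complex" "det h = 1" "t *\<^sub>R ((W ** x) ** h) \<in> V"
        using \<open>x \<in> ?C\<close> by (auto simp: teich_saturation_def)
      have "(t / s) *\<^sub>R ((W ** (s *\<^sub>R x)) ** h) \<in> V"
        using x(6) s by (simp add: matrix_mult_scaleR)
      then show ?thesis
        unfolding teich_saturation_def using x s
        by (intro CollectI conjI bexI[of _ W] exI[of _ "t / s"] bexI[of _ h]) (simp_all add: det_scaleR)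
    qed
    fix x k :: "'n realmat" assume "x \<in> ?C" and k: "k \<in> SL_complex" "det k = 1"
    then obtain W t h where x: "0 < det x" "W \<in> SLZ" "0 < t" "h \<in> SL_complex" "det h = 1" "t *\<^sub>R ((W ** x) ** h) \<in> V"
      by (auto simp: teich_saturation_def)
    obtain k' where k': "k' \<in> SL_complex" "k ** k' = mat 1" using SL_complex_inverse[OF k(1)] by blast
    have dk': "det k' = 1" using k(2) k'(2) by (metis det_I det_mul mult_1)
    have "(W ** (x ** k)) ** (k' ** h) = (W ** x) ** h"
      using k'(2) by (metis matrix_mul_assoc matrix_mul_lid)
    then show "x ** k \<in> ?C"
      unfolding teich_saturation_def using x SL_complex_mult[OF k'(1) x(4)] k(2) dk'
      by (intro CollectI conjI bexI[of _ W] exI[of _ t] bexI[of _ "k' ** h"]) (simp_all add: det_mul)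
  qed
  moreover have "?C \<notin> null_sets lebesgue"
  proof
    assume "?C \<in> null_sets lebesgue"
    then have "V \<inter> GLpos \<in> null_sets lebesgue"
      using sub open_sets_lebesgue[OF open_Int[OF V(1) open_GLpos]] null_sets_subset by blast
    then show False
      using open_not_negligible[OF open_Int[OF V(1) open_GLpos] V(2)] by (simp add: negligible_iff_null_sets)
  qed
  ultimately show ?thesis by blast
qed

text \<open>Dividing by the \<open>m\<close>-th root of the determinant is the retraction of the matrices of positive determinant onto
\<open>SL(m,\<real>)\<close>; it turns open sets of the quotient topology into open sets of matrices.\<close>

lemma open_radial_preimage:
  fixes O1 :: "(real^'m^'m::finite) set"
  assumes "open O1"
  shows "open {x \<in> GLpos. inverse (root CARD('m) (det x)) *\<^sub>R x \<in> O1}"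
proof -
  have "continuous_on GLpos (\<lambda>x :: real^'m^'m. inverse (root CARD('m) (det x)) *\<^sub>R x)"
    by (intro continuous_intros continuous_on_det) (auto simp: real_root_eq_0_iff)
  from continuous_open_preimage[OF this open_GLpos assms] show ?thesis
    by (simp add: vimage_def Int_def)
qed

lemma radial_projection:
  fixes g :: "real^'m^'m::finite"
  assumes "0 < t" "det g = 1"
  shows "inverse (root CARD('m) (det (t *\<^sub>R g))) *\<^sub>R (t *\<^sub>R g) = g"
  using assms by (simp add: det_scaleR real_root_power_cancel)

text \<open>A neighbourhood \<open>U\<close> of a torus pulls back to an open cone \<open>Q\<close> of matrices. If the orbit meets the image of a
basic open set inside \<open>Q\<close>, then it meets \<open>U\<close>.\<close>

lemma ergodic_torus_if_dense:
  fixes g :: "'n::finite realmat"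
  assumes basis: "topological_basis \<V>" and g: "det g = 1"
    and dense: "\<And>V. V \<in> \<V> \<Longrightarrow> V \<inter> GLpos \<noteq> {} \<Longrightarrow> g \<in> teich_saturation V"
  shows "ergodic_torus (teich_proj g)"
proof -
  have "I \<in> teich_top closure_of (orbit SL_int teich_act (teich_proj g))" if I: "I \<in> teich" for I
    unfolding in_closure_of topspace_teich_top
  proof (intro conjI allI impI I)
    fix U assume U: "I \<in> U \<and> openin teich_top U"
    obtain g' where g': "det g' = 1" "I = teich_proj g'" using teich_cases[OF I] by blast
    have "openin (top_of_set (carrier SL_real)) {k \<in> carrier SL_real. teich_proj k \<in> U}"
      using U by (simp add: openin_teich_top)
    then obtain O1 where O1: "open O1" "{k \<in> carrier SL_real. teich_proj k \<in> U} = carrier SL_real \<inter> O1"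
      unfolding openin_open by blast
    have O1_iff: "k \<in> O1 \<longleftrightarrow> teich_proj k \<in> U" if "det k = 1" for k
      using O1(2) that by (auto simp flip: SL_real_iff)
    define Q where "Q = {x \<in> GLpos. inverse (root CARD('n + 'n) (det x)) *\<^sub>R x \<in> O1}"
    have "open Q" unfolding Q_def by (rule open_radial_preimage[OF O1(1)])
    moreover have "g' \<in> Q"
      using radial_projection[of 1 g'] g' O1_iff[OF g'(1)] U by (simp add: Q_def)
    ultimately obtain V where V: "V \<in> \<V>" "g' \<in> V" "V \<subseteq> Q"
      using topological_basisE[OF basis] by metis
    have "V \<inter> GLpos \<noteq> {}" using V(2) g'(1) by force
    then obtain W t h where x: "W \<in> SLZ" "0 < t" "h \<in> SL_complex" "det h = 1" "t *\<^sub>R ((W ** g) ** h) \<in> V"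
      using dense[OF V(1)] by (auto simp: teich_saturation_def)
    have d: "det ((W ** g) ** h) = 1" "det (W ** g) = 1" using x g by (simp_all add: det_mul SLZ_iff)
    \<comment> \<open>Here \<open>det h = 1\<close> matters: the radial projection removes the factor \<open>t\<close> and nothing else.\<close>
    have "(W ** g) ** h \<in> O1"
      using x(5) V(3) radial_projection[OF x(2) d(1)] unfolding Q_def by auto
    then have "teich_act W (teich_proj g) \<in> U"
      using O1_iff[OF d(1)] by (simp add: teich_proj_mult_SL_complex x(3) teich_act_proj g)
    moreover have "teich_act W (teich_proj g) \<in> orbit SL_int teich_act (teich_proj g)"
      using x(1) by (auto simp: orbit_def)
    ultimately show "\<exists>y. y \<in> orbit SL_int teich_act (teich_proj g) \<and> y \<in> U" by blast
  qed
  then show ?thesis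
    unfolding ergodic_torus_def topspace_teich_top
    using closure_of_subset_topspace[of teich_top] by (force simp: topspace_teich_top)
qed

theorem nonergodic_tori_null:
  assumes n: "CARD('n::finite) \<ge> 2"
  shows "{I \<in> teich. \<not> ergodic_torus I} \<in> null_sets (teich_measure :: ('n realmat) set measure)"
proof -
  obtain \<V> :: "('n realmat) set set" where \<V>: "countable \<V>" "topological_basis \<V>"
    using ex_countable_basis by blast
  define \<V>' where "\<V>' = {V \<in> \<V>. V \<inter> GLpos \<noteq> {}}"
  have "(\<Union>V\<in>\<V>'. GLpos - teich_saturation V) \<in> null_sets lebesgue"
  proof (intro null_sets_UN')
    show "countable \<V>'" unfolding \<V>'_def using \<V>(1) by (rule countable_subset[rotated]) blast
    show "GLpos - teich_saturation V \<in> null_sets lebesgue" if "V \<in> \<V>'" for V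
      using that topological_basis_open[OF \<V>(2)] by (intro teich_saturation_conull n) (auto simp: \<V>'_def)
  qed
  moreover have "teich_cone {I \<in> teich. \<not> ergodic_torus I} \<subseteq> (\<Union>V\<in>\<V>'. GLpos - teich_saturation V)"
  proof
    fix x :: "'n realmat" assume "x \<in> teich_cone {I \<in> teich. \<not> ergodic_torus I}"
    then obtain t g where g: "0 < t" "det g = 1" "x = t *\<^sub>R g" "\<not> ergodic_torus (teich_proj g)"
      by (auto elim: teich_cone_cases)
    then obtain V where V: "V \<in> \<V>'" "g \<notin> teich_saturation V"
      using ergodic_torus_if_dense[OF \<V>(2) g(2)] unfolding \<V>'_def by blast
    have "x \<notin> teich_saturation V"
    proof
      assume "x \<in> teich_saturation V"
      then obtain W s h where "W \<in> SLZ" "0 < s" "h \<in> SL_complex" "det h = 1" "s *\<^sub>R ((W ** x) ** h) \<in> V"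
        by (auto simp: teich_saturation_def)
      then have "g \<in> teich_saturation V"
        unfolding teich_saturation_def using g
        by (intro CollectI conjI bexI[of _ W] exI[of _ "s * t"] bexI[of _ h]) (simp_all add: matrix_mult_scaleR)
      then show False using V(2) by blast
    qed
    moreover have "x \<in> GLpos" using g by (simp add: det_scaleR)
    ultimately show "x \<in> (\<Union>V\<in>\<V>'. GLpos - teich_saturation V)" using V(1) by blast
  qed
  ultimately have "teich_cone {I \<in> teich. \<not> ergodic_torus (I :: ('n realmat) set)} \<in> null_sets lebesgue"
    by (rule null_sets_completion_subset[rotated])
  then show ?thesis by (simp add: null_sets_teich_measure_iff)
qed

theorem theorem3p11:
  assumes "CARD('n::finite) \<ge> 2"
  shows "ergodic_action SL_int (teich_measure :: (real^('n + 'n)^('n + 'n)) set measure) teich_act \<and>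
         {I \<in> teich. \<not> ergodic_torus I}
           \<in> null_sets (teich_measure :: (real^('n + 'n)^('n + 'n)) set measure)"
  using ergodic_action_teich[OF assms] nonergodic_tori_null[OF assms] by blast

end
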